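(* (1) The satisfiability problem of the bimodal logic $\mathrm{K4\times S5}$ can be decided by a deterministic (multi-tape) Turing machine in space $O(n\cdot 2^{3n})$, where $n$ is the length of the input formula. (2) The satisfiability problems of the bimodal logics $\mathrm{S4\times S5}$ and $\mathrm{SSL}$ can each be decided by a deterministic (multi-tape) Turing machine in space $O(n\cdot 2^{2n})$, where $n$ is the length of the input formula.
   Context: Bimodal formulas are strings over the alphabet $\{(,),\neg,\wedge,\Box,K,x,0,1\}$ generated by $\varphi ::= \neg\varphi \mid (\varphi\wedge\varphi)\mid K\varphi\mid \Box\varphi \mid A$, where the propositional variables $A\in AT$ are the strings $x0$, $x1$, $x1w$ with $w\in\{0,1\}^+$. The length of a formula is its length as such a string. Abbreviations: $\Diamond\varphi=\neg\Box\neg\varphi$, $L\varphi=\neg K\neg\varphi$. A model is a quadruple $M=(W,\stackrel{\Diamond}{\to},\stackrel{L}{\to},\sigma)$ with $W\neq\emptyset$, two binary relations on $W$ and $\sigma:AT\to\mathcal{P}(W)$; satisfaction is defined by $w\models A$ iff $w\in\sigma(A)$, Boolean clauses as usual, $w\models\Box\varphi$ iff $v\models\varphi$ for all $v$ with $w\stackrel{\Diamond}{\to}v$, and $w\models K\varphi$ iff $v\models\varphi$ for all $v$ with $w\stackrel{L}{\to}v$. For $Y\in\{\mathrm{K4},\mathrm{S4}\}$: a $Y$-frame is $(W_1,R)$ with $R$ transitive (for K4) or reflexive and transitive (for S4); an S5-frame is $(W_2,E)$ with $E$ an equivalence relation. A $Y\times\mathrm{S5}$-product model has $W=W_1\times W_2$,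 $(v_1,v_2)\stackrel{\Diamond}{\to}(w_1,w_2)$ iff $v_1Rw_1$ and $v_2=w_2$, $(v_1,v_2)\stackrel{L}{\to}(w_1,w_2)$ iff $v_2Ew_2$ and $v_1=w_1$, and arbitrary $\sigma$. A formula is $Y\times\mathrm{S5}$-satisfiable iff it holds at some point of some $Y\times\mathrm{S5}$-product model. A cross axiom model is a model in which $\stackrel{\Diamond}{\to}$ is a preorder, $\stackrel{L}{\to}$ is an equivalence relation, left commutativity holds ($\forall w,u,u'$: if $w\stackrel{\Diamond}{\to}u$ and $u\stackrel{L}{\to}u'$ then there is $w'$ with $w\stackrel{L}{\to}w'$ and $w'\stackrel{\Diamond}{\to}u'$), and $w\stackrel{\Diamond}{\to}v$ implies ($w\in\sigma(A)\iff v\in\sigma(A)$) for all $A\in AT$. A formula is $\mathrm{SSL}$-satisfiable iff it holds at some point of some cross axiom model. The satisfiability problem of a logic is the set of (strings of) formulas satisfiable in that logic. *)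

theory Defs
  imports "HOL-Library.Landau_Symbols" "HOL-Library.Countable_Set" "HOL-Library.Infinite_Typeclass"
begin

section \<open>Bimodal formulas as strings\<close>

datatype letter = LPar | RPar | NegL | AndL | BoxL | KL | XL | ZeroL | OneL

text \<open>\<open>X0\<close> is the variable \<open>x0\<close>, and \<open>X1 w\<close> is \<open>x1w\<close> with a possibly empty bit string \<open>w\<close>.\<close>

datatype atom = X0 | X1 "bool list"

datatype form = Atom atom | Neg form | Conj form form | K form | Box form

primrec atom_string :: "atom \<Rightarrow> letter list" where
  "atom_string X0 = [XL, ZeroL]"
| "atom_string (X1 w) = XL # OneL # map (\<lambda>b. if b then OneL else ZeroL) w"

primrec form_string :: "form \<Rightarrow> letter list" where
  "form_string (Atom A) = atom_string A"
| "form_string (Neg \<phi>) = NegL # form_string \<phi>"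
| "form_string (Conj \<phi> \<psi>) = LPar # form_string \<phi> @ AndL # form_string \<psi> @ [RPar]"
| "form_string (K \<phi>) = KL # form_string \<phi>"
| "form_string (Box \<phi>) = BoxL # form_string \<phi>"

section \<open>Models\<close>

record 'w model =
  worlds :: "'w set"
  dia :: "'w rel"
  lrel :: "'w rel"
  val :: "atom \<Rightarrow> 'w set"

definition is_model :: "'w model \<Rightarrow> bool" where
  "is_model M \<longleftrightarrow> worlds M \<noteq> {} \<and> dia M \<subseteq> worlds M \<times> worlds M \<and> lrel M \<subseteq> worlds M \<times> worlds M \<and>
     (\<forall>A. val M A \<subseteq> worlds M)"

primrec sat :: "'w model \<Rightarrow> 'w \<Rightarrow> form \<Rightarrow> bool" where
  "sat M w (Atom A) \<longleftrightarrow> w \<in> val M A"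
| "sat M w (Neg \<phi>) \<longleftrightarrow> \<not> sat M w \<phi>"
| "sat M w (Conj \<phi> \<psi>) \<longleftrightarrow> sat M w \<phi> \<and> sat M w \<psi>"
| "sat M w (K \<phi>) \<longleftrightarrow> (\<forall>v. (w, v) \<in> lrel M \<longrightarrow> sat M v \<phi>)"
| "sat M w (Box \<phi>) \<longleftrightarrow> (\<forall>v. (w, v) \<in> dia M \<longrightarrow> sat M v \<phi>)"

definition K4_frame :: "'a set \<Rightarrow> 'a rel \<Rightarrow> bool" where
  "K4_frame W R \<longleftrightarrow> R \<subseteq> W \<times> W \<and> trans R"

definition S4_frame :: "'a set \<Rightarrow> 'a rel \<Rightarrow> bool" where
  "S4_frame W R \<longleftrightarrow> preorder_on W R"

definition S5_frame :: "'a set \<Rightarrow> 'a rel \<Rightarrow> bool" where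
  "S5_frame W E \<longleftrightarrow> equiv W E"

definition product_model ::
  "'a set \<Rightarrow> 'a rel \<Rightarrow> 'b set \<Rightarrow> 'b rel \<Rightarrow> (atom \<Rightarrow> ('a \<times> 'b) set) \<Rightarrow> ('a \<times> 'b) model" where
  "product_model W1 R W2 E \<sigma> =
     \<lparr>worlds = W1 \<times> W2,
      dia = {((v1, v2), (w1, w2)). (v1, w1) \<in> R \<and> v2 = w2 \<and> v2 \<in> W2},
      lrel = {((v1, v2), (w1, w2)). (v2, w2) \<in> E \<and> v1 = w1 \<and> v1 \<in> W1},
      val = \<sigma>\<rparr>"

definition product_satisfiable ::
  "('a set \<Rightarrow> 'a rel \<Rightarrow> bool) \<Rightarrow> 'b itself \<Rightarrow> form \<Rightarrow> bool" where
  "product_satisfiable Y_frame (_ :: 'b itself) \<phi> \<longleftrightarrow>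
     (\<exists>W1 R (W2 :: 'b set) E \<sigma>. Y_frame W1 R \<and> S5_frame W2 E \<and>
        is_model (product_model W1 R W2 E \<sigma>) \<and>
        (\<exists>w \<in> worlds (product_model W1 R W2 E \<sigma>). sat (product_model W1 R W2 E \<sigma>) w \<phi>))"

definition cross_axiom_model :: "'w model \<Rightarrow> bool" where
  "cross_axiom_model M \<longleftrightarrow> is_model M \<and>
     preorder_on (worlds M) (dia M) \<and>
     equiv (worlds M) (lrel M) \<and>
     (\<forall>w u u'. (w, u) \<in> dia M \<and> (u, u') \<in> lrel M \<longrightarrow> (\<exists>w'. (w, w') \<in> lrel M \<and> (w', u') \<in> dia M)) \<and>
     (\<forall>w v A. (w, v) \<in> dia M \<longrightarrow> (w \<in> val M A \<longleftrightarrow> v \<in> val M A))"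

definition SSL_satisfiable :: "'w itself \<Rightarrow> form \<Rightarrow> bool" where
  "SSL_satisfiable (_ :: 'w itself) \<phi> \<longleftrightarrow>
     (\<exists>M :: 'w model. cross_axiom_model M \<and> (\<exists>w \<in> worlds M. sat M w \<phi>))"

text \<open>
  HOL cannot quantify over all types inside a definition, so the satisfiability problems carry the
  types from which the worlds are drawn; the carriers are arbitrary nonempty sets over these types.
  For infinite types the problems do not depend on the choice and contain every formula that is
  satisfiable over any types whatsoever: see \<open>K4_S5_SAT_universal\<close>, \<open>S4_S5_SAT_universal\<close> and
  \<open>SSL_SAT_universal\<close> below.
\<close>

definition K4_S5_SAT :: "'a itself \<Rightarrow> 'b itself \<Rightarrow> letter list set" where
  "K4_S5_SAT (_ :: 'a itself) TB =
     {form_string \<phi> |\<phi>. product_satisfiable (K4_frame :: 'a set \<Rightarrow> 'a rel \<Rightarrow> bool) TB \<phi>}"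

definition S4_S5_SAT :: "'a itself \<Rightarrow> 'b itself \<Rightarrow> letter list set" where
  "S4_S5_SAT (_ :: 'a itself) TB =
     {form_string \<phi> |\<phi>. product_satisfiable (S4_frame :: 'a set \<Rightarrow> 'a rel \<Rightarrow> bool) TB \<phi>}"

definition SSL_SAT :: "'w itself \<Rightarrow> letter list set" where
  "SSL_SAT TW = {form_string \<phi> |\<phi>. SSL_satisfiable TW \<phi>}"

section \<open>Independence of the universe types\<close>

instance atom :: countable by countable_datatype
instance form :: countable by countable_datatype

lemma countable_closure:
  fixes G :: "'x \<Rightarrow> 'x \<Rightarrow> 'x \<Rightarrow> 'i::countable \<Rightarrow> 'x"
  assumes x0: "x0 \<in> W"
    and G: "\<And>x y z i. x \<in> W \<Longrightarrow> y \<in> W \<Longrightarrow> z \<in> W \<Longrightarrow> G x y z i \<in> W"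
  obtains C where "countable C" "x0 \<in> C" "C \<subseteq> W"
    "\<And>x y z i. x \<in> C \<Longrightarrow> y \<in> C \<Longrightarrow> z \<in> C \<Longrightarrow> G x y z i \<in> C"
proof -
  define S where "S = rec_nat {x0}
    (\<lambda>_ X. X \<union> (\<lambda>(x, y, z, i). G x y z i) ` (X \<times> X \<times> X \<times> (UNIV :: 'i set)))"
  have S0: "S 0 = {x0}"
    and SS: "S (Suc n) = S n \<union> (\<lambda>(x, y, z, i). G x y z i) ` (S n \<times> S n \<times> S n \<times> UNIV)" for n
    by (simp_all add: S_def)
  have c: "countable (S n)" for n
    by (induction n) (auto simp: S0 SS)
  have sub: "S n \<subseteq> W" for n
    by (induction n) (auto simp: S0 SS x0 intro!: G)
  have mono: "m \<le> n \<Longrightarrow> S m \<subseteq> S n" for m n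
    by (rule lift_Suc_mono_le) (auto simp: SS)
  have cl: "G x y z i \<in> (\<Union>n. S n)" if xyz: "x \<in> (\<Union>n. S n)" "y \<in> (\<Union>n. S n)" "z \<in> (\<Union>n. S n)" for x y z i
  proof -
    from xyz obtain a b c where abc: "x \<in> S a" "y \<in> S b" "z \<in> S c" by auto
    define m where "m = max a (max b c)"
    have "x \<in> S m" "y \<in> S m" "z \<in> S m"
      using abc mono[of a m] mono[of b m] mono[of c m] unfolding m_def by (meson max.cobounded1 max.cobounded2 max.coboundedI2 subsetD)+
    then have "(x, y, z, i) \<in> S m \<times> S m \<times> S m \<times> UNIV" by simp
    from imageI[OF this, of "\<lambda>(x, y, z, i). G x y z i"] have "G x y z i \<in> S (Suc m)"
      unfolding SS by simp
    then show ?thesis by blast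
  qed
  show ?thesis
  proof (rule that)
    show "countable (\<Union>n. S n)" using c by simp
    show "x0 \<in> (\<Union>n. S n)" using S0 by blast
    show "(\<Union>n. S n) \<subseteq> W" using sub by blast
  qed (rule cl)
qed

lemma countable_copy:
  assumes "countable C"
  obtains V :: "'a::infinite set" and g :: "'a \<Rightarrow> 'c" where "bij_betw g V C"
proof -
  obtain h :: "nat \<Rightarrow> 'a" where h: "inj h"
    using infinite_countable_subset[OF infinite_UNIV] by blast
  have "inj_on (h \<circ> to_nat_on C) C"
    by (intro comp_inj_on inj_on_to_nat_on assms inj_on_subset[OF h]) auto
  then have "bij_betw (h \<circ> to_nat_on C) C ((h \<circ> to_nat_on C) ` C)"
    by (rule inj_on_imp_bij_betw)
  then show ?thesis using that bij_betw_inv_into by blast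
qed

lemma sat_reflect:
  assumes W: "dia N \<subseteq> worlds N \<times> worlds N" "lrel N \<subseteq> worlds N \<times> worlds N"
    and val: "\<And>w A. w \<in> worlds N \<Longrightarrow> w \<in> val N A \<longleftrightarrow> g w \<in> val M A"
    and dia: "\<And>w v. (w, v) \<in> dia N \<Longrightarrow> (g w, g v) \<in> dia M"
    and lrel: "\<And>w v. (w, v) \<in> lrel N \<Longrightarrow> (g w, g v) \<in> lrel M"
    and dia': "\<And>w \<phi>. w \<in> worlds N \<Longrightarrow> \<not> sat M (g w) (Box \<phi>) \<Longrightarrow> \<exists>v. (w, v) \<in> dia N \<and> \<not> sat M (g v) \<phi>"
    and lrel': "\<And>w \<phi>. w \<in> worlds N \<Longrightarrow> \<not> sat M (g w) (K \<phi>) \<Longrightarrow> \<exists>v. (w, v) \<in> lrel N \<and> \<not> sat M (g v) \<phi>"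
  shows "w \<in> worlds N \<Longrightarrow> sat N w \<phi> \<longleftrightarrow> sat M (g w) \<phi>"
proof (induction \<phi> arbitrary: w)
  case (K \<phi>)
  have IH: "(w, v) \<in> lrel N \<Longrightarrow> sat N v \<phi> \<longleftrightarrow> sat M (g v) \<phi>" for v
    using K.IH W by blast
  show ?case
  proof
    assume "sat N w (K \<phi>)"
    then show "sat M (g w) (K \<phi>)" using lrel'[OF K.prems, of \<phi>] IH by auto
  next
    assume "sat M (g w) (K \<phi>)"
    then show "sat N w (K \<phi>)" using lrel IH by auto
  qed
next
  case (Box \<phi>)
  have IH: "(w, v) \<in> dia N \<Longrightarrow> sat N v \<phi> \<longleftrightarrow> sat M (g v) \<phi>" for v
    using Box.IH W by blast
  show ?case
  proof
    assume "sat N w (Box \<phi>)"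
    then show "sat M (g w) (Box \<phi>)" using dia'[OF Box.prems, of \<phi>] IH by auto
  next
    assume "sat M (g w) (Box \<phi>)"
    then show "sat N w (Box \<phi>)" using dia IH by auto
  qed
qed (use val in auto)

text \<open>A choice of worlds refuting \<open>\<phi>\<close> whenever \<open>Box \<phi>\<close> or \<open>K \<phi>\<close> fails.\<close>

definition box_witness :: "'w model \<Rightarrow> 'w \<Rightarrow> form \<Rightarrow> 'w" where
  "box_witness M w \<phi> = (if sat M w (Box \<phi>) then w else SOME v. (w, v) \<in> dia M \<and> \<not> sat M v \<phi>)"

definition K_witness :: "'w model \<Rightarrow> 'w \<Rightarrow> form \<Rightarrow> 'w" where
  "K_witness M w \<phi> = (if sat M w (K \<phi>) then w else SOME v. (w, v) \<in> lrel M \<and> \<not> sat M v \<phi>)"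

lemma box_witness:
  assumes "\<not> sat M w (Box \<phi>)"
  shows "(w, box_witness M w \<phi>) \<in> dia M \<and> \<not> sat M (box_witness M w \<phi>) \<phi>"
  using assms someI_ex[of "\<lambda>v. (w, v) \<in> dia M \<and> \<not> sat M v \<phi>"] by (auto simp: box_witness_def)

lemma K_witness:
  assumes "\<not> sat M w (K \<phi>)"
  shows "(w, K_witness M w \<phi>) \<in> lrel M \<and> \<not> sat M (K_witness M w \<phi>) \<phi>"
  using assms someI_ex[of "\<lambda>v. (w, v) \<in> lrel M \<and> \<not> sat M v \<phi>"] by (auto simp: K_witness_def)

lemma box_witness_in: "is_model M \<Longrightarrow> w \<in> worlds M \<Longrightarrow> box_witness M w \<phi> \<in> worlds M"
  using box_witness[of M w \<phi>] unfolding is_model_def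
  by (cases "sat M w (Box \<phi>)") (simp add: box_witness_def, blast)

lemma K_witness_in: "is_model M \<Longrightarrow> w \<in> worlds M \<Longrightarrow> K_witness M w \<phi> \<in> worlds M"
  using K_witness[of M w \<phi>] unfolding is_model_def
  by (cases "sat M w (K \<phi>)") (simp add: K_witness_def, blast)

definition pullback :: "('a \<Rightarrow> 'c) \<Rightarrow> 'a set \<Rightarrow> 'c rel \<Rightarrow> 'a rel" where
  "pullback g V R = {(x, y). x \<in> V \<and> y \<in> V \<and> (g x, g y) \<in> R}"

lemma pullback_equiv: "equiv W E \<Longrightarrow> g ` V \<subseteq> W \<Longrightarrow> equiv V (pullback g V E)"
  unfolding equiv_def pullback_def refl_on_def sym_on_def trans_on_def by blast

lemma pullback_K4: "K4_frame W R \<Longrightarrow> K4_frame V (pullback g V R)"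
  unfolding K4_frame_def pullback_def trans_on_def by blast

lemma pullback_S4: "S4_frame W R \<Longrightarrow> g ` V \<subseteq> W \<Longrightarrow> S4_frame V (pullback g V R)"
  unfolding S4_frame_def preorder_on_def pullback_def refl_on_def trans_on_def by blast

lemma product_universal:
  fixes Y :: "'c set \<Rightarrow> 'c rel \<Rightarrow> bool" and Y' :: "'a::infinite set \<Rightarrow> 'a rel \<Rightarrow> bool"
  assumes Y: "\<And>W R V g. Y W R \<Longrightarrow> g ` V \<subseteq> W \<Longrightarrow> Y' V (pullback g V R)"
    and sat: "product_satisfiable Y TYPE('d) \<phi>"
  shows "product_satisfiable Y' TYPE('b::infinite) \<phi>"
proof -
  from sat obtain W1 R and W2 :: "'d set" and E \<sigma> w0 where
    fr: "Y W1 R" "S5_frame W2 E" and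
    mod: "is_model (product_model W1 R W2 E \<sigma>)" (is "is_model ?M") and
    w0: "w0 \<in> worlds (product_model W1 R W2 E \<sigma>)" and s: "sat (product_model W1 R W2 E \<sigma>) w0 \<phi>"
    unfolding product_satisfiable_def by blast
  define G where "G x (y :: 'c \<times> 'd) (z :: 'c \<times> 'd) (i :: form \<times> nat) =
    (if snd i = 0 then box_witness ?M x (fst i) else if snd i = 1 then K_witness ?M x (fst i)
     else (fst x, snd y))" for x y z i
  have WM: "worlds ?M = W1 \<times> W2" by (simp add: product_model_def)
  obtain C where C: "countable C" "w0 \<in> C" "C \<subseteq> worlds ?M"
    and cl: "\<And>x y z i. x \<in> C \<Longrightarrow> y \<in> C \<Longrightarrow> z \<in> C \<Longrightarrow> G x y z i \<in> C"
  proof (rule countable_closure[of w0 "worlds ?M" G])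
    show "G x y z i \<in> worlds ?M" if "x \<in> worlds ?M" "y \<in> worlds ?M" "z \<in> worlds ?M" for x y z i
      using that box_witness_in[OF mod] K_witness_in[OF mod] unfolding G_def WM by auto
  qed (use w0 in auto)
  have Cprod: "(a, b) \<in> C" if "a \<in> fst ` C" "b \<in> snd ` C" for a b
  proof -
    from that obtain x y where "x \<in> C" "y \<in> C" "a = fst x" "b = snd y" by auto
    then show ?thesis using cl[of x y x "(undefined, 2)"] by (simp add: G_def)
  qed
  have Cbox: "x \<in> C \<Longrightarrow> box_witness ?M x \<psi> \<in> C" for x \<psi>
    using cl[of x x x "(\<psi>, 0)"] by (simp add: G_def)
  have CK: "x \<in> C \<Longrightarrow> K_witness ?M x \<psi> \<in> C" for x \<psi>
    using cl[of x x x "(\<psi>, 1)"] by (simp add: G_def)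
  obtain V1 :: "'a set" and g1 where g1: "bij_betw g1 V1 (fst ` C)"
    by (rule countable_copy[of "fst ` C"]) (use C in auto)
  obtain V2 :: "'b set" and g2 where g2: "bij_betw g2 V2 (snd ` C)"
    by (rule countable_copy[of "snd ` C"]) (use C in auto)
  define g where "g = map_prod g1 g2"
  have im: "g1 ` V1 = fst ` C" "g2 ` V2 = snd ` C"
    using g1 g2 by (auto simp: bij_betw_def)
  have sub: "g1 ` V1 \<subseteq> W1" "g2 ` V2 \<subseteq> W2" using C(3) unfolding im WM by auto
  have gC: "g x \<in> C" if "x \<in> V1 \<times> V2" for x
  proof -
    have "g1 (fst x) \<in> fst ` C" "g2 (snd x) \<in> snd ` C" using that unfolding im[symmetric] by auto
    from Cprod[OF this] show ?thesis by (simp add: g_def map_prod_def case_prod_beta)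
  qed
  have surj: "\<exists>x \<in> V1 \<times> V2. g x = c" if "c \<in> C" for c
  proof -
    have "fst c \<in> g1 ` V1" "snd c \<in> g2 ` V2" using that im by auto
    then obtain a b where "a \<in> V1" "b \<in> V2" "g1 a = fst c" "g2 b = snd c" by auto
    then show ?thesis by (intro bexI[of _ "(a, b)"]) (auto simp: g_def)
  qed
  define \<tau> where "\<tau> A = {x \<in> V1 \<times> V2. g x \<in> \<sigma> A}" for A
  define N where "N = product_model V1 (pullback g1 V1 R) V2 (pullback g2 V2 E) \<tau>"
  have WN: "worlds N = V1 \<times> V2" and valN: "val N = \<tau>" by (simp_all add: N_def product_model_def)
  have inj: "inj_on g1 V1" "inj_on g2 V2" using g1 g2 by (auto simp: bij_betw_def)
  have dN: "(x, y) \<in> dia N \<longleftrightarrow> x \<in> V1 \<times> V2 \<and> y \<in> V1 \<times> V2 \<and> (g x, g y) \<in> dia ?M" for x y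
    using inj sub by (cases x; cases y) (auto simp: N_def product_model_def g_def pullback_def inj_on_eq_iff)
  have lN: "(x, y) \<in> lrel N \<longleftrightarrow> x \<in> V1 \<times> V2 \<and> y \<in> V1 \<times> V2 \<and> (g x, g y) \<in> lrel ?M" for x y
    using inj sub by (cases x; cases y) (auto simp: N_def product_model_def g_def pullback_def inj_on_eq_iff)
  have refl: "w \<in> worlds N \<Longrightarrow> sat N w \<psi> \<longleftrightarrow> sat ?M (g w) \<psi>" for w \<psi>
  proof (rule sat_reflect)
    fix w A assume "w \<in> worlds N"
    then show "w \<in> val N A \<longleftrightarrow> g w \<in> val ?M A"
      unfolding valN WN \<tau>_def by (simp add: product_model_def)
  next
    fix w \<psi> assume w: "w \<in> worlds N" and n: "\<not> sat ?M (g w) (Box \<psi>)"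
    obtain x where x: "x \<in> V1 \<times> V2" "g x = box_witness ?M (g w) \<psi>"
      using surj[OF Cbox[OF gC]] w unfolding WN by blast
    show "\<exists>v. (w, v) \<in> dia N \<and> \<not> sat ?M (g v) \<psi>"
      using x w box_witness[OF n] dN unfolding WN by metis
  next
    fix w \<psi> assume w: "w \<in> worlds N" and n: "\<not> sat ?M (g w) (K \<psi>)"
    obtain x where x: "x \<in> V1 \<times> V2" "g x = K_witness ?M (g w) \<psi>"
      using surj[OF CK[OF gC]] w unfolding WN by blast
    show "\<exists>v. (w, v) \<in> lrel N \<and> \<not> sat ?M (g v) \<psi>"
      using x w K_witness[OF n] lN unfolding WN by metis
  qed (auto simp: dN lN WN)
  obtain x where x: "x \<in> V1 \<times> V2" "g x = w0" using surj[OF C(2)] by blast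
  have "is_model N" using x(1) dN lN unfolding is_model_def WN valN \<tau>_def by auto
  moreover have "sat N x \<phi>" using refl[of x \<phi>] x s unfolding WN by simp
  moreover have "Y' V1 (pullback g1 V1 R)" using Y fr(1) sub(1) by blast
  moreover have "S5_frame V2 (pullback g2 V2 E)"
    using pullback_equiv fr(2) sub(2) unfolding S5_frame_def by blast
  moreover have "x \<in> worlds N" using x WN by simp
  ultimately show ?thesis unfolding product_satisfiable_def N_def by blast
qed

lemma SSL_universal:
  assumes "SSL_satisfiable TYPE('v) \<phi>"
  shows "SSL_satisfiable TYPE('w::infinite) \<phi>"
proof -
  from assms obtain M :: "'v model" and w0 where
    cam: "cross_axiom_model M" and w0: "w0 \<in> worlds M" and s: "sat M w0 \<phi>"
    unfolding SSL_satisfiable_def by blast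
  have mod: "is_model M" using cam by (simp add: cross_axiom_model_def)
  define P where "P w (u :: 'v) u' w' \<longleftrightarrow> (w, w') \<in> lrel M \<and> (w', u') \<in> dia M" for w u u' w'
  define lc where "lc w u u' = (if (w, u) \<in> dia M \<and> (u, u') \<in> lrel M then SOME w'. P w u u' w' else w)" for w u u'
  have lc: "P w u u' (lc w u u')" if "(w, u) \<in> dia M" "(u, u') \<in> lrel M" for w u u'
  proof -
    have "\<exists>w'. P w u u' w'" using cam that unfolding cross_axiom_model_def P_def by blast
    then show ?thesis using that someI_ex[of "P w u u'"] by (simp add: lc_def)
  qed
  have lc_in: "lc w u u' \<in> worlds M" if "w \<in> worlds M" for w u u'
    using lc[of w u u'] that mod unfolding lc_def P_def is_model_def
    by (cases "(w, u) \<in> dia M \<and> (u, u') \<in> lrel M") auto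
  define G where "G x y z (i :: form \<times> nat) =
    (if snd i = 0 then box_witness M x (fst i) else if snd i = 1 then K_witness M x (fst i)
     else lc x y z)" for x y z i
  obtain C where C: "countable C" "w0 \<in> C" "C \<subseteq> worlds M"
    and cl: "\<And>x y z i. x \<in> C \<Longrightarrow> y \<in> C \<Longrightarrow> z \<in> C \<Longrightarrow> G x y z i \<in> C"
  proof (rule countable_closure[of w0 "worlds M" G])
    show "G x y z i \<in> worlds M" if "x \<in> worlds M" "y \<in> worlds M" "z \<in> worlds M" for x y z i
      using that box_witness_in[OF mod] K_witness_in[OF mod] lc_in unfolding G_def by auto
  qed (use w0 in auto)
  have Cbox: "x \<in> C \<Longrightarrow> box_witness M x \<psi> \<in> C" for x \<psi>
    using cl[of x x x "(\<psi>, 0)"] by (simp add: G_def)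
  have CK: "x \<in> C \<Longrightarrow> K_witness M x \<psi> \<in> C" for x \<psi>
    using cl[of x x x "(\<psi>, 1)"] by (simp add: G_def)
  have Clc: "x \<in> C \<Longrightarrow> y \<in> C \<Longrightarrow> z \<in> C \<Longrightarrow> lc x y z \<in> C" for x y z
    using cl[of x y z "(undefined, 2)"] by (simp add: G_def)
  obtain V :: "'w set" and g where g: "bij_betw g V C"
    by (rule countable_copy[OF C(1)])
  have im: "g ` V = C" using g by (auto simp: bij_betw_def)
  have gC: "x \<in> V \<Longrightarrow> g x \<in> C" for x using im by blast
  have surj: "\<exists>x \<in> V. g x = c" if "c \<in> C" for c using im that by blast
  define N where "N = \<lparr>worlds = V, dia = pullback g V (dia M), lrel = pullback g V (lrel M),
    val = (\<lambda>A. {x \<in> V. g x \<in> val M A})\<rparr>"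
  have WN: "worlds N = V" and valN: "val N A = {x \<in> V. g x \<in> val M A}" for A
    by (simp_all add: N_def)
  have dN: "(x, y) \<in> dia N \<longleftrightarrow> x \<in> V \<and> y \<in> V \<and> (g x, g y) \<in> dia M" for x y
    by (simp add: N_def pullback_def)
  have lN: "(x, y) \<in> lrel N \<longleftrightarrow> x \<in> V \<and> y \<in> V \<and> (g x, g y) \<in> lrel M" for x y
    by (simp add: N_def pullback_def)
  have refl: "w \<in> worlds N \<Longrightarrow> sat N w \<psi> \<longleftrightarrow> sat M (g w) \<psi>" for w \<psi>
  proof (rule sat_reflect)
    fix w \<psi> assume w: "w \<in> worlds N" and n: "\<not> sat M (g w) (Box \<psi>)"
    obtain x where x: "x \<in> V" "g x = box_witness M (g w) \<psi>"
      using surj[OF Cbox[OF gC]] w unfolding WN by blast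
    show "\<exists>v. (w, v) \<in> dia N \<and> \<not> sat M (g v) \<psi>"
      using x w box_witness[OF n] dN unfolding WN by metis
  next
    fix w \<psi> assume w: "w \<in> worlds N" and n: "\<not> sat M (g w) (K \<psi>)"
    obtain x where x: "x \<in> V" "g x = K_witness M (g w) \<psi>"
      using surj[OF CK[OF gC]] w unfolding WN by blast
    show "\<exists>v. (w, v) \<in> lrel N \<and> \<not> sat M (g v) \<psi>"
      using x w K_witness[OF n] lN unfolding WN by metis
  qed (auto simp: dN lN WN valN)
  obtain x where x: "x \<in> V" "g x = w0" using surj[OF C(2)] by blast
  have isN: "is_model N" using x(1) dN lN unfolding is_model_def WN valN by auto
  have "cross_axiom_model N"
    unfolding cross_axiom_model_def
  proof (intro conjI allI impI)
    have "S4_frame (worlds M) (dia M)"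
      using cam by (simp add: S4_frame_def cross_axiom_model_def)
    then show "preorder_on (worlds N) (dia N)"
      using pullback_S4[of "worlds M" "dia M" g V] im C(3) by (simp add: S4_frame_def N_def)
    show "equiv (worlds N) (lrel N)"
      using cam C(3) pullback_equiv[of "worlds M" "lrel M" g V] im
      by (auto simp: cross_axiom_model_def N_def)
  next
    fix w u u' assume h: "(w, u) \<in> dia N \<and> (u, u') \<in> lrel N"
    then have *: "(g w, g u) \<in> dia M" "(g u, g u') \<in> lrel M" "w \<in> V" "u \<in> V" "u' \<in> V"
      unfolding dN lN by auto
    obtain w' where "w' \<in> V" "g w' = lc (g w) (g u) (g u')"
      using surj[OF Clc[OF gC gC gC]] * by blast
    then show "\<exists>w'. (w, w') \<in> lrel N \<and> (w', u') \<in> dia N"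
      using lc[OF *(1,2)] * unfolding P_def dN lN by metis
  next
    fix w v A assume "(w, v) \<in> dia N"
    then show "w \<in> val N A \<longleftrightarrow> v \<in> val N A"
      using cam unfolding cross_axiom_model_def dN valN by blast
  qed (rule isN)
  moreover have "sat N x \<phi>" using refl[of x \<phi>] x s unfolding WN by simp
  ultimately show ?thesis using x WN unfolding SSL_satisfiable_def by blast
qed

theorem K4_S5_SAT_universal:
  "K4_S5_SAT TYPE('c) TYPE('d) \<subseteq> K4_S5_SAT TYPE('a::infinite) TYPE('b::infinite)"
proof -
  have "product_satisfiable (K4_frame :: 'c set \<Rightarrow> _) TYPE('d) \<phi> \<Longrightarrow>
      product_satisfiable (K4_frame :: 'a set \<Rightarrow> _) TYPE('b) \<phi>" for \<phi>
    by (erule product_universal[rotated]) (rule pullback_K4)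
  then show ?thesis unfolding K4_S5_SAT_def by blast
qed

theorem S4_S5_SAT_universal:
  "S4_S5_SAT TYPE('c) TYPE('d) \<subseteq> S4_S5_SAT TYPE('a::infinite) TYPE('b::infinite)"
proof -
  have "product_satisfiable (S4_frame :: 'c set \<Rightarrow> _) TYPE('d) \<phi> \<Longrightarrow>
      product_satisfiable (S4_frame :: 'a set \<Rightarrow> _) TYPE('b) \<phi>" for \<phi>
    by (erule product_universal[rotated]) (rule pullback_S4)
  then show ?thesis unfolding S4_S5_SAT_def by blast
qed

theorem SSL_SAT_universal: "SSL_SAT TYPE('v) \<subseteq> SSL_SAT TYPE('w::infinite)"
proof -
  have "SSL_satisfiable TYPE('v) \<phi> \<Longrightarrow> SSL_satisfiable TYPE('w) \<phi>" for \<phi>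
    by (rule SSL_universal)
  then show ?thesis unfolding SSL_SAT_def by blast
qed

section \<open>Deterministic multi-tape Turing machines\<close>

datatype 'i tape_symbol = Blank | Input 'i | Aux nat

datatype move = MoveL | Stay | MoveR

fun offset :: "move \<Rightarrow> int" where
  "offset MoveL = - 1"
| "offset Stay = 0"
| "offset MoveR = 1"

text \<open>
  The transition function maps a state and the list of scanned symbols (one per tape) to the new
  state and, for every tape, the symbol to be written and the head movement.
\<close>

record 'i tm =
  tm_tapes :: nat
  tm_states :: "nat set"
  tm_alphabet :: "'i tape_symbol set"
  tm_start :: nat
  tm_accept :: nat
  tm_reject :: nat
  tm_delta :: "nat \<Rightarrow> 'i tape_symbol list \<Rightarrow> nat \<times> ('i tape_symbol \<times> move) list"

definition turing_machine :: "'i tm \<Rightarrow> bool" where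
  "turing_machine M \<longleftrightarrow>
     tm_tapes M \<ge> 1 \<and>
     finite (tm_states M) \<and> {tm_start M, tm_accept M, tm_reject M} \<subseteq> tm_states M \<and>
     tm_accept M \<noteq> tm_reject M \<and>
     finite (tm_alphabet M) \<and> insert Blank (range Input) \<subseteq> tm_alphabet M \<and>
     (\<forall>q \<in> tm_states M. \<forall>ss \<in> lists (tm_alphabet M). length ss = tm_tapes M \<longrightarrow>
        (case tm_delta M q ss of (q', acts) \<Rightarrow>
           q' \<in> tm_states M \<and> length acts = tm_tapes M \<and> fst ` set acts \<subseteq> tm_alphabet M))"

text \<open>A tape is two-way infinite and comes with the position of its head.\<close>

type_synonym 'i tape = "(int \<Rightarrow> 'i tape_symbol) \<times> int"
type_synonym 'i config = "nat \<times> 'i tape list"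

definition tm_halted :: "'i tm \<Rightarrow> 'i config \<Rightarrow> bool" where
  "tm_halted M c \<longleftrightarrow> fst c = tm_accept M \<or> fst c = tm_reject M"

definition tm_step :: "'i tm \<Rightarrow> 'i config \<Rightarrow> 'i config" where
  "tm_step M c =
     (if tm_halted M c then c
      else case tm_delta M (fst c) (map (\<lambda>(t, h). t h) (snd c)) of (q', acts) \<Rightarrow>
        (q', map2 (\<lambda>(t, h) (s, m). (t(h := s), h + offset m)) (snd c) acts))"

definition input_tape :: "'i list \<Rightarrow> 'i tape" where
  "input_tape w = (\<lambda>p. if 0 \<le> p \<and> p < int (length w) then Input (w ! nat p) else Blank, 0)"

definition tm_init :: "'i tm \<Rightarrow> 'i list \<Rightarrow> 'i config" where
  "tm_init M w = (tm_start M, input_tape w # replicate (tm_tapes M - 1) (\<lambda>_. Blank, 0))"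

definition tm_run :: "'i tm \<Rightarrow> 'i list \<Rightarrow> nat \<Rightarrow> 'i config" where
  "tm_run M w t = (tm_step M ^^ t) (tm_init M w)"

text \<open>
  The space is the number of cells scanned during the computation, summed over all tapes, the input
  tape included. It is meaningful for halting computations only.
\<close>

definition tm_space :: "'i tm \<Rightarrow> 'i list \<Rightarrow> nat" where
  "tm_space M w = (\<Sum>i < tm_tapes M. card (range (\<lambda>t. snd (snd (tm_run M w t) ! i))))"

definition tm_decides :: "'i tm \<Rightarrow> 'i list set \<Rightarrow> bool" where
  "tm_decides M L \<longleftrightarrow>
     (\<forall>w. \<exists>t. fst (tm_run M w t) = (if w \<in> L then tm_accept M else tm_reject M))"

definition DSPACE :: "(nat \<Rightarrow> real) \<Rightarrow> 'i list set set" where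
  "DSPACE f = {L. \<exists>M s. turing_machine M \<and> tm_decides M L \<and>
     (\<forall>w. tm_space M w \<le> s (length w)) \<and> (\<lambda>n. real (s n)) \<in> O(f)}"

end

theory Submission
  imports Defs
begin

text \<open>
  Time does not matter for a space bound, so the machine may search by brute force: registers that hold
  numbers \<open>N\<close> occupy \<open>O(log N)\<close> cells, and it suffices to decide satisfiability by bounded
  recursion on numbers polynomial in \<open>2 ^ (n * 4 ^ n)\<close>.

  A formula of length \<open>n\<close> has at most \<open>2 ^ n\<close> types, and an \<open>L\<close>-class of a model is described by its
  cloud, the set of the types it realises. A formula is satisfiable iff it belongs to a type of a good
  cloud, where the good clouds form the largest set of coherent clouds in which every failing box of a
  type has a witness in a good successor cloud. The successors of a cloud only depend on its up-closure
  and its down-closure with respect to the order of types induced by boxes. The former shrinks and the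
  latter grows along successors, so at most about \<open>2 * 2 ^ n\<close> different pairs of closures occur on a path.
  A recursion along these pairs that computes, for each pair, the \<open>n * 2 ^ n\<close> bits saying which failing
  boxes can be witnessed, therefore needs a stack of \<open>O(n * 4 ^ n)\<close> bits, for all three logics.
\<close>

section \<open>Bijective base-9 numerals over the input alphabet\<close>

text \<open>A table of the good clouds would need one bit for each of the 2 ^ 2 ^ n clouds, far
  beyond the space allowed. Much less has to be remembered: a coherent cloud is good iff its flaws,
  the failing boxes of its types, are repairable, and which flaws are repairable depends only on its
  key, the pair of closures. A path may visit many clouds with the same key, so the recursion cannot
  simply descend from cloud to cloud. All clouds sharing a key are treated at once by guessing a
  self-supporting vector of n * 2 ^ n repairable flaws; the recursion goes down only when the key
  loses one of its 2 * 2 ^ n bits. This gives at most 2 * 2 ^ n + 1 stack frames of three numbers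
  with O(n * 2 ^ n) bits each, hence n * 4 ^ n. The two closures come from the two commutation laws:
  left commutativity puts every type of a successor cloud above a type of the cloud, and right
  commutativity, which holds in products but not in cross axiom models in general, puts every type
  of the cloud below a type of the successor.\<close>

fun digit_val :: "letter \<Rightarrow> nat" where
  "digit_val LPar = 1" | "digit_val RPar = 2" | "digit_val NegL = 3" | "digit_val AndL = 4"
| "digit_val BoxL = 5" | "digit_val KL = 6" | "digit_val XL = 7" | "digit_val ZeroL = 8"
| "digit_val OneL = 9"

fun next_digit :: "letter \<Rightarrow> letter" where
  "next_digit LPar = RPar" | "next_digit RPar = NegL" | "next_digit NegL = AndL"
| "next_digit AndL = BoxL" | "next_digit BoxL = KL" | "next_digit KL = XL"
| "next_digit XL = ZeroL" | "next_digit ZeroL = OneL" | "next_digit OneL = LPar"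

fun prev_digit :: "letter \<Rightarrow> letter" where
  "prev_digit LPar = OneL" | "prev_digit RPar = LPar" | "prev_digit NegL = RPar"
| "prev_digit AndL = NegL" | "prev_digit BoxL = AndL" | "prev_digit KL = BoxL"
| "prev_digit XL = KL" | "prev_digit ZeroL = XL" | "prev_digit OneL = ZeroL"

text \<open>With digits 1 to 9 and no zero, each string denotes its own number. The input tape is
  therefore a register as it stands. The least significant digit comes first.\<close>

fun num_val :: "letter list \<Rightarrow> nat" where
  "num_val [] = 0"
| "num_val (d # ds) = digit_val d + 9 * num_val ds"

fun num_inc :: "letter list \<Rightarrow> letter list" where
  "num_inc [] = [LPar]"
| "num_inc (d # ds) = (if d = OneL then LPar # num_inc ds else next_digit d # ds)"

text \<open>Borrowing turns a 1 into a 9, except that a leading 1 disappears, there being no digit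
  0. The empty numeral stays empty, which is truncated subtraction.\<close>

fun num_dec :: "letter list \<Rightarrow> letter list" where
  "num_dec [] = []"
| "num_dec (d # ds) =
     (if d = LPar then (if ds = [] then [] else OneL # num_dec ds) else prev_digit d # ds)"

lemma digit_val_bounds: "1 \<le> digit_val d" "digit_val d \<le> 9"
  by (cases d; simp)+

lemma digit_val_inject: "digit_val d = digit_val d' \<longleftrightarrow> d = d'"
  by (cases d; cases d'; simp)

lemma digit_val_next: "d \<noteq> OneL \<Longrightarrow> digit_val (next_digit d) = Suc (digit_val d)"
  by (cases d; simp)

lemma digit_val_prev: "d \<noteq> LPar \<Longrightarrow> digit_val d = Suc (digit_val (prev_digit d))"
  by (cases d; simp)

lemma num_val_eq_0_iff: "num_val ds = 0 \<longleftrightarrow> ds = []"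
  using digit_val_bounds by (cases ds) (auto simp: not_less_eq_eq Suc_le_eq)

lemma num_val_inc: "num_val (num_inc ds) = Suc (num_val ds)"
  by (induction ds) (auto simp: digit_val_next)

lemma num_val_dec: "num_val (num_dec ds) = num_val ds - 1"
proof (induction ds)
  case (Cons d ds)
  show ?case
    using Cons num_val_eq_0_iff[of ds] digit_val_prev[of d]
    by (cases "d = LPar"; cases "ds = []"; cases "num_val ds") auto
qed simp

lemma num_val_inject: "num_val xs = num_val ys \<longleftrightarrow> xs = ys"
proof
  show "num_val xs = num_val ys \<Longrightarrow> xs = ys"
  proof (induction xs arbitrary: ys)
    case Nil
    then show ?case using num_val_eq_0_iff[of ys] by simp
  next
    case (Cons d ds)
    then obtain d' ds' where ys: "ys = d' # ds'"
      using num_val_eq_0_iff[of "d # ds"] by (cases ys) auto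
    have "digit_val d + 9 * num_val ds = digit_val d' + 9 * num_val ds'"
      using Cons.prems ys by simp
    moreover have "1 \<le> digit_val d" "digit_val d \<le> 9" "1 \<le> digit_val d'" "digit_val d' \<le> 9"
      by (rule digit_val_bounds)+
    ultimately have "digit_val d = digit_val d'" "num_val ds = num_val ds'" by presburger+
    then show ?case using Cons.IH ys digit_val_inject by blast
  qed
qed simp

definition numeral_of :: "nat \<Rightarrow> letter list" where
  "numeral_of k = (num_inc ^^ k) []"

lemma num_val_numeral_of [simp]: "num_val (numeral_of k) = k"
  by (induction k) (simp_all add: numeral_of_def num_val_inc)

lemma numeral_of_num_val [simp]: "numeral_of (num_val ds) = ds"
  using num_val_inject num_val_numeral_of by blast

lemma num_inc_numeral_of: "num_inc (numeral_of k) = numeral_of (Suc k)"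
  by (simp add: numeral_of_def)

lemma num_dec_numeral_of: "num_dec (numeral_of k) = numeral_of (k - 1)"
  by (metis num_val_dec num_val_numeral_of numeral_of_num_val)

lemma numeral_of_eq_Nil: "numeral_of k = [] \<longleftrightarrow> k = 0"
  by (metis num_val_eq_0_iff num_val_numeral_of)

text \<open>This ties space to size: digits are at least 1, so long numerals denote large numbers,
  and a value below 2 ^ H fits into H cells.\<close>

lemma power_length_le_num_val: "2 ^ length ds \<le> num_val ds + 1"
proof (induction ds)
  case (Cons d ds)
  then show ?case using digit_val_bounds(1)[of d] by simp
qed simp

lemma length_numeral_of_le: "k < 2 ^ H \<Longrightarrow> length (numeral_of k) \<le> H"
  using power_length_le_num_val[of "numeral_of k"]
  by (simp) (meson Suc_leI le_trans one_less_numeral_iff power_le_imp_le_exp semiring_norm(76))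

section \<open>Counter programs and their Turing machines\<close>

datatype prog = Skip | Inc nat | Dec nat | Seq prog prog | While nat prog

instance prog :: countable by countable_datatype

text \<open>All values that arise are at most \<open>B\<close>: the bound is checked at every increment.\<close>

inductive exec :: "nat \<Rightarrow> prog \<Rightarrow> (nat \<Rightarrow> nat) \<Rightarrow> (nat \<Rightarrow> nat) \<Rightarrow> bool" for B where
  Skip: "exec B Skip s s"
| Inc: "s r < B \<Longrightarrow> exec B (Inc r) s (s(r := Suc (s r)))"
| Dec: "exec B (Dec r) s (s(r := s r - 1))"
| Seq: "exec B a s s' \<Longrightarrow> exec B b s' s'' \<Longrightarrow> exec B (Seq a b) s s''"
| While0: "s r = 0 \<Longrightarrow> exec B (While r a) s s"
| While1: "s r \<noteq> 0 \<Longrightarrow> exec B a s s' \<Longrightarrow> exec B (While r a) s' s'' \<Longrightarrow> exec B (While r a) s s''"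

lemma exec_le: "exec B p s s' \<Longrightarrow> s' r \<le> max B (s r)"
  by (induction rule: exec.induct) (auto simp: le_max_iff_disj)

lemma exec_bounded: "exec B p s s' \<Longrightarrow> \<forall>i. s i \<le> B \<Longrightarrow> \<forall>i. s' i \<le> B"
  using exec_le by fastforce

primrec regs :: "prog \<Rightarrow> nat set" where
  "regs Skip = {}"
| "regs (Inc r) = {r}"
| "regs (Dec r) = {r}"
| "regs (Seq a b) = regs a \<union> regs b"
| "regs (While r a) = insert r (regs a)"

lemma finite_regs: "finite (regs p)"
  by (induction p) auto

text \<open>A state carries the remaining work as a list of programs. The four phases of a register
  operation also record the register they work on.\<close>

datatype ctrl = Run "prog list" | Carry nat "prog list" | Borrow nat "prog list"
  | Erase nat "prog list" | Rewind nat "prog list" | Yes | No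

instance ctrl :: countable by countable_datatype

text \<open>The action of a control state on the scanned symbols: the next state, the only tape that is
  changed, and what happens on it. A register rests with its head on the least significant digit;
  \<open>Rewind\<close> finds that digit again as the cell to the right of the first blank on the left.\<close>

fun act :: "ctrl \<Rightarrow> (nat \<Rightarrow> letter tape_symbol) \<Rightarrow> ctrl \<times> nat \<times> letter tape_symbol \<times> move" where
  "act (Run []) f = (if f 1 = Blank then No else Yes, 0, f 0, Stay)"
| "act (Run (Skip # k)) f = (Run k, 0, f 0, Stay)"
| "act (Run (Inc r # k)) f = (Carry r k, 0, f 0, Stay)"
| "act (Run (Dec r # k)) f = (if f r = Blank then Run k else Borrow r k, 0, f 0, Stay)"
| "act (Run (Seq a b # k)) f = (Run (a # b # k), 0, f 0, Stay)"
| "act (Run (While r a # k)) f =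
     (if f r = Blank then Run k else Run (a # While r a # k), 0, f 0, Stay)"
| "act (Carry r k) f = (case f r of
       Input d \<Rightarrow> if d = OneL then (Carry r k, r, Input LPar, MoveR)
                 else (Rewind r k, r, Input (next_digit d), Stay)
     | _ \<Rightarrow> (Rewind r k, r, Input LPar, Stay))"
| "act (Borrow r k) f = (case f r of
       Input d \<Rightarrow> if d = LPar then (Borrow r k, r, Input OneL, MoveR)
                 else (Rewind r k, r, Input (prev_digit d), Stay)
     | _ \<Rightarrow> (Erase r k, r, Blank, MoveL))"
| "act (Erase r k) f = (Rewind r k, r, Blank, MoveL)"
| "act (Rewind r k) f =
     (if f r = Blank then (Run k, r, Blank, MoveR) else (Rewind r k, r, f r, MoveL))"
| "act Yes f = (Yes, 0, f 0, Stay)"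
| "act No f = (No, 0, f 0, Stay)"

text \<open>The continuations that arise while \<open>p\<close> runs with \<open>k\<close> left to
  do. They are finitely many because a loop body continues with the loop itself; control leaves the
  set only towards \<open>k\<close>.\<close>

primrec conts :: "prog \<Rightarrow> prog list \<Rightarrow> prog list set" where
  "conts Skip k = {Skip # k}"
| "conts (Inc r) k = {Inc r # k}"
| "conts (Dec r) k = {Dec r # k}"
| "conts (Seq a b) k = insert (Seq a b # k) (conts a (b # k) \<union> conts b k)"
| "conts (While r a) k = insert (While r a # k) (conts a (While r a # k))"

lemma finite_conts: "finite (conts p k)"
  by (induction p arbitrary: k) auto

lemma conts_start: "p # k \<in> conts p k"
  by (cases p) auto

lemma conts_regs: "ks \<in> conts p k \<Longrightarrow> \<exists>q l. ks = q # l \<and> regs q \<subseteq> regs p"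
  by (induction p arbitrary: k) fastforce+

fun succs :: "prog list \<Rightarrow> prog list set" where
  "succs [] = {[]}"
| "succs (Seq a b # k) = {a # b # k}"
| "succs (While r a # k) = {k, a # While r a # k}"
| "succs (_ # k) = {k}"

lemma conts_succs: "ks \<in> conts p k \<Longrightarrow> succs ks \<subseteq> insert k (conts p k)"
proof (induction p arbitrary: k)
  case (Seq a b)
  then show ?case using conts_start[of a "b # k"] conts_start[of b k] by fastforce
next
  case (While r a)
  then show ?case using conts_start[of a "While r a # k"] by fastforce
qed auto

definition all_conts :: "prog \<Rightarrow> prog list set" where
  "all_conts p = insert [] (conts p [])"

lemma all_conts_succs: "ks \<in> all_conts p \<Longrightarrow> l \<in> succs ks \<Longrightarrow> l \<in> all_conts p"
  using conts_succs[of ks p "[]"] unfolding all_conts_def by auto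

definition ctrls :: "nat \<Rightarrow> prog \<Rightarrow> ctrl set" where
  "ctrls N p = {Yes, No} \<union> Run ` all_conts p \<union>
     (\<Union>c \<in> {Carry, Borrow, Erase, Rewind}. \<Union>r<N. c r ` all_conts p)"

lemma finite_ctrls: "finite (ctrls N p)"
  by (auto simp: ctrls_def all_conts_def finite_conts)

text \<open>Machine states have to be numbers, hence \<open>to_nat\<close>. On every tape other than
  \<open>r\<close> the scanned symbol is written back and the head stays.\<close>

definition counter_tm :: "nat \<Rightarrow> prog \<Rightarrow> letter tm" where
  "counter_tm N p = \<lparr>tm_tapes = N, tm_states = to_nat ` ctrls N p,
     tm_alphabet = insert Blank (range Input), tm_start = to_nat (Run [p]),
     tm_accept = to_nat Yes, tm_reject = to_nat No,
     tm_delta = (\<lambda>q ss. case act (from_nat q) (\<lambda>i. ss ! i) of (q', r, a, m) \<Rightarrow>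
       (to_nat q', map (\<lambda>i. if i = r then (a, m) else (ss ! i, Stay)) [0..<N]))\<rparr>"

lemma act_closed:
  assumes N: "N \<ge> 2" "regs p \<subseteq> {..<N}" and q: "q \<in> ctrls N p"
    and f: "\<And>i. i < N \<Longrightarrow> f i \<in> insert Blank (range Input)"
    and act: "act q f = (q', r, a, m)"
  shows "q' \<in> ctrls N p \<and> r < N \<and> a \<in> insert Blank (range Input)"
proof (cases q)
  case (Run ks)
  then have ks: "ks \<in> all_conts p" using q by (auto simp: ctrls_def)
  have suc: "\<And>l. l \<in> succs ks \<Longrightarrow> l \<in> all_conts p" using all_conts_succs[OF ks] .
  show ?thesis
  proof (cases ks)
    case Nil
    then show ?thesis using act Run f[of 0] N by (auto simp: ctrls_def split: if_splits)
  next
    case (Cons b k)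
    then have rb: "regs b \<subseteq> {..<N}"
      using ks conts_regs[of ks p "[]"] N by (auto simp: all_conts_def)
    show ?thesis
      using Cons act Run f[of 0] N suc rb by (cases b) (auto simp: ctrls_def split: if_splits)
  qed
qed (use q act f f[of 0] N in \<open>auto simp: ctrls_def split: tape_symbol.splits if_splits\<close>)

lemma finite_letter: "finite (UNIV :: letter set)"
proof -
  have "(UNIV :: letter set) \<subseteq> {LPar, RPar, NegL, AndL, BoxL, KL, XL, ZeroL, OneL}"
    using letter.exhaust by blast
  then show ?thesis by (rule finite_subset) simp
qed

lemma turing_machine_counter_tm:
  assumes N: "N \<ge> 2" "regs p \<subseteq> {..<N}"
  shows "turing_machine (counter_tm N p)"
proof -
  have start: "Run [p] \<in> ctrls N p"
    using conts_start[of p "[]"] by (auto simp: ctrls_def all_conts_def)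
  have "case tm_delta (counter_tm N p) q ss of (q', acts) \<Rightarrow>
      q' \<in> to_nat ` ctrls N p \<and> length acts = N \<and> fst ` set acts \<subseteq> insert Blank (range Input)"
    if q: "q \<in> to_nat ` ctrls N p" and ss: "ss \<in> lists (insert Blank (range Input))" "length ss = N"
    for q ss
  proof -
    obtain c where c: "c \<in> ctrls N p" "q = to_nat c" using q by blast
    have f: "ss ! i \<in> insert Blank (range Input)" if "i < N" for i
      using ss that nth_mem[of i ss] by auto
    obtain q' r a m where act: "act c (\<lambda>i. ss ! i) = (q', r, a, m)" by (metis prod_cases4)
    show ?thesis
      using act_closed[OF N c(1) f act] c(2) act by (auto simp: counter_tm_def; use f in blast)
  qed
  then show ?thesis
    using N start unfolding turing_machine_def
    by (auto simp: counter_tm_def finite_ctrls finite_letter) (auto simp: ctrls_def)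
qed

section \<open>Simulation of counter programs, with control of the head positions\<close>

definition num_tape :: "letter list \<Rightarrow> int \<Rightarrow> letter tape" where
  "num_tape ds h = (fst (input_tape ds), h)"

lemma num_tape_read:
  "fst (input_tape (pre @ d # ds)) (int (length pre)) = Input d"
  "fst (input_tape pre) (int (length pre)) = Blank"
  "fst (input_tape ds) (- 1) = Blank"
  by (auto simp: input_tape_def)

lemma num_tape_write:
  "(fst (input_tape (pre @ d # ds)))(int (length pre) := Input d') = fst (input_tape (pre @ d' # ds))"
  "(fst (input_tape pre))(int (length pre) := Input d') = fst (input_tape (pre @ [d']))"
  "(fst (input_tape (pre @ [d'])))(int (length pre) := Blank) = fst (input_tape pre)"
  by (auto simp: input_tape_def nth_append nth_Cons' fun_eq_iff)

definition tm_config :: "nat \<Rightarrow> ctrl \<Rightarrow> (nat \<Rightarrow> letter tape) \<Rightarrow> letter config" where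
  "tm_config N q T = (to_nat q, map T [0..<N])"

text \<open>Position -1 is the blank cell at which \<open>Rewind\<close> turns round. The interval
  has H + 2 positions, the space charged per tape.\<close>

definition heads_within :: "nat \<Rightarrow> int \<Rightarrow> letter config \<Rightarrow> bool" where
  "heads_within N H c \<longleftrightarrow> (\<forall>i<N. snd (snd c ! i) \<in> {-1..H})"

inductive reaches :: "letter tm \<Rightarrow> nat \<Rightarrow> int \<Rightarrow> letter config \<Rightarrow> letter config \<Rightarrow> bool" for M N H where
  here: "heads_within N H c \<Longrightarrow> reaches M N H c c"
| there: "heads_within N H c \<Longrightarrow> reaches M N H (tm_step M c) c' \<Longrightarrow> reaches M N H c c'"

lemma reaches_trans: "reaches M N H a b \<Longrightarrow> reaches M N H b c \<Longrightarrow> reaches M N H a c"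
  by (induction rule: reaches.induct) (auto intro: reaches.there)

lemma reaches_iterate:
  "reaches M N H c c' \<Longrightarrow> \<exists>t. (tm_step M ^^ t) c = c' \<and> (\<forall>j\<le>t. heads_within N H ((tm_step M ^^ j) c))"
proof (induction rule: reaches.induct)
  case (here c)
  then show ?case by (intro exI[of _ 0]) auto
next
  case (there c c')
  then obtain t where t: "(tm_step M ^^ t) (tm_step M c) = c'"
    "\<forall>j\<le>t. heads_within N H ((tm_step M ^^ j) (tm_step M c))" by blast
  have "heads_within N H ((tm_step M ^^ j) c)" if "j \<le> Suc t" for j
    using that t(2) there(1) by (cases j) (auto simp: funpow_swap1)
  then show ?case using t(1) by (intro exI[of _ "Suc t"]) (auto simp: funpow_swap1)
qed

lemma tm_step_config:
  assumes "q \<noteq> Yes" "q \<noteq> No" "act q (\<lambda>i. map (\<lambda>i. fst (T i) (snd (T i))) [0..<N] ! i) = (q', r, a, m)" "r < N"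
  shows "tm_step (counter_tm N p) (tm_config N q T) =
    tm_config N q' (T(r := ((fst (T r))(snd (T r) := a), snd (T r) + offset m)))"
proof -
  have *: "map (\<lambda>(t, h). t h) (map T [0..<N]) = map (\<lambda>i. fst (T i) (snd (T i))) [0..<N]"
    by (simp add: case_prod_beta)
  show ?thesis
    using assms unfolding tm_step_def tm_halted_def *[symmetric] tm_config_def
    by (auto simp: counter_tm_def case_prod_beta intro!: nth_equalityI)
qed

lemma tm_step_run:
  assumes "ks \<noteq> []" "N \<ge> 1" "\<forall>r\<in>regs (hd ks). r < N"
  shows "tm_step (counter_tm N p) (tm_config N (Run ks) T) =
    tm_config N (fst (act (Run ks) (\<lambda>i. fst (T i) (snd (T i))))) T"
proof -
  obtain b k where ks: "ks = b # k" using assms(1) by (cases ks) auto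
  show ?thesis
    by (subst tm_step_config[where r = 0 and a = "fst (T 0) (snd (T 0))" and m = Stay
          and q' = "fst (act (Run ks) (\<lambda>i. fst (T i) (snd (T i))))"])
      (use assms ks in \<open>cases b; auto\<close>)+
qed

context
  fixes N :: nat and p :: prog and H :: int and T :: "nat \<Rightarrow> letter tape" and r :: nat
  assumes rK: "r < N" and T: "\<forall>i<N. snd (T i) \<in> {-1..H}"
begin

abbreviation leads_to :: "letter config \<Rightarrow> letter config \<Rightarrow> bool" where
  "leads_to \<equiv> reaches (counter_tm N p) N H"

lemma step_reach:
  assumes "act q (\<lambda>i. map (\<lambda>i. fst ((T(r := num_tape ds h)) i) (snd ((T(r := num_tape ds h)) i))) [0..<N] ! i)
      = (q', r, a, m)" "q \<noteq> Yes" "q \<noteq> No"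
    and w: "(fst (input_tape ds))(h := a) = fst (input_tape ds')" "h + offset m = h'"
    and h: "- 1 \<le> h" "h \<le> H"
    and rch: "leads_to (tm_config N q' (T(r := num_tape ds' h'))) c"
  shows "leads_to (tm_config N q (T(r := num_tape ds h))) c"
proof (rule reaches.there)
  show "heads_within N H (tm_config N q (T(r := num_tape ds h)))"
    using T h by (auto simp: heads_within_def tm_config_def num_tape_def)
  show "leads_to (tm_step (counter_tm N p) (tm_config N q (T(r := num_tape ds h)))) c"
    using rch w by (subst tm_step_config[OF assms(2,3,1) rK]) (simp add: num_tape_def)
qed

text \<open>The head stands at n - 1 so that the turning point -1 becomes the base case of the
  induction.\<close>

lemma rewind_reach:
  assumes "n \<le> length ds" "int (length ds) \<le> H + 1" "0 \<le> H"
  shows "leads_to (tm_config N (Rewind r k) (T(r := num_tape ds (int n - 1))))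
    (tm_config N (Run k) (T(r := num_tape ds 0)))"
  using assms(1)
proof (induction n)
  case 0
  show ?case
  proof (rule step_reach[where a = Blank and m = MoveR])
    show "leads_to (tm_config N (Run k) (T(r := num_tape ds 0)))
       (tm_config N (Run k) (T(r := num_tape ds 0)))"
      using T assms by (auto intro!: reaches.here simp: heads_within_def tm_config_def num_tape_def)
  qed (use rK assms in \<open>auto simp: num_tape_def num_tape_read fun_upd_idem\<close>)
next
  case (Suc n)
  obtain pre d post where ds: "ds = pre @ d # post" "length pre = n"
    using Suc.prems id_take_nth_drop[of n ds] by (metis Suc_le_lessD length_take min.absorb4)
  have IH: "leads_to (tm_config N (Rewind r k) (T(r := num_tape ds (int n - 1))))
      (tm_config N (Run k) (T(r := num_tape ds 0)))" by (rule Suc.IH) (use Suc.prems in simp)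
  have rd: "fst (input_tape ds) (int n) = Input d" using ds num_tape_read(1)[of pre d post] by simp
  have wr: "(fst (input_tape ds))(int n := Input d) = fst (input_tape ds)" using rd by auto
  show ?case
    by (rule step_reach[where a = "Input d" and m = MoveL, OF _ _ _ _ _ _ _ IH])
      (use rK Suc.prems assms rd wr in \<open>auto simp: num_tape_def\<close>)
qed

text \<open>\<open>pre\<close> holds the digits that the carry has already passed; generalising over
  it lets the induction follow the moving head.\<close>

lemma carry_reach:
  assumes "int (length pre + length ds) \<le> H"
  shows "leads_to (tm_config N (Carry r k) (T(r := num_tape (pre @ ds) (int (length pre)))))
    (tm_config N (Run k) (T(r := num_tape (pre @ num_inc ds) 0)))"
  using assms
proof (induction ds arbitrary: pre)
  case Nil
  have R: "leads_to (tm_config N (Rewind r k) (T(r := num_tape (pre @ [LPar]) (int (Suc (length pre)) - 1))))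
    (tm_config N (Run k) (T(r := num_tape (pre @ [LPar]) 0)))"
    by (rule rewind_reach) (use Nil in auto)
  have E: "pre @ num_inc [] = pre @ [LPar]" by simp
  show ?case unfolding E
    by (rule step_reach[where a = "Input LPar" and m = Stay, OF _ _ _ _ _ _ _ R])
      (use rK Nil in \<open>auto simp: num_tape_def num_tape_read num_tape_write\<close>)
next
  case (Cons d ds)
  show ?case
  proof (cases "d = OneL")
    case True
    have R: "leads_to (tm_config N (Carry r k) (T(r := num_tape ((pre @ [LPar]) @ ds) (int (length (pre @ [LPar]))))))
      (tm_config N (Run k) (T(r := num_tape ((pre @ [LPar]) @ num_inc ds) 0)))"
      by (rule Cons.IH) (use Cons.prems in auto)
    have E: "pre @ num_inc (d # ds) = (pre @ [LPar]) @ num_inc ds" using True by simp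
    show ?thesis unfolding E
      by (rule step_reach[where a = "Input LPar" and m = MoveR, OF _ _ _ _ _ _ _ R])
        (use rK True Cons.prems in \<open>auto simp: num_tape_def num_tape_read num_tape_write add.commute\<close>)
  next
    case False
    have R: "leads_to (tm_config N (Rewind r k) (T(r := num_tape (pre @ next_digit d # ds) (int (Suc (length pre)) - 1))))
      (tm_config N (Run k) (T(r := num_tape (pre @ next_digit d # ds) 0)))"
      by (rule rewind_reach) (use Cons.prems in auto)
    have E: "pre @ num_inc (d # ds) = pre @ next_digit d # ds" using False by simp
    show ?thesis unfolding E
      by (rule step_reach[where a = "Input (next_digit d)" and m = Stay, OF _ _ _ _ _ _ _ R])
        (use rK False Cons.prems in \<open>auto simp: num_tape_def num_tape_read num_tape_write\<close>)
  qed
qed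

lemma borrow_reach:
  assumes "int (length pre + length ds) \<le> H" "ds \<noteq> []"
  shows "leads_to (tm_config N (Borrow r k) (T(r := num_tape (pre @ ds) (int (length pre)))))
    (tm_config N (Run k) (T(r := num_tape (pre @ num_dec ds) 0)))"
  using assms
proof (induction ds arbitrary: pre)
  case (Cons d ds)
  show ?case
  proof (cases "d = LPar")
    case False
    have R: "leads_to (tm_config N (Rewind r k) (T(r := num_tape (pre @ prev_digit d # ds) (int (Suc (length pre)) - 1))))
      (tm_config N (Run k) (T(r := num_tape (pre @ prev_digit d # ds) 0)))"
      by (rule rewind_reach) (use Cons.prems in auto)
    have E: "pre @ num_dec (d # ds) = pre @ prev_digit d # ds" using False by simp
    show ?thesis unfolding E
      by (rule step_reach[where a = "Input (prev_digit d)" and m = Stay, OF _ _ _ _ _ _ _ R])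
        (use rK False Cons.prems in \<open>auto simp: num_tape_def num_tape_read num_tape_write\<close>)
  next
    case True
    have R: "reaches (counter_tm N p) N H
      (tm_config N (Borrow r k) (T(r := num_tape (pre @ OneL # ds) (int (length pre) + 1))))
      (tm_config N (Run k) (T(r := num_tape (pre @ num_dec (d # ds)) 0)))"
    proof (cases "ds = []")
      case False
      have R: "leads_to (tm_config N (Borrow r k) (T(r := num_tape ((pre @ [OneL]) @ ds) (int (length (pre @ [OneL]))))))
        (tm_config N (Run k) (T(r := num_tape ((pre @ [OneL]) @ num_dec ds) 0)))"
        by (rule Cons.IH) (use Cons.prems False in auto)
      have E: "pre @ num_dec (d # ds) = (pre @ [OneL]) @ num_dec ds"
        "pre @ OneL # ds = (pre @ [OneL]) @ ds" "int (length pre) + 1 = int (length (pre @ [OneL]))"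
        using False True by simp_all
      show ?thesis unfolding E by (rule R)
    next
      \<comment> \<open>The 9 just written was provisional: the blank to its right shows that the 1
        was the leading digit, so \<open>Erase\<close> goes back and removes it.\<close>
      case dsN: True
      have R: "leads_to (tm_config N (Rewind r k) (T(r := num_tape pre (int (length pre) - 1))))
        (tm_config N (Run k) (T(r := num_tape pre 0)))"
        by (rule rewind_reach) (use Cons.prems in auto)
      have R: "leads_to (tm_config N (Erase r k) (T(r := num_tape (pre @ [OneL]) (int (length pre)))))
        (tm_config N (Run k) (T(r := num_tape pre 0)))"
        by (rule step_reach[where a = Blank and m = MoveL, OF _ _ _ _ _ _ _ R])
          (use rK Cons.prems in \<open>auto simp: num_tape_def num_tape_write\<close>)
      have E: "pre @ num_dec (d # ds) = pre" "pre @ OneL # ds = pre @ [OneL]" using True dsN by simp_all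
      show ?thesis unfolding E
        by (rule step_reach[where a = Blank and m = MoveL, OF _ _ _ _ _ _ _ R])
          (use rK Cons.prems num_tape_read(2)[of "pre @ [OneL]"] in \<open>auto simp: num_tape_def fun_upd_idem add.commute\<close>)
    qed
    show ?thesis
      by (rule step_reach[where a = "Input OneL" and m = MoveR, OF _ _ _ _ _ _ _ R])
        (use rK True Cons.prems in \<open>auto simp: num_tape_def num_tape_read num_tape_write\<close>)
  qed
qed simp

end

definition reg_tapes :: "(nat \<Rightarrow> nat) \<Rightarrow> nat \<Rightarrow> letter tape" where
  "reg_tapes s i = num_tape (numeral_of (s i)) 0"

lemma reg_tapes_upd: "reg_tapes (s(r := v)) = (reg_tapes s)(r := num_tape (numeral_of v) 0)"
  by (auto simp: reg_tapes_def)

lemma heads_reg_tapes: "heads_within N (int H) (tm_config N q (reg_tapes s))"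
  by (auto simp: heads_within_def tm_config_def reg_tapes_def num_tape_def)

lemma reg_tapes_read: "fst (reg_tapes s i) (snd (reg_tapes s i)) = Blank \<longleftrightarrow> s i = 0"
  by (cases "numeral_of (s i)")
    (auto simp: reg_tapes_def num_tape_def input_tape_def numeral_of_eq_Nil[symmetric])

lemma reaches_run:
  assumes "ks \<noteq> []" "N \<ge> 1" "\<forall>r\<in>regs (hd ks). r < N"
    and "reaches (counter_tm N p) N (int H)
      (tm_config N (fst (act (Run ks) (\<lambda>i. fst (reg_tapes s i) (snd (reg_tapes s i))))) (reg_tapes s)) c"
  shows "reaches (counter_tm N p) N (int H) (tm_config N (Run ks) (reg_tapes s)) c"
  by (rule reaches.there[OF heads_reg_tapes]) (subst tm_step_run, use assms in auto)

lemma exec_reaches: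
  assumes "exec B b s s'" "regs b \<subseteq> {..<N}" "\<forall>i. s i \<le> B" "B < 2 ^ H" "N \<ge> 1"
  shows "reaches (counter_tm N p) N (int H) (tm_config N (Run (b # k)) (reg_tapes s))
      (tm_config N (Run k) (reg_tapes s'))"
  using assms
proof (induction arbitrary: k rule: exec.induct)
  case (Skip s)
  show ?case
    by (rule reaches_run) (use Skip in \<open>auto simp: reaches.here heads_reg_tapes\<close>)
next
  case (Inc s r)
  have len: "length (numeral_of (s r)) \<le> H"
    using Inc length_numeral_of_le le_less_trans by blast
  have "reaches (counter_tm N p) N (int H)
      (tm_config N (Carry r k) ((reg_tapes s)(r := num_tape ([] @ numeral_of (s r)) (int (length ([] :: letter list)))))) 
      (tm_config N (Run k) ((reg_tapes s)(r := num_tape ([] @ num_inc (numeral_of (s r))) 0)))"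
    by (rule carry_reach) (use Inc len in \<open>auto simp: reg_tapes_def num_tape_def\<close>)
  then have R: "reaches (counter_tm N p) N (int H) (tm_config N (Carry r k) (reg_tapes s))
      (tm_config N (Run k) (reg_tapes (s(r := Suc (s r)))))"
    by (simp add: num_inc_numeral_of reg_tapes_upd) (simp add: reg_tapes_def fun_upd_idem)
  show ?case by (rule reaches_run) (use Inc R in \<open>auto simp: fun_upd_def\<close>)
next
  case (Dec r s)
  show ?case
  proof (cases "s r = 0")
    case True
    have "s(r := s r - 1) = s" using True by auto
    then show ?thesis
      by (intro reaches_run) (use True Dec in \<open>auto simp: reaches.here heads_reg_tapes reg_tapes_read\<close>)
  next
    case False
    have len: "length (numeral_of (s r)) \<le> H"
      using Dec length_numeral_of_le le_less_trans by blast
    have "reaches (counter_tm N p) N (int H)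
        (tm_config N (Borrow r k) ((reg_tapes s)(r := num_tape ([] @ numeral_of (s r)) (int (length ([] :: letter list)))))) 
        (tm_config N (Run k) ((reg_tapes s)(r := num_tape ([] @ num_dec (numeral_of (s r))) 0)))"
      by (rule borrow_reach)
        (use Dec len False in \<open>auto simp: reg_tapes_def num_tape_def numeral_of_eq_Nil\<close>)
    then have R: "reaches (counter_tm N p) N (int H) (tm_config N (Borrow r k) (reg_tapes s))
        (tm_config N (Run k) (reg_tapes (s(r := s r - 1))))"
      by (simp add: num_dec_numeral_of reg_tapes_upd) (simp add: reg_tapes_def fun_upd_idem)
    show ?thesis by (rule reaches_run) (use Dec False R in \<open>auto simp: reg_tapes_read fun_upd_def\<close>)
  qed
next
  case (Seq a s s' b s'')
  have "\<forall>i. s' i \<le> B" using exec_bounded[OF Seq(1) Seq.prems(2)] .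
  with Seq have R: "reaches (counter_tm N p) N (int H) (tm_config N (Run (a # b # k)) (reg_tapes s))
      (tm_config N (Run k) (reg_tapes s''))"
    by (intro reaches_trans[OF Seq.IH(1) Seq.IH(2)]) auto
  show ?case by (rule reaches_run) (use Seq.prems R in auto)
next
  case (While0 s r a)
  show ?case
    by (rule reaches_run) (use While0 in \<open>auto simp: reaches.here heads_reg_tapes reg_tapes_read\<close>)
next
  case (While1 s r a s' s'')
  have "\<forall>i. s' i \<le> B" using exec_bounded[OF While1(2) While1.prems(2)] .
  with While1 have R: "reaches (counter_tm N p) N (int H) (tm_config N (Run (a # While r a # k)) (reg_tapes s))
      (tm_config N (Run k) (reg_tapes s''))"
    by (intro reaches_trans[OF While1.IH(1) While1.IH(2)]) auto
  show ?case by (rule reaches_run) (use While1 R in \<open>auto simp: reg_tapes_read\<close>)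
qed

text \<open>Register 0 is the input and register 1 the answer, hence at least two tapes. Only
  termination matters; no bound on the running time enters.\<close>

theorem counter_tm_decides:
  fixes H :: "nat \<Rightarrow> nat"
  assumes N: "N \<ge> 2" "regs p \<subseteq> {..<N}"
    and ex: "\<And>w. \<exists>B s. exec B p (\<lambda>i. if i = 0 then num_val w else 0) s \<and> num_val w \<le> B \<and>
       B < 2 ^ H (length w) \<and> (s 1 \<noteq> 0 \<longleftrightarrow> w \<in> L)"
  shows "tm_decides (counter_tm N p) L"
    and "tm_space (counter_tm N p) w \<le> N * (H (length w) + 2)"
proof -
  let ?M = "counter_tm N p"
  have main: "\<exists>t. fst (tm_run ?M w t) = to_nat (if w \<in> L then Yes else No) \<and>
      (\<forall>j. heads_within N (int (H (length w))) (tm_run ?M w j))" for w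
  proof -
    obtain B s where s: "exec B p (\<lambda>i. if i = 0 then num_val w else 0) s" "num_val w \<le> B"
       "B < 2 ^ H (length w)" "s 1 \<noteq> 0 \<longleftrightarrow> w \<in> L" using ex[of w] by blast
    let ?s0 = "\<lambda>i::nat. if i = 0 then num_val w else 0"
    let ?q = "if w \<in> L then Yes else No"
    obtain N' where N': "N = Suc N'" using N by (cases N) auto
    have emp: "num_tape [] 0 = (\<lambda>_. Blank, 0)" by (auto simp: num_tape_def input_tape_def fun_eq_iff)
    \<comment> \<open>No conversion of the input takes place: its string is the numeral of
      \<open>num_val w\<close>, and a blank tape is the numeral of 0.\<close>
    have "map (reg_tapes ?s0) [0..<N] = input_tape w # replicate (N - 1) (\<lambda>_. Blank, 0)"
      unfolding N' by (rule nth_equalityI)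
        (auto simp: nth_Cons' reg_tapes_def numeral_of_eq_Nil[THEN iffD2] emp simp del: upt_Suc,
         simp add: num_tape_def input_tape_def)
    then have init: "tm_init ?M w = tm_config N (Run [p]) (reg_tapes ?s0)"
      by (simp add: tm_init_def tm_config_def) (simp add: counter_tm_def)
    have "reaches ?M N (int (H (length w))) (tm_config N (Run [p]) (reg_tapes ?s0))
      (tm_config N (Run []) (reg_tapes s))"
      by (rule exec_reaches[OF s(1)]) (use N s in auto)
    moreover have "tm_step ?M (tm_config N (Run []) (reg_tapes s)) = tm_config N ?q (reg_tapes s)"
      by (subst tm_step_config[where r = 0 and a = "fst (reg_tapes s 0) (snd (reg_tapes s 0))"
            and m = Stay and q' = ?q])
        (use N s(4) reg_tapes_read[of s 1] in auto)
    then have "reaches ?M N (int (H (length w))) (tm_config N (Run []) (reg_tapes s))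
        (tm_config N ?q (reg_tapes s))"
      by (metis reaches.there reaches.here heads_reg_tapes)
    ultimately have "reaches ?M N (int (H (length w))) (tm_init ?M w) (tm_config N ?q (reg_tapes s))"
      unfolding init by (rule reaches_trans)
    from reaches_iterate[OF this] obtain t where
      t: "tm_run ?M w t = tm_config N ?q (reg_tapes s)"
        "\<forall>j\<le>t. heads_within N (int (H (length w))) (tm_run ?M w j)"
      unfolding tm_run_def by blast
    \<comment> \<open>The space counts the positions at all times, so the times after halting have
      to be covered as well.\<close>
    have halt: "tm_step ?M (tm_config N ?q (reg_tapes s)) = tm_config N ?q (reg_tapes s)"
      by (auto simp: tm_step_def tm_halted_def tm_config_def counter_tm_def)
    have "tm_run ?M w (t + j) = tm_config N ?q (reg_tapes s)" for j
    proof (induction j)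
      case (Suc j)
      then show ?case using halt by (simp add: tm_run_def)
    qed (simp add: t)
    then have "heads_within N (int (H (length w))) (tm_run ?M w j)" for j
      using t(2) heads_reg_tapes by (metis le_iff_add linorder_le_cases)
    then show ?thesis using t(1) by (intro exI[of _ t]) (auto simp: tm_config_def)
  qed
  show "tm_decides ?M L"
    using main by (simp add: tm_decides_def) (metis (mono_tags, lifting) counter_tm_def tm.select_convs(5,6))
  have card: "card (range (\<lambda>t. snd (snd (tm_run ?M w t) ! i))) \<le> H (length w) + 2" if "i < N" for i
  proof -
    have "range (\<lambda>t. snd (snd (tm_run ?M w t) ! i)) \<subseteq> {-1..int (H (length w))}"
      using main[of w] that by (auto simp: heads_within_def)
    from card_mono[OF _ this] show ?thesis by simp
  qed
  have tapes: "tm_tapes ?M = N" by (simp add: counter_tm_def)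
  have "tm_space ?M w \<le> (\<Sum>i<N. H (length w) + 2)"
    unfolding tm_space_def tapes by (rule sum_mono) (use card in auto)
  then show "tm_space ?M w \<le> N * (H (length w) + 2)" by simp
qed

section \<open>Functions computable in linear space\<close>

definition clear :: "nat \<Rightarrow> prog" where
  "clear r = While r (Dec r)"

definition transfer :: "nat \<Rightarrow> nat \<Rightarrow> prog" where
  "transfer r d = While r (Seq (Dec r) (Inc d))"

text \<open>Reading a register by a loop empties it; the scratch register \<open>t\<close> serves to
  restore it.\<close>

definition copy :: "nat \<Rightarrow> nat \<Rightarrow> nat \<Rightarrow> prog" where
  "copy r d t = Seq (While r (Seq (Dec r) (Seq (Inc d) (Inc t)))) (transfer t r)"

lemma exec_While_iterate:
  assumes "\<And>j. j < k \<Longrightarrow> S j r \<noteq> 0 \<and> exec B a (S j) (S (Suc j))" "S k r = (0 :: nat)"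
  shows "exec B (While r a) (S 0) (S k)"
  using assms
proof (induction k arbitrary: S)
  case 0
  then show ?case by (simp add: exec.While0)
next
  case (Suc k)
  have "exec B (While r a) ((\<lambda>j. S (Suc j)) 0) ((\<lambda>j. S (Suc j)) k)"
    by (rule Suc.IH) (use Suc.prems in auto)
  moreover have "S 0 r \<noteq> 0" "exec B a (S 0) (S (Suc 0))" using Suc.prems(1)[of 0] by auto
  ultimately show ?case by (metis exec.While1)
qed

lemma exec_eq: "exec B p s s' \<Longrightarrow> s' = s'' \<Longrightarrow> exec B p s s''"
  by simp

lemma exec_clear: "exec B (clear r) s (s(r := 0))"
proof -
  have "exec B (While r (Dec r)) ((\<lambda>j. s(r := s r - j)) 0) ((\<lambda>j. s(r := s r - j)) (s r))"
  proof (rule exec_While_iterate)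
    fix j assume j: "j < s r"
    have "exec B (Dec r) (s(r := s r - j)) (s(r := s r - Suc j))"
      by (rule exec_eq[OF exec.Dec]) auto
    then show "(s(r := s r - j)) r \<noteq> 0 \<and> exec B (Dec r) (s(r := s r - j)) (s(r := s r - Suc j))"
      using j by simp
  qed simp
  then show ?thesis by (simp add: clear_def)
qed

lemma exec_transfer:
  assumes "r \<noteq> d" "s d + s r \<le> B"
  shows "exec B (transfer r d) s (s(r := 0, d := s d + s r))"
proof -
  let ?S = "\<lambda>j. s(r := s r - j, d := s d + j)"
  have "exec B (While r (Seq (Dec r) (Inc d))) (?S 0) (?S (s r))"
  proof (rule exec_While_iterate)
    fix j assume j: "j < s r"
    have "exec B (Seq (Dec r) (Inc d)) (?S j) (?S (Suc j))"
      by (rule exec_eq[OF exec.Seq[OF exec.Dec exec.Inc]]) (use j assms in \<open>auto simp: fun_eq_iff\<close>)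
    then show "?S j r \<noteq> 0 \<and> exec B (Seq (Dec r) (Inc d)) (?S j) (?S (Suc j))"
      using j assms by simp
  qed (use assms in auto)
  then show ?thesis by (simp add: transfer_def)
qed

lemma exec_copy:
  assumes "r \<noteq> d" "r \<noteq> t" "d \<noteq> t" "s d = 0" "s t = 0" "s r \<le> B"
  shows "exec B (copy r d t) s (s(d := s r))"
proof -
  let ?S = "\<lambda>j. s(r := s r - j, d := j, t := j)"
  have "exec B (While r (Seq (Dec r) (Seq (Inc d) (Inc t)))) (?S 0) (?S (s r))"
  proof (rule exec_While_iterate)
    fix j assume j: "j < s r"
    have "exec B (Seq (Dec r) (Seq (Inc d) (Inc t))) (?S j) (?S (Suc j))"
      by (rule exec_eq[OF exec.Seq[OF exec.Dec exec.Seq[OF exec.Inc exec.Inc]]])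
        (use j assms in \<open>auto simp: fun_eq_iff\<close>)
    then show "?S j r \<noteq> 0 \<and> exec B (Seq (Dec r) (Seq (Inc d) (Inc t))) (?S j) (?S (Suc j))"
      using j assms by simp
  qed (use assms in auto)
  moreover have "?S 0 = s" using assms by auto
  moreover have "exec B (transfer t r) (?S (s r)) (s(d := s r))"
    by (rule exec_eq[OF exec_transfer]) (use assms in \<open>auto simp: fun_eq_iff\<close>)
  ultimately show ?thesis unfolding copy_def by (auto intro: exec.Seq)
qed

text \<open>
  \<open>computes ub gs f c P\<close> says that the program \<open>P rs d m\<close> computes \<open>f e\<close> into the empty register \<open>d\<close> from
  the values \<open>g e\<close>, \<open>g \<in> set gs\<close>, found in the registers \<open>rs\<close>, with scratch registers from \<open>m\<close> on.
  Its values are polynomially bounded in \<open>ub e\<close> and the arguments, so that it needs only linear space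
  in the length of these numbers. The bounding function \<open>ub\<close> itself need not be available as a value.
\<close>

definition arguments_in ::
    "('e \<Rightarrow> nat) \<Rightarrow> ('e \<Rightarrow> nat) list \<Rightarrow> 'e \<Rightarrow> nat list \<Rightarrow> nat \<Rightarrow> nat \<Rightarrow> (nat \<Rightarrow> nat) \<Rightarrow> nat \<Rightarrow> bool" where
  "arguments_in ub gs e rs d m s b \<longleftrightarrow> map s rs = map (\<lambda>g. g e) gs \<and> (\<forall>r\<in>set rs. r < m \<and> s r \<le> b) \<and>
     ub e \<le> b \<and> d < m \<and> d \<notin> set rs \<and> s d = 0 \<and> (\<forall>r\<ge>m. s r = 0)"

definition computes ::
    "('e \<Rightarrow> nat) \<Rightarrow> ('e \<Rightarrow> nat) list \<Rightarrow> ('e \<Rightarrow> nat) \<Rightarrow> nat \<Rightarrow> (nat list \<Rightarrow> nat \<Rightarrow> nat \<Rightarrow> prog) \<Rightarrow> bool" where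
  "computes ub gs f c P \<longleftrightarrow> (\<forall>e rs d m s b B. arguments_in ub gs e rs d m s b \<and> (b + 2) ^ c \<le> B \<longrightarrow>
     exec B (P rs d m) s (s(d := f e)))"

definition linspace :: "('e \<Rightarrow> nat) \<Rightarrow> ('e \<Rightarrow> nat) list \<Rightarrow> ('e \<Rightarrow> nat) \<Rightarrow> bool" where
  "linspace ub gs f \<longleftrightarrow> (\<exists>c P. computes ub gs f c P)"

definition linspace_pred :: "('e \<Rightarrow> nat) \<Rightarrow> ('e \<Rightarrow> nat) list \<Rightarrow> ('e \<Rightarrow> bool) \<Rightarrow> bool" where
  "linspace_pred ub gs P \<longleftrightarrow> linspace ub gs (\<lambda>e. of_bool (P e))"

text \<open>The base b + 2 is at least 2, so raising the exponent never lowers the bound, and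
  constants and sums are absorbed by the exponent.\<close>

definition polybounded :: "('e \<Rightarrow> nat) \<Rightarrow> ('e \<Rightarrow> nat) list \<Rightarrow> ('e \<Rightarrow> nat) \<Rightarrow> bool" where
  "polybounded ub gs f \<longleftrightarrow> (\<exists>c. \<forall>e b. ub e \<le> b \<and> (\<forall>g\<in>set gs. g e \<le> b) \<longrightarrow> f e \<le> (b + 2) ^ c)"

text \<open>Binders in de Bruijn style: a bound variable is paired to the environment and becomes
  the first argument. Under two binders the environment is ((e, outer), inner).\<close>

definition ext_bound :: "('e \<Rightarrow> nat) \<Rightarrow> 'e \<times> nat \<Rightarrow> nat" where
  "ext_bound ub x = ub (fst x)"

definition ext_args :: "('e \<Rightarrow> nat) list \<Rightarrow> ('e \<times> nat \<Rightarrow> nat) list" where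
  "ext_args gs = snd # map (\<lambda>g x. g (fst x)) gs"

lemma computesD:
  "computes ub gs f c P \<Longrightarrow> arguments_in ub gs e rs d m s b \<Longrightarrow> (b + 2) ^ c \<le> B \<Longrightarrow>
     exec B (P rs d m) s (s(d := f e))"
  unfolding computes_def by blast

lemma arguments_in_ext:
  "arguments_in ub gs e rs d m s b \<Longrightarrow> r < m \<Longrightarrow> s r \<le> b \<Longrightarrow> r \<noteq> d \<Longrightarrow>
     arguments_in (ext_bound ub) (ext_args gs) (e, s r) (r # rs) d m s b"
  by (auto simp: arguments_in_def ext_bound_def ext_args_def)

lemma arguments_in_mono: "arguments_in ub gs e rs d m s b \<Longrightarrow> b \<le> b' \<Longrightarrow> arguments_in ub gs e rs d m s b'"
  by (auto simp: arguments_in_def)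

text \<open>Allocation of temporaries: a subprogram writes to a register \<open>d'\<close> taken
  from the scratch area, which then starts at \<open>m'\<close>.\<close>

lemma arguments_in_shift:
  assumes "arguments_in ub gs e rs d m s b" "m < m'" "\<forall>i<m. s' i = s i" "\<forall>i\<ge>m'. s' i = 0"
    "m \<le> d'" "d' < m'" "s' d' = 0"
  shows "arguments_in ub gs e rs d' m' s' b"
proof -
  have "\<forall>r\<in>set rs. s' r = s r" using assms by (auto simp: arguments_in_def)
  then have "map s' rs = map (\<lambda>g. g e) gs" using assms(1) by (simp add: arguments_in_def cong: map_cong)
  then show ?thesis using assms by (auto simp: arguments_in_def)
qed

lemma power_add_2_le: "(b + 2 :: nat) ^ c + 2 \<le> (b + 2) ^ (c + 2)"
proof -
  have "(b + 2) ^ c * 4 \<le> (b + 2) ^ c * (b + 2) ^ 2"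
    by (intro mult_left_mono) (auto simp: power2_eq_square)
  moreover have "(b + 2) ^ c \<ge> 1" by simp
  ultimately show ?thesis unfolding power_add by linarith
qed

text \<open>Used when computed values become arguments: their bound takes over the role of b, and
  the exponents multiply.\<close>

lemma power_power_add_2_le: "((b + 2 :: nat) ^ c + 2) ^ c' \<le> (b + 2) ^ ((c + 2) * c')"
  unfolding power_mult by (intro power_mono power_add_2_le) auto

lemma power_le_power_sum: "c \<le> c' \<Longrightarrow> (b + 2 :: nat) ^ c \<le> (b + 2) ^ c'"
  by (intro power_increasing) auto

lemma le_power_Suc: "b \<le> (b + 2 :: nat) ^ Suc c"
proof -
  have "(b + 2) * 1 \<le> (b + 2) * (b + 2) ^ c" by (intro mult_left_mono) auto
  then show ?thesis by simp
qed

text \<open>A program run under the bound B cannot raise a register above B, so its output is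
  bounded by the B with which it is known to run.\<close>

lemma linspace_polybounded:
  assumes "linspace ub gs f"
  shows "polybounded ub gs f"
proof -
  obtain c P where P: "computes ub gs f c P" using assms by (auto simp: linspace_def)
  have "f e \<le> (b + 2) ^ c" if b: "ub e \<le> b" "\<forall>g\<in>set gs. g e \<le> b" for e b
  proof -
    define s where "s i = (if i < length gs then (gs ! i) e else 0)" for i
    have "arguments_in ub gs e [0..<length gs] (length gs) (Suc (length gs)) s b"
      using b by (auto simp: arguments_in_def s_def intro!: nth_equalityI)
    from exec_le[OF computesD[OF P this order_refl], of "length gs"] show ?thesis by (simp add: s_def)
  qed
  then show ?thesis unfolding polybounded_def by blast
qed

lemma polybounded_const: "polybounded ub gs (\<lambda>_. k)"
proof -
  have "k \<le> (b + 2) ^ k" for b :: nat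
    by (rule order_trans[OF less_imp_le[OF less_exp] power_mono]) auto
  then show ?thesis unfolding polybounded_def by blast
qed

lemma polybounded_bound: "polybounded ub gs ub"
  unfolding polybounded_def by (intro exI[of _ 1]) auto

lemma polybounded_mono: "polybounded ub gs g \<Longrightarrow> (\<And>e. f e \<le> g e) \<Longrightarrow> polybounded ub gs f"
  unfolding polybounded_def by (meson order_trans)

lemma polybounded_mult:
  assumes "polybounded ub gs f" "polybounded ub gs g"
  shows "polybounded ub gs (\<lambda>e. f e * g e)"
proof -
  obtain c c' where "\<forall>e b. ub e \<le> b \<and> (\<forall>g\<in>set gs. g e \<le> b) \<longrightarrow> f e \<le> (b + 2) ^ c"
    "\<forall>e b. ub e \<le> b \<and> (\<forall>g\<in>set gs. g e \<le> b) \<longrightarrow> g e \<le> (b + 2) ^ c'"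
    using assms unfolding polybounded_def by blast
  then have "\<forall>e b. ub e \<le> b \<and> (\<forall>g\<in>set gs. g e \<le> b) \<longrightarrow> f e * g e \<le> (b + 2) ^ (c + c')"
    unfolding power_add by (intro allI impI mult_le_mono) auto
  then show ?thesis unfolding polybounded_def by blast
qed

lemma polybounded_add:
  assumes "polybounded ub gs f" "polybounded ub gs g"
  shows "polybounded ub gs (\<lambda>e. f e + g e)"
proof -
  have "polybounded ub gs (\<lambda>e. f e + 1)" if f: "polybounded ub gs f" for f
  proof -
    obtain c where c: "\<forall>e b. ub e \<le> b \<and> (\<forall>g\<in>set gs. g e \<le> b) \<longrightarrow> f e \<le> (b + 2) ^ c"
      using f unfolding polybounded_def by blast
    have "\<forall>e b. ub e \<le> b \<and> (\<forall>g\<in>set gs. g e \<le> b) \<longrightarrow> f e + 1 \<le> (b + 2) ^ (c + 2)"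
      using c power_add_2_le by (meson add_le_mono le_trans one_le_numeral)
    then show ?thesis unfolding polybounded_def by blast
  qed
  \<comment> \<open>f + g \<le> (f + 1) * (g + 1).\<close>
  from polybounded_mult[OF this[OF assms(1)] this[OF assms(2)]]
  show ?thesis by (rule polybounded_mono) auto
qed

lemma polybounded_power: "polybounded ub gs f \<Longrightarrow> polybounded ub gs (\<lambda>e. f e ^ k)"
  by (induction k) (auto intro: polybounded_const polybounded_mult)

lemma polybounded_weaken:
  "polybounded ub gs f \<Longrightarrow> polybounded (ext_bound ub) (ext_args gs) (\<lambda>x. f (fst x))"
  unfolding polybounded_def ext_bound_def ext_args_def by auto

section \<open>Composition, bounded recursion and iteration\<close>

lemma linspace_zero: "linspace ub gs (\<lambda>_. 0)"
proof -
  have "computes ub gs (\<lambda>_. 0) 0 (\<lambda>_ _ _. Skip)"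
    unfolding computes_def arguments_in_def
    by (auto intro!: exec_eq[OF exec.Skip])
  then show ?thesis unfolding linspace_def by blast
qed

lemma arguments_in_le:
  assumes "arguments_in ub gs e rs d m s b" "g \<in> set gs"
  shows "g e \<le> b"
proof -
  have "g e \<in> set (map s rs)" using assms by (auto simp: arguments_in_def)
  then show "g e \<le> b" using assms(1) by (auto simp: arguments_in_def)
qed

lemma polybounded_at:
  assumes "polybounded ub gs f"
  obtains c where "\<And>e rs d m s b. arguments_in ub gs e rs d m s b \<Longrightarrow> f e \<le> (b + 2) ^ c"
proof -
  obtain c where c: "\<forall>e b. ub e \<le> b \<and> (\<forall>g\<in>set gs. g e \<le> b) \<longrightarrow> f e \<le> (b + 2) ^ c"
    using assms unfolding polybounded_def by blast
  have "f e \<le> (b + 2) ^ c" if "arguments_in ub gs e rs d m s b" for e rs d m s b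
    using c arguments_in_le[OF that] that by (auto simp: arguments_in_def)
  then show ?thesis using that by blast
qed

lemma linspace_Suc:
  assumes "linspace ub gs f"
  shows "linspace ub gs (\<lambda>e. Suc (f e))"
proof -
  obtain c P where P: "computes ub gs f c P" using assms by (auto simp: linspace_def)
  obtain c' where c': "\<And>e rs d m s b. arguments_in ub gs e rs d m s b \<Longrightarrow> f e \<le> (b + 2) ^ c'"
    using polybounded_at[OF linspace_polybounded[OF assms]] by blast
  have "computes ub gs (\<lambda>e. Suc (f e)) (c + (c' + 2)) (\<lambda>rs d m. Seq (P rs d m) (Inc d))"
    unfolding computes_def
  proof (intro allI impI, elim conjE)
    fix e rs d m s b B
    assume a: "arguments_in ub gs e rs d m s b" and B: "(b + 2) ^ (c + (c' + 2)) \<le> B"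
    have "f e < B"
      using c'[OF a] power_add_2_le[of b c'] B power_le_power_sum[of "c' + 2" "c + (c' + 2)" b] by linarith
    then have "exec B (Inc d) (s(d := f e)) (s(d := Suc (f e)))"
      by (intro exec_eq[OF exec.Inc]) auto
    moreover have "exec B (P rs d m) s (s(d := f e))"
      by (rule computesD[OF P a]) (use B power_le_power_sum[of c "c + (c' + 2)" b] in linarith)
    ultimately show "exec B (Seq (P rs d m) (Inc d)) s (s(d := Suc (f e)))"
      by (blast intro: exec.Seq)
  qed
  then show ?thesis unfolding linspace_def by blast
qed

lemma linspace_arg: "linspace ub (g # gs) g"
proof -
  have "computes ub (g # gs) g 1 (\<lambda>rs d m. copy (hd rs) d m)"
    unfolding computes_def
  proof (intro allI impI, elim conjE)
    fix e rs d m s b B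
    assume a: "arguments_in ub (g # gs) e rs d m s b" and B: "(b + 2) ^ 1 \<le> B"
    then obtain r rs' where rs: "rs = r # rs'" "s r = g e"
      by (cases rs) (auto simp: arguments_in_def)
    show "exec B (copy (hd rs) d m) s (s(d := g e))"
      using a rs B by (intro exec_eq[OF exec_copy]) (auto simp: arguments_in_def)
  qed
  then show ?thesis unfolding linspace_def by blast
qed

lemma linspace_snd: "linspace (ext_bound ub) (ext_args gs) (\<lambda>x. snd x)"
  unfolding ext_args_def by (rule linspace_arg)

lemma linspace_weaken:
  assumes "linspace ub gs f"
  shows "linspace (ext_bound ub) (ext_args gs) (\<lambda>x. f (fst x))"
proof -
  obtain c P where P: "computes ub gs f c P" using assms by (auto simp: linspace_def)
  have "computes (ext_bound ub) (ext_args gs) (\<lambda>x. f (fst x)) c (\<lambda>rs d m. P (tl rs) d m)"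
    unfolding computes_def
  proof (intro allI impI, elim conjE)
    fix e rs d m s b B
    assume a: "arguments_in (ext_bound ub) (ext_args gs) e rs d m s b" and B: "(b + 2) ^ c \<le> B"
    then have "arguments_in ub gs (fst e) (tl rs) d m s b"
      by (cases rs) (auto simp: arguments_in_def ext_args_def ext_bound_def)
    then show "exec B (P (tl rs) d m) s (s(d := f (fst e)))" by (rule computesD[OF P _ B])
  qed
  then show ?thesis unfolding linspace_def by blast
qed

lemma linspace_Let:
  assumes "linspace ub gs a" and F: "linspace (ext_bound ub) (ext_args gs) (\<lambda>x. F (fst x) (snd x))"
  shows "linspace ub gs (\<lambda>e. F e (a e))"
proof -
  obtain ca Pa where Pa: "computes ub gs a ca Pa" using assms(1) by (auto simp: linspace_def)
  obtain cF PF where PF: "computes (ext_bound ub) (ext_args gs) (\<lambda>x. F (fst x) (snd x)) cF PF"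
    using F by (auto simp: linspace_def)
  obtain cp where cp: "\<And>e rs d m s b. arguments_in ub gs e rs d m s b \<Longrightarrow> a e \<le> (b + 2) ^ cp"
    using polybounded_at[OF linspace_polybounded[OF assms(1)]] by blast
  \<comment> \<open>The value of \<open>a\<close> is at most (b + 2) ^ cp. With
    \<open>Suc cp\<close> the bound covers b too, as needed for the old arguments of
    \<open>PF\<close>.\<close>
  let ?c = "ca + (Suc cp + 2) * cF"
  let ?P = "\<lambda>rs d m. Seq (Pa rs m (Suc m)) (Seq (PF (m # rs) d (Suc m)) (clear m))"
  have "computes ub gs (\<lambda>e. F e (a e)) ?c ?P"
    unfolding computes_def
  proof (intro allI impI, elim conjE)
    fix e rs d m s b B
    assume A: "arguments_in ub gs e rs d m s b" and B: "(b + 2) ^ ?c \<le> B"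
    have sm: "s m = 0" "d < m" using A by (auto simp: arguments_in_def)
    have "arguments_in ub gs e rs m (Suc m) s b"
      by (rule arguments_in_shift[OF A]) (use A in \<open>auto simp: arguments_in_def\<close>)
    then have 1: "exec B (Pa rs m (Suc m)) s (s(m := a e))"
      by (rule computesD[OF Pa]) (use B power_le_power_sum[of ca ?c b] in linarith)
    let ?s = "s(m := a e)" and ?b = "(b + 2) ^ Suc cp"
    have "arguments_in ub gs e rs d (Suc m) ?s b"
      using A sm by (auto simp: arguments_in_def)
    then have "arguments_in ub gs e rs d (Suc m) ?s ?b"
      by (rule arguments_in_mono) (rule le_power_Suc)
    then have "arguments_in (ext_bound ub) (ext_args gs) (e, ?s m) (m # rs) d (Suc m) ?s ?b"
      by (rule arguments_in_ext)
        (use cp[OF A] sm power_le_power_sum[of cp "Suc cp" b] in \<open>auto intro: order_trans\<close>)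
    then have "exec B (PF (m # rs) d (Suc m)) ?s (?s(d := F (fst (e, ?s m)) (snd (e, ?s m))))"
      by (rule computesD[OF PF])
        (use B power_le_power_sum[of "(Suc cp + 2) * cF" ?c b] power_power_add_2_le[of b "Suc cp" cF] in linarith)
    then have 2: "exec B (PF (m # rs) d (Suc m)) ?s (?s(d := F e (a e)))" by simp
    show "exec B (?P rs d m) s (s(d := F e (a e)))"
      by (rule exec_eq[OF exec.Seq[OF 1 exec.Seq[OF 2 exec_clear]]]) (use sm in \<open>auto simp: fun_eq_iff\<close>)
  qed
  then show ?thesis unfolding linspace_def by blast
qed

lemma linspace_rec:
  assumes k: "linspace ub gs k" and g: "linspace ub gs g"
    and h: "linspace (ext_bound (ext_bound ub)) (ext_args (ext_args gs))
      (\<lambda>x. h (fst (fst x)) (snd (fst x)) (snd x))"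
    and bd: "polybounded ub gs bd" "\<And>e i. i \<le> k e \<Longrightarrow> rec_nat (g e) (h e) i \<le> bd e"
  shows "linspace ub gs (\<lambda>e. rec_nat (g e) (h e) (k e))"
proof -
  obtain ck Pk where Pk: "computes ub gs k ck Pk" using k by (auto simp: linspace_def)
  obtain cg Pg where Pg: "computes ub gs g cg Pg" using g by (auto simp: linspace_def)
  obtain ch Ph where Ph: "computes (ext_bound (ext_bound ub)) (ext_args (ext_args gs))
      (\<lambda>x. h (fst (fst x)) (snd (fst x)) (snd x)) ch Ph"
    using h by (auto simp: linspace_def)
  obtain cp where cp: "\<And>e rs d m s b. arguments_in ub gs e rs d m s b \<Longrightarrow> k e + bd e \<le> (b + 2) ^ cp"
    using polybounded_at[OF polybounded_add[OF linspace_polybounded[OF k] bd(1)]] by blast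
  let ?c = "ck + cg + cp + (Suc cp + 2) * ch"
  \<comment> \<open>Registers: m the rounds left, m+1 the accumulator, m+2 the index of the round,
    m+3 the next accumulator.\<close>
  let ?loop = "\<lambda>rs m. Seq (Dec m) (Seq (Ph ((m+1) # (m+2) # rs) (m+3) (m+4)) (Seq (clear (m+1))
      (Seq (transfer (m+3) (m+1)) (Inc (m+2)))))"
  let ?P = "\<lambda>rs d m. Seq (Pk rs m (m+4)) (Seq (Pg rs (m+1) (m+4)) (Seq (While m (?loop rs m))
      (Seq (transfer (m+1) d) (clear (m+2)))))"
  have "computes ub gs (\<lambda>e. rec_nat (g e) (h e) (k e)) ?c ?P"
    unfolding computes_def
  proof (intro allI impI, elim conjE)
    fix e rs d m s b B
    assume A: "arguments_in ub gs e rs d m s b" and B: "(b + 2) ^ ?c \<le> B"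
    let ?rec = "rec_nat (g e) (h e)"
    have sm: "s m = 0" "s (m+1) = 0" "s (m+2) = 0" "s (m+3) = 0" "d < m" "s d = 0"
      using A by (auto simp: arguments_in_def)
    have Bp: "(b + 2) ^ ck \<le> B" "(b + 2) ^ cg \<le> B" "(b + 2) ^ cp \<le> B" "(b + 2) ^ ((Suc cp + 2) * ch) \<le> B"
      by (rule order_trans[OF power_le_power_sum B]; simp)+
    have kb: "k e \<le> (b + 2) ^ cp" "k e \<le> B" using cp[OF A] Bp by linarith+
    have rb: "?rec i \<le> (b + 2) ^ cp" "?rec i \<le> B" if "i \<le> k e" for i
      using cp[OF A] Bp bd(2)[OF that] by linarith+
    have "arguments_in ub gs e rs m (m+4) s b"
      by (rule arguments_in_shift[OF A]) (use A in \<open>auto simp: arguments_in_def\<close>)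
    then have 1: "exec B (Pk rs m (m+4)) s (s(m := k e))"
      by (rule computesD[OF Pk]) (rule Bp)
    have "arguments_in ub gs e rs (m+1) (m+4) (s(m := k e)) b"
      by (rule arguments_in_shift[OF A]) (use A in \<open>auto simp: arguments_in_def\<close>)
    then have 2: "exec B (Pg rs (m+1) (m+4)) (s(m := k e)) (s(m := k e, m+1 := g e))"
      by (rule computesD[OF Pg]) (rule Bp)
    let ?S = "\<lambda>j. s(m := k e - j, m+1 := ?rec j, m+2 := j)"
    have S0: "s(m := k e, m+1 := g e) = ?S 0" using sm by (auto simp: fun_eq_iff)
    have 3: "exec B (While m (?loop rs m)) (?S 0) (?S (k e))"
    proof (rule exec_While_iterate)
      fix j assume j: "j < k e"
      let ?s = "s(m := k e - Suc j, m+1 := ?rec j, m+2 := j)" and ?b = "(b + 2) ^ Suc cp"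
      have l1: "exec B (Dec m) (?S j) ?s"
        by (rule exec_eq[OF exec.Dec]) (auto simp: fun_eq_iff)
      have le: "(b + 2) ^ cp \<le> ?b" by (rule power_le_power_sum) simp
      have "arguments_in ub gs e rs (m+3) (m+4) ?s b"
        by (rule arguments_in_shift[OF A]) (use A sm in \<open>auto simp: arguments_in_def\<close>)
      then have "arguments_in ub gs e rs (m+3) (m+4) ?s ?b"
        by (rule arguments_in_mono) (rule le_power_Suc)
      then have "arguments_in (ext_bound ub) (ext_args gs) (e, ?s (m+2)) ((m+2) # rs) (m+3) (m+4) ?s ?b"
        by (rule arguments_in_ext) (use kb j le in auto)
      then have "arguments_in (ext_bound (ext_bound ub)) (ext_args (ext_args gs)) ((e, ?s (m+2)), ?s (m+1))
          ((m+1) # (m+2) # rs) (m+3) (m+4) ?s ?b"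
        by (rule arguments_in_ext) (use rb[of j] j le in auto)
      from computesD[OF Ph this] have
        l2: "exec B (Ph ((m+1) # (m+2) # rs) (m+3) (m+4)) ?s (?s(m+3 := ?rec (Suc j)))"
        using Bp(4) power_power_add_2_le[of b "Suc cp" ch] by simp
      have l3: "exec B (clear (m+1)) (?s(m+3 := ?rec (Suc j))) (?s(m+3 := ?rec (Suc j), m+1 := 0))"
        by (rule exec_clear)
      have l4: "exec B (transfer (m+3) (m+1)) (?s(m+3 := ?rec (Suc j), m+1 := 0))
          (s(m := k e - Suc j, m+1 := ?rec (Suc j), m+2 := j))"
        by (rule exec_eq[OF exec_transfer])
          (use rb(2)[of "Suc j"] j sm in \<open>auto simp: fun_eq_iff\<close>)
      have l5: "exec B (Inc (m+2)) (s(m := k e - Suc j, m+1 := ?rec (Suc j), m+2 := j)) (?S (Suc j))"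
        by (rule exec_eq[OF exec.Inc]) (use kb j in \<open>auto simp: fun_eq_iff\<close>)
      have "exec B (?loop rs m) (?S j) (?S (Suc j))"
        by (rule exec.Seq[OF l1 exec.Seq[OF l2 exec.Seq[OF l3 exec.Seq[OF l4 l5]]]])
      then show "?S j m \<noteq> 0 \<and> exec B (?loop rs m) (?S j) (?S (Suc j))" using j by simp
    qed auto
    have 4: "exec B (transfer (m+1) d) (?S (k e)) (s(m+2 := k e, d := ?rec (k e)))"
      by (rule exec_eq[OF exec_transfer]) (use rb(2)[of "k e"] sm in \<open>auto simp: fun_eq_iff\<close>)
    have 5: "exec B (clear (m+2)) (s(m+2 := k e, d := ?rec (k e))) (s(d := ?rec (k e)))"
      by (rule exec_eq[OF exec_clear]) (use sm in \<open>auto simp: fun_eq_iff\<close>)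
    show "exec B (?P rs d m) s (s(d := ?rec (k e)))"
      by (rule exec.Seq[OF 1 exec.Seq[OF 2[unfolded S0] exec.Seq[OF 3 exec.Seq[OF 4 5]]]])
  qed
  then show ?thesis unfolding linspace_def by blast
qed

text \<open>The number \<open>k\<close> of rounds exists in the proof only; no register holds it. It
  may thus be exponential in the space used, unlike the counter of \<open>linspace_rec\<close>,
  whose bits must be stored. All that is bounded is the iterated value.\<close>

lemma linspace_while:
  assumes g: "linspace ub gs g"
    and t: "linspace (ext_bound ub) (ext_args gs) (\<lambda>x. t (fst x) (snd x))"
    and h: "linspace (ext_bound ub) (ext_args gs) (\<lambda>x. h (fst x) (snd x))"
    and bd: "polybounded ub gs bd" "\<And>e j. j \<le> k e \<Longrightarrow> (h e ^^ j) (g e) \<le> bd e"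
    and stop: "\<And>e. t e ((h e ^^ k e) (g e)) = 0" "\<And>e j. j < k e \<Longrightarrow> t e ((h e ^^ j) (g e)) \<noteq> 0"
  shows "linspace ub gs (\<lambda>e. (h e ^^ k e) (g e))"
proof -
  obtain ct Pt where Pt: "computes (ext_bound ub) (ext_args gs) (\<lambda>x. t (fst x) (snd x)) ct Pt"
    using t by (auto simp: linspace_def)
  obtain cg Pg where Pg: "computes ub gs g cg Pg" using g by (auto simp: linspace_def)
  obtain ch Ph where Ph: "computes (ext_bound ub) (ext_args gs) (\<lambda>x. h (fst x) (snd x)) ch Ph"
    using h by (auto simp: linspace_def)
  obtain cp where cp: "\<And>e rs d m s b. arguments_in ub gs e rs d m s b \<Longrightarrow> bd e \<le> (b + 2) ^ cp"
    using polybounded_at[OF bd(1)] by blast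
  let ?c = "cg + cp + (Suc cp + 2) * ch + (Suc cp + 2) * ct"
  \<comment> \<open>Registers: m the outcome of the test, m+1 the current value, m+2 the next
    value.\<close>
  let ?loop = "\<lambda>rs m. Seq (clear m) (Seq (Ph ((m+1) # rs) (m+2) (m+3)) (Seq (clear (m+1))
      (Seq (transfer (m+2) (m+1)) (Pt ((m+1) # rs) m (m+3)))))"
  let ?P = "\<lambda>rs d m. Seq (Pg rs (m+1) (m+3)) (Seq (Pt ((m+1) # rs) m (m+3))
      (Seq (While m (?loop rs m)) (transfer (m+1) d)))"
  have "computes ub gs (\<lambda>e. (h e ^^ k e) (g e)) ?c ?P"
    unfolding computes_def
  proof (intro allI impI, elim conjE)
    fix e rs d m s b B
    assume A: "arguments_in ub gs e rs d m s b" and B: "(b + 2) ^ ?c \<le> B"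
    let ?x = "\<lambda>j. (h e ^^ j) (g e)"
    have sm: "s m = 0" "s (m+1) = 0" "s (m+2) = 0" "d < m" "s d = 0"
      using A by (auto simp: arguments_in_def)
    have Bp: "(b + 2) ^ cg \<le> B" "(b + 2) ^ cp \<le> B" "(b + 2) ^ ((Suc cp + 2) * ch) \<le> B"
        "(b + 2) ^ ((Suc cp + 2) * ct) \<le> B"
      by (rule order_trans[OF power_le_power_sum B]; simp)+
    have xb: "?x i \<le> (b + 2) ^ cp" "?x i \<le> B" if "i \<le> k e" for i
      using cp[OF A] Bp bd(2)[OF that] by linarith+
    let ?b = "(b + 2) ^ Suc cp"
    have le: "(b + 2) ^ cp \<le> ?b" by (rule power_le_power_sum) simp
    have arg: "arguments_in (ext_bound ub) (ext_args gs) (e, ?x j) ((m+1) # rs) d' (m+3) (s(m+1 := ?x j)) ?b"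
      if "j \<le> k e" "d' = m \<or> d' = m + 2" for j d'
    proof -
      have "arguments_in ub gs e rs d' (m+3) (s(m+1 := ?x j)) b"
        by (rule arguments_in_shift[OF A]) (use A sm that in \<open>auto simp: arguments_in_def\<close>)
      then have "arguments_in ub gs e rs d' (m+3) (s(m+1 := ?x j)) ?b"
        by (rule arguments_in_mono) (rule le_power_Suc)
      then have "arguments_in (ext_bound ub) (ext_args gs) (e, (s(m+1 := ?x j)) (m+1)) ((m+1) # rs) d' (m+3)
          (s(m+1 := ?x j)) ?b"
        by (rule arguments_in_ext) (use xb[OF that(1)] le that in auto)
      then show ?thesis by simp
    qed
    have test: "exec B (Pt ((m+1) # rs) m (m+3)) (s(m+1 := ?x j)) (s(m+1 := ?x j, m := t e (?x j)))"
      if "j \<le> k e" for j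
      using computesD[OF Pt arg[OF that], of m B] Bp(4) power_power_add_2_le[of b "Suc cp" ct] by simp
    have "arguments_in ub gs e rs (m+1) (m+3) s b"
      by (rule arguments_in_shift[OF A]) (use A in \<open>auto simp: arguments_in_def\<close>)
    from computesD[OF Pg this Bp(1)] have 1: "exec B (Pg rs (m+1) (m+3)) s (s(m+1 := ?x 0))" by simp
    let ?S = "\<lambda>j. s(m+1 := ?x j, m := t e (?x j))"
    have 3: "exec B (While m (?loop rs m)) (?S 0) (?S (k e))"
    proof (rule exec_While_iterate)
      fix j assume j: "j < k e"
      have l1: "exec B (clear m) (?S j) (s(m+1 := ?x j))"
        by (rule exec_eq[OF exec_clear]) (use sm in \<open>auto simp: fun_eq_iff\<close>)
      have l2: "exec B (Ph ((m+1) # rs) (m+2) (m+3)) (s(m+1 := ?x j)) (s(m+1 := ?x j, m+2 := ?x (Suc j)))"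
        using computesD[OF Ph arg[of j], of "m+2" B] Bp(3) power_power_add_2_le[of b "Suc cp" ch] j by simp
      have l3: "exec B (clear (m+1)) (s(m+1 := ?x j, m+2 := ?x (Suc j))) (s(m+2 := ?x (Suc j)))"
        by (rule exec_eq[OF exec_clear]) (use sm in \<open>auto simp: fun_eq_iff\<close>)
      have l4: "exec B (transfer (m+2) (m+1)) (s(m+2 := ?x (Suc j))) (s(m+1 := ?x (Suc j)))"
        by (rule exec_eq[OF exec_transfer])
          (use xb(2)[of "Suc j"] j sm in \<open>auto simp: fun_eq_iff\<close>)
      have "exec B (?loop rs m) (?S j) (?S (Suc j))"
        by (rule exec.Seq[OF l1 exec.Seq[OF l2 exec.Seq[OF l3 exec.Seq[OF l4 test]]]]) (use j in simp)
      then show "?S j m \<noteq> 0 \<and> exec B (?loop rs m) (?S j) (?S (Suc j))"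
        using stop(2)[OF j] by simp
    qed (use stop in auto)
    have 4: "exec B (transfer (m+1) d) (?S (k e)) (s(d := ?x (k e)))"
      by (rule exec_eq[OF exec_transfer]) (use xb(2)[of "k e"] sm stop in \<open>auto simp: fun_eq_iff\<close>)
    show "exec B (?P rs d m) s (s(d := ?x (k e)))"
      by (rule exec.Seq[OF 1 exec.Seq[OF test[of 0] exec.Seq[OF 3 4]]]) simp
  qed
  then show ?thesis unfolding linspace_def by blast
qed

section \<open>Arithmetic, Boolean connectives and bounded quantifiers\<close>

lemma linspace_const: "linspace ub gs (\<lambda>_. k)"
  by (induction k) (auto intro: linspace_zero linspace_Suc)

lemma linspace_add:
  assumes a: "linspace ub gs a" and b: "linspace ub gs b"
  shows "linspace ub gs (\<lambda>e. a e + b e)"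
proof -
  have r: "rec_nat x (\<lambda>_. Suc) i = x + i" for x i :: nat by (induction i) auto
  have "linspace ub gs (\<lambda>e. rec_nat (a e) (\<lambda>_. Suc) (b e))"
    by (rule linspace_rec[OF b a, where bd = "\<lambda>e. a e + b e"])
      (auto simp: r intro!: linspace_Suc linspace_snd
        polybounded_add[OF a[THEN linspace_polybounded] b[THEN linspace_polybounded]])
  then show ?thesis by (simp add: r)
qed

lemma linspace_mult:
  assumes a: "linspace ub gs a" and b: "linspace ub gs b"
  shows "linspace ub gs (\<lambda>e. a e * b e)"
proof -
  have r: "rec_nat 0 (\<lambda>_ y. y + x) i = x * i" for x i :: nat by (induction i) auto
  have "linspace ub gs (\<lambda>e. rec_nat 0 (\<lambda>_ y. y + a e) (b e))"
    by (rule linspace_rec[OF b linspace_const, where bd = "\<lambda>e. a e * b e"])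
      (auto simp: r intro!: linspace_add linspace_snd
        polybounded_mult[OF a[THEN linspace_polybounded] b[THEN linspace_polybounded]] a
        linspace_weaken[of _ _ "\<lambda>x. a (fst x)"] linspace_weaken[of _ _ a])
  then show ?thesis by (simp add: r)
qed

lemma linspace_pred:
  assumes a: "linspace ub gs a"
  shows "linspace ub gs (\<lambda>e. a e - 1)"
proof -
  have r: "rec_nat 0 (\<lambda>i _. i) i = i - 1" for i :: nat by (cases i) auto
  have "linspace ub gs (\<lambda>e. rec_nat 0 (\<lambda>i _. i) (a e))"
    by (rule linspace_rec[OF a linspace_const, where bd = a])
      (auto simp: r intro!: linspace_weaken[of _ _ snd] linspace_snd linspace_polybounded a)
  then show ?thesis by (simp add: r)
qed

lemma linspace_diff:
  assumes a: "linspace ub gs a" and b: "linspace ub gs b"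
  shows "linspace ub gs (\<lambda>e. a e - b e)"
proof -
  have r: "rec_nat x (\<lambda>_ y. y - Suc 0) i = x - i" for x i :: nat by (induction i) auto
  have "linspace ub gs (\<lambda>e. rec_nat (a e) (\<lambda>_ y. y - Suc 0) (b e))"
    by (rule linspace_rec[OF b a, where bd = a])
      (auto simp: r intro!: linspace_pred[unfolded One_nat_def] linspace_snd linspace_polybounded a)
  then show ?thesis by (simp add: r)
qed

lemma linspace_if:
  assumes P: "linspace_pred ub gs P" and a: "linspace ub gs a" and b: "linspace ub gs b"
  shows "linspace ub gs (\<lambda>e. if P e then a e else b e)"
proof -
  have r: "rec_nat y (\<lambda>_ _. x) (of_bool p) = (if p then x else y)" for x y :: nat and p by auto
  have "linspace ub gs (\<lambda>e. rec_nat (b e) (\<lambda>_ _. a e) (of_bool (P e)))"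
  proof (rule linspace_rec[where bd = "\<lambda>e. a e + b e"])
    show "rec_nat (b e) (\<lambda>_ _. a e) i \<le> a e + b e" for e i by (cases i) auto
  qed (use P in \<open>auto simp: linspace_pred_def intro!: linspace_polybounded linspace_add a b
      linspace_weaken[of _ _ "\<lambda>x. a (fst x)"] linspace_weaken[of _ _ a]\<close>)
  then show ?thesis by (simp add: r)
qed

lemma linspace_pred_weaken:
  "linspace_pred ub gs P \<Longrightarrow> linspace_pred (ext_bound ub) (ext_args gs) (\<lambda>x. P (fst x))"
  unfolding linspace_pred_def by (rule linspace_weaken)

lemma linspace_pred_const: "linspace_pred ub gs (\<lambda>_. p)"
  unfolding linspace_pred_def by (rule linspace_const)

lemma linspace_pred_not:
  assumes "linspace_pred ub gs P" shows "linspace_pred ub gs (\<lambda>e. \<not> P e)"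
proof -
  have "linspace ub gs (\<lambda>e. 1 - of_bool (P e))"
    using assms unfolding linspace_pred_def by (intro linspace_diff linspace_const)
  moreover have "(\<lambda>e. 1 - of_bool (P e)) = (\<lambda>e. of_bool (\<not> P e) :: nat)" by auto
  ultimately show ?thesis by (simp only: linspace_pred_def)
qed

lemma linspace_pred_conj:
  "linspace_pred ub gs P \<Longrightarrow> linspace_pred ub gs Q \<Longrightarrow> linspace_pred ub gs (\<lambda>e. P e \<and> Q e)"
  unfolding linspace_pred_def of_bool_conj by (rule linspace_mult)

lemma linspace_pred_cong: "linspace_pred ub gs P \<Longrightarrow> (\<And>e. P e = Q e) \<Longrightarrow> linspace_pred ub gs Q"
  by (simp add: linspace_pred_def)

lemma linspace_pred_disj:
  assumes "linspace_pred ub gs P" "linspace_pred ub gs Q" shows "linspace_pred ub gs (\<lambda>e. P e \<or> Q e)"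
  by (rule linspace_pred_cong[OF linspace_pred_not[OF linspace_pred_conj[OF assms[THEN linspace_pred_not]]]]) auto

lemma linspace_pred_imp:
  assumes "linspace_pred ub gs P" "linspace_pred ub gs Q" shows "linspace_pred ub gs (\<lambda>e. P e \<longrightarrow> Q e)"
  by (rule linspace_pred_cong[OF linspace_pred_disj[OF assms(1)[THEN linspace_pred_not] assms(2)]]) auto

lemma linspace_pred_iff:
  assumes "linspace_pred ub gs P" "linspace_pred ub gs Q" shows "linspace_pred ub gs (\<lambda>e. P e = Q e)"
  by (rule linspace_pred_cong[OF linspace_pred_conj[OF linspace_pred_imp[OF assms] linspace_pred_imp[OF assms(2,1)]]]) auto

lemma linspace_pred_le:
  assumes "linspace ub gs a" "linspace ub gs b" shows "linspace_pred ub gs (\<lambda>e. a e \<le> b e)"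
proof -
  have "linspace ub gs (\<lambda>e. 1 - (a e - b e))" by (intro linspace_diff linspace_const assms)
  moreover have "(\<lambda>e. 1 - (a e - b e)) = (\<lambda>e. of_bool (a e \<le> b e))" by (auto simp: fun_eq_iff)
  ultimately show ?thesis by (simp add: linspace_pred_def)
qed

lemma linspace_pred_less:
  assumes "linspace ub gs a" "linspace ub gs b" shows "linspace_pred ub gs (\<lambda>e. a e < b e)"
  by (rule linspace_pred_cong[OF linspace_pred_not[OF linspace_pred_le[OF assms(2,1)]]]) auto

lemma linspace_pred_eq:
  assumes "linspace ub gs a" "linspace ub gs b" shows "linspace_pred ub gs (\<lambda>e. a e = b e)"
  by (rule linspace_pred_cong[OF linspace_pred_conj[OF linspace_pred_le[OF assms] linspace_pred_le[OF assms(2,1)]]]) auto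

text \<open>The last number below \<open>y\<close> with property \<open>P\<close>, or the junk value \<open>0\<close> if there is none.\<close>

definition search :: "nat \<Rightarrow> (nat \<Rightarrow> bool) \<Rightarrow> nat" where
  "search y P = rec_nat 0 (\<lambda>i r. if P i then i else r) y"

lemma search_le: "search y P \<le> y - 1"
  by (induction y) (auto simp: search_def)

lemma search_prop: "i < y \<Longrightarrow> P i \<Longrightarrow> P (search y P) \<and> i \<le> search y P"
proof (induction y)
  case (Suc y)
  then show ?case using less_antisym by (fastforce simp: search_def)
qed simp

lemma linspace_search:
  assumes y: "linspace ub gs y" and P: "linspace_pred (ext_bound ub) (ext_args gs) (\<lambda>x. P (fst x) (snd x))"
  shows "linspace ub gs (\<lambda>e. search (y e) (P e))"
  unfolding search_def
proof (rule linspace_rec[where bd = y])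
  show "i \<le> y e \<Longrightarrow> rec_nat 0 (\<lambda>i r. if P e i then i else r) i \<le> y e" for e i
    using search_le[of i "P e"] by (simp add: search_def)
qed (use y P in \<open>auto intro!: linspace_const linspace_if linspace_snd linspace_polybounded
    linspace_weaken[of _ _ snd] linspace_pred_weaken[of _ _ "\<lambda>x. P (fst x) (snd x)"]\<close>)

lemma linspace_pred_ex:
  assumes y: "linspace ub gs y" and P: "linspace_pred (ext_bound ub) (ext_args gs) (\<lambda>x. P (fst x) (snd x))"
  shows "linspace_pred ub gs (\<lambda>e. \<exists>i<y e. P e i)"
proof (rule linspace_pred_cong)
  \<comment> \<open>For y = 0 the search returns 0, which is not in range; the first conjunct
    excludes this. Otherwise the result is in range and testing it decides the question.\<close>
  show "linspace_pred ub gs (\<lambda>e. 0 < y e \<and> P e (search (y e) (P e)))"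
    unfolding linspace_pred_def
    by (rule linspace_pred_conj[unfolded linspace_pred_def])
      (use linspace_pred_less[OF linspace_const y]
        linspace_Let[OF linspace_search[OF y P], where F = "\<lambda>e i. of_bool (P e i)"] P
       in \<open>auto simp: linspace_pred_def\<close>)
  show "(0 < y e \<and> P e (search (y e) (P e))) \<longleftrightarrow> (\<exists>i<y e. P e i)" for e
  proof
    assume h: "0 < y e \<and> P e (search (y e) (P e))"
    then have "search (y e) (P e) < y e" using search_le[of "y e" "P e"] by linarith
    then show "\<exists>i<y e. P e i" using h by blast
  qed (use search_prop in auto)
qed

lemma linspace_pred_all:
  assumes y: "linspace ub gs y" and P: "linspace_pred (ext_bound ub) (ext_args gs) (\<lambda>x. P (fst x) (snd x))"
  shows "linspace_pred ub gs (\<lambda>e. \<forall>i<y e. P e i)"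
  by (rule linspace_pred_cong[OF linspace_pred_not[OF linspace_pred_ex[OF y, where P = "\<lambda>e i. \<not> P e i"]]])
    (use linspace_pred_not[OF P] in auto)

text \<open>\<open>search\<close> returns the last hit, which is the greatest q with q * y \<le> x.
  Division by 0 yields 0 in HOL and is treated apart.\<close>

lemma linspace_div:
  assumes a: "linspace ub gs a" and b: "linspace ub gs b"
  shows "linspace ub gs (\<lambda>e. a e div b e)"
proof -
  have s: "search (Suc x) (\<lambda>q. q * y \<le> x) = x div y" if "y > 0" for x y
  proof -
    have "x div y < Suc x" "x div y * y \<le> x" using le_imp_less_Suc[OF div_le_dividend] by auto
    from search_prop[of "x div y" "Suc x" "\<lambda>q. q * y \<le> x", OF this]
    have 1: "search (Suc x) (\<lambda>q. q * y \<le> x) * y \<le> x" "x div y \<le> search (Suc x) (\<lambda>q. q * y \<le> x)" by auto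
    have "search (Suc x) (\<lambda>q. q * y \<le> x) \<le> x div y"
      using 1(1) that by (simp add: less_eq_div_iff_mult_less_eq)
    then show ?thesis using 1(2) by simp
  qed
  have "linspace ub gs (\<lambda>e. if 0 < b e then search (Suc (a e)) (\<lambda>q. q * b e \<le> a e) else 0)"
    by (intro linspace_if linspace_pred_less linspace_const linspace_search linspace_Suc linspace_pred_le
        linspace_mult linspace_snd linspace_weaken[of _ _ a] linspace_weaken[of _ _ b] a b)
  moreover have "(\<lambda>e. if 0 < b e then search (Suc (a e)) (\<lambda>q. q * b e \<le> a e) else 0) = (\<lambda>e. a e div b e)"
    using s by auto
  ultimately show ?thesis by simp
qed

lemma linspace_mod:
  assumes a: "linspace ub gs a" and b: "linspace ub gs b"
  shows "linspace ub gs (\<lambda>e. a e mod b e)"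
  unfolding modulo_nat_def by (intro linspace_diff linspace_mult linspace_div a b)

lemma linspace_pred_bit:
  assumes a: "linspace ub gs a" and i: "linspace ub gs i"
  shows "linspace_pred ub gs (\<lambda>e. bit (a e) (i e))"
proof (rule linspace_pred_cong)
  have r: "rec_nat x (\<lambda>_ y. y div 2) k = x div 2 ^ k" for x k :: nat
    by (induction k) (auto simp: div_mult2_eq[symmetric] mult.commute)
  have "linspace ub gs (\<lambda>e. rec_nat (a e) (\<lambda>_ y. y div 2) (i e))"
    by (rule linspace_rec[OF i a, where bd = a])
      (auto simp: r intro!: linspace_div linspace_snd linspace_const linspace_polybounded a div_le_dividend)
  then show "linspace_pred ub gs (\<lambda>e. (a e div 2 ^ i e) mod 2 = 1)"
    unfolding r by (intro linspace_pred_eq linspace_mod linspace_const)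
  show "((a e div 2 ^ i e) mod 2 = 1) = bit (a e) (i e)" for e
    by (simp add: bit_iff_odd odd_iff_mod_2_eq_one)
qed

text \<open>Exponentials are not polynomially bounded in their arguments. The bound has to come from
  \<open>ub\<close>, which is why \<open>ub\<close> may exceed every value at hand.\<close>

lemma linspace_power2:
  assumes a: "linspace ub gs a" and bd: "polybounded ub gs (\<lambda>e. 2 ^ a e)"
  shows "linspace ub gs (\<lambda>e. 2 ^ a e)"
proof -
  have r: "rec_nat (Suc 0) (\<lambda>_ y. 2 * y) i = 2 ^ i" for i :: nat by (induction i) auto
  have "linspace ub gs (\<lambda>e. rec_nat (Suc 0) (\<lambda>_ y. 2 * y) (a e))"
  proof (rule linspace_rec[OF a linspace_const _ bd])
    show "i \<le> a e \<Longrightarrow> rec_nat (Suc 0) (\<lambda>_ y. 2 * y) i \<le> 2 ^ a e" for e i unfolding r by simp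
  qed (intro linspace_mult linspace_const linspace_snd)
  then show ?thesis by (simp only: r)
qed

lemmas linspace_intros =
  linspace_const linspace_snd linspace_Suc linspace_add linspace_mult linspace_diff linspace_if
  linspace_search linspace_div linspace_mod
  linspace_pred_const linspace_pred_not linspace_pred_conj linspace_pred_disj linspace_pred_imp
  linspace_pred_iff linspace_pred_le linspace_pred_less linspace_pred_eq linspace_pred_ex
  linspace_pred_all linspace_pred_bit linspace_weaken linspace_pred_weaken

lemma num_val_le: "num_val w \<le> 2 ^ (4 * length w)"
proof -
  have "num_val w + 1 \<le> 16 ^ length w"
  proof (induction w)
    case (Cons d w)
    then show ?case using digit_val_bounds(2)[of d] one_le_power[of "16::nat" "length w"] by simp
  qed simp
  then show ?thesis by (simp add: power_mult)
qed

theorem linspace_pred_DSPACE: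
  assumes P: "linspace_pred ub [num_val] (\<lambda>w. w \<in> L)"
    and ub: "\<And>w. ub w \<le> 2 ^ h (length w)" and h: "\<And>n. 4 * n \<le> h n"
    and f: "(\<lambda>n. real (h n)) \<in> O(f)" "(\<lambda>_. 1) \<in> O(f)"
  shows "L \<in> DSPACE f"
proof -
  obtain c Q where Q: "computes ub [num_val] (\<lambda>w. of_bool (w \<in> L)) c Q"
    using P by (auto simp: linspace_pred_def linspace_def)
  define p where "p = Q [0] 1 2"
  define N where "N = Suc (Max (insert 1 (regs p)))"
  have N: "2 \<le> N" "regs p \<subseteq> {..<N}"
    using finite_regs[of p] by (auto simp: N_def less_Suc_eq_le intro!: Max_ge)
  \<comment> \<open>2 ^ h + 2 \<le> 2 ^ (h + 2), so the values stay below 2 ^ H. The exponent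
    \<open>Suc c\<close> makes the bound cover the input also for c = 0.\<close>
  define H where "H n = (h n + 2) * Suc c + 1" for n
  have ex: "\<exists>B s. exec B p (\<lambda>i. if i = 0 then num_val w else 0) s \<and> num_val w \<le> B \<and>
       B < 2 ^ H (length w) \<and> (s 1 \<noteq> 0 \<longleftrightarrow> w \<in> L)" for w
  proof -
    let ?b = "2 ^ h (length w) :: nat" and ?s = "\<lambda>i::nat. if i = 0 then num_val w else 0"
    have b: "num_val w \<le> ?b"
      using num_val_le[of w] power_increasing[OF h[of "length w"], of "2::nat"] by linarith
    have A: "arguments_in ub [num_val] w [0] 1 2 ?s ?b"
      using b ub by (auto simp: arguments_in_def)
    have le: "?b + 2 \<le> 2 ^ (h (length w) + 2)"
      unfolding power_add power2_eq_square using one_le_power[of "2::nat" "h (length w)"] by linarith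
    have "(?b + 2) ^ Suc c \<le> (2 ^ (h (length w) + 2)) ^ Suc c"
      by (rule power_mono[OF le]) simp
    also have "\<dots> = 2 ^ ((h (length w) + 2) * Suc c)" by (simp only: power_mult)
    also have "\<dots> < 2 ^ H (length w)" by (rule power_strict_increasing) (auto simp: H_def)
    finally have "(?b + 2) ^ Suc c < 2 ^ H (length w)" .
    moreover have "(?b + 2) ^ c \<le> (?b + 2) ^ Suc c" by (rule power_le_power_sum) simp
    then have "exec ((?b + 2) ^ Suc c) p ?s (?s(1 := of_bool (w \<in> L)))"
      unfolding p_def by (rule computesD[OF Q A])
    moreover have "num_val w \<le> (?b + 2) ^ Suc c"
      using b le_power_Suc[of ?b c] by linarith
    ultimately show ?thesis by fastforce
  qed
  let ?s = "\<lambda>n. N * (H n + 2)"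
  have "(\<lambda>n. real (?s n)) = (\<lambda>n. real (N * Suc c) * real (h n) + real (N * (2 * Suc c + 3)) * 1)"
    by (auto simp: H_def algebra_simps)
  moreover have "(\<lambda>n. real (N * Suc c) * real (h n) + real (N * (2 * Suc c + 3)) * 1) \<in> O(f)"
    by (intro sum_in_bigo(1) landau_o.big.cmult_in_iff[THEN iffD2] f) (use f N in \<open>auto simp del: of_nat_mult\<close>)
  ultimately have "(\<lambda>n. real (?s n)) \<in> O(f)" by metis
  moreover have "turing_machine (counter_tm N p)" by (rule turing_machine_counter_tm[OF N])
  moreover have "tm_decides (counter_tm N p) L" "\<And>w. tm_space (counter_tm N p) w \<le> ?s (length w)"
    using counter_tm_decides[OF N ex] by blast+
  ultimately show ?thesis
    unfolding DSPACE_def by (intro CollectI exI[of _ "counter_tm N p"] exI[of _ ?s]) auto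
qed

section \<open>Recursion with a stack that is a number\<close>

text \<open>A stack frame consists of three base-\<open>A\<close> digits: the argument (plus one, so that only the empty
  stack is the number \<open>0\<close>), the loop counter and the accumulator. A machine state appends one more
  digit: \<open>0\<close> while the topmost call is running, and the successor of the value that was returned last.\<close>

definition push_frame :: "nat \<Rightarrow> nat \<Rightarrow> nat \<Rightarrow> nat \<Rightarrow> nat \<Rightarrow> nat" where
  "push_frame A k c acc st = ((st * A + Suc k) * A + c) * A + acc"

text \<open>The last digit of \<open>x\<close> is the return digit; below it, repeated division by
  \<open>A\<close> exposes the accumulator, the counter, the argument plus one and the rest of the
  stack. The branches are: call a child, skip a non-child, return, and absorb a returned value. As
  arithmetic on a single number the step can be iterated by \<open>linspace_while\<close>.\<close>

definition stack_step :: "nat \<Rightarrow> nat \<Rightarrow> (nat \<Rightarrow> nat \<Rightarrow> bool) \<Rightarrow> (nat \<Rightarrow> nat) \<Rightarrow>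
    (nat \<Rightarrow> nat \<Rightarrow> nat \<Rightarrow> nat \<Rightarrow> nat) \<Rightarrow> (nat \<Rightarrow> nat \<Rightarrow> nat) \<Rightarrow> nat \<Rightarrow> nat" where
  "stack_step A Y child key upd fin x =
    (if x mod A = 0 then
       if x div A div A mod A < Y then
         if child (x div A div A div A mod A - 1) (x div A div A mod A)
         then push_frame A (key (x div A div A mod A)) 0 0 (x div A) * A
         else push_frame A (x div A div A div A mod A - 1) (Suc (x div A div A mod A)) (x div A mod A)
           (x div A div A div A div A) * A
       else x div A div A div A div A * A + Suc (fin (x div A div A div A mod A - 1) (x div A mod A))
     else push_frame A (x div A div A div A mod A - 1) (Suc (x div A div A mod A))
       (upd (x div A div A div A mod A - 1) (x div A div A mod A) (x div A mod A) (x mod A - 1))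
       (x div A div A div A div A) * A)"

definition stack_running :: "nat \<Rightarrow> nat \<Rightarrow> bool" where
  "stack_running A x \<longleftrightarrow> x div A \<noteq> 0 \<or> x mod A = 0"

locale stack_recursion =
  fixes A Y :: nat and child :: "nat \<Rightarrow> nat \<Rightarrow> bool" and key :: "nat \<Rightarrow> nat"
    and upd :: "nat \<Rightarrow> nat \<Rightarrow> nat \<Rightarrow> nat \<Rightarrow> nat" and "fin" :: "nat \<Rightarrow> nat \<Rightarrow> nat"
    and rank :: "nat \<Rightarrow> nat"
  assumes Y_less: "Y < A"
    and key_less: "\<And>c. Suc (key c) < A"
    and upd_less: "\<And>k c acc v. upd k c acc v < A"
    and fin_less: "\<And>k acc. Suc (fin k acc) < A"
    and rank_less: "\<And>k c. child k c \<Longrightarrow> rank (key c) < rank k"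
begin

function result :: "nat \<Rightarrow> nat" where
  "result k = fin k (fold (\<lambda>c acc. if child k c then upd k c acc (result (key c)) else acc) [0..<Y] 0)"
  by auto
termination by (relation "measure rank") (auto simp: rank_less)

declare result.simps [simp del]

definition accum :: "nat \<Rightarrow> nat \<Rightarrow> nat" where
  "accum k j = fold (\<lambda>c acc. if child k c then upd k c acc (result (key c)) else acc) [0..<j] 0"

lemma accum_0: "accum k 0 = 0"
  by (simp add: accum_def)

lemma accum_Suc:
  "accum k (Suc j) = (if child k j then upd k j (accum k j) (result (key j)) else accum k j)"
  by (simp add: accum_def)

lemma result_eq: "result k = fin k (accum k Y)"
  unfolding accum_def by (rule result.simps)

lemma accum_less: "accum k j < A"
  using Y_less upd_less by (induction j) (auto simp: accum_0 accum_Suc)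

abbreviation "step \<equiv> stack_step A Y child key upd fin"

lemma push_frame_fields:
  assumes "Suc k < A" "c < A" "acc < A"
  shows "push_frame A k c acc st mod A = acc" "push_frame A k c acc st div A mod A = c"
    "push_frame A k c acc st div A div A mod A - 1 = k" "push_frame A k c acc st div A div A div A = st"
    "push_frame A k c acc st \<noteq> 0"
proof -
  have d: "(x * A + y) div A = x" "(x * A + y) mod A = y" if "y < A" for x y using that by auto
  show "push_frame A k c acc st mod A = acc" "push_frame A k c acc st div A mod A = c"
    "push_frame A k c acc st div A div A mod A - 1 = k" "push_frame A k c acc st div A div A div A = st"
    unfolding push_frame_def d[OF assms(1)] d[OF assms(2)] d[OF assms(3)] by simp_all
  show "push_frame A k c acc st \<noteq> 0" using assms by (simp add: push_frame_def)
qed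

lemma push_frame_less:
  assumes "Suc k < A" "c < A" "acc < A" "st < A ^ (3 * j)"
  shows "push_frame A k c acc st < A ^ (3 * Suc j)"
proof -
  have less: "x * A + y < z * A" if "x < z" "y < A" for x y z
  proof -
    have "x * A + y < Suc x * A" using that by simp
    also have "\<dots> \<le> z * A" using that by (intro mult_right_mono) auto
    finally show ?thesis .
  qed
  have "push_frame A k c acc st < A ^ (3 * j) * A * A * A"
    unfolding push_frame_def by (intro less assms)
  then show ?thesis by (simp add: power_add mult.assoc power3_eq_cube mult.commute)
qed

inductive trail :: "nat \<Rightarrow> nat \<Rightarrow> nat \<Rightarrow> bool" for bd where
  here: "trail bd x x"
| there: "stack_running A x \<Longrightarrow> x \<le> bd \<Longrightarrow> trail bd (step x) y \<Longrightarrow> trail bd x y"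

lemma trail_trans: "trail bd x y \<Longrightarrow> trail bd y z \<Longrightarrow> trail bd x z"
  by (induction rule: trail.induct) (auto intro: trail.there)

lemma trail_iterate:
  "trail bd x y \<Longrightarrow> \<exists>k. (step ^^ k) x = y \<and> (\<forall>j<k. stack_running A ((step ^^ j) x) \<and> (step ^^ j) x \<le> bd)"
proof (induction rule: trail.induct)
  case (here x)
  then show ?case by (intro exI[of _ 0]) auto
next
  case (there x y)
  then obtain k where k: "(step ^^ k) (step x) = y"
    "\<forall>j<k. stack_running A ((step ^^ j) (step x)) \<and> (step ^^ j) (step x) \<le> bd" by blast
  have "stack_running A ((step ^^ j) x) \<and> (step ^^ j) x \<le> bd" if "j < Suc k" for j
    using that k(2) there(1,2) by (cases j) (auto simp: funpow_swap1)
  then show ?case using k(1) by (intro exI[of _ "Suc k"]) (auto simp: funpow_swap1)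
qed

text \<open>Stack depth \<open>j\<close> plus remaining rank stays below \<open>D\<close>, since
  every call lowers the rank. So there are never more than \<open>D\<close> frames of three digits,
  plus the return digit.\<close>

lemma trail_call:
  assumes "Suc k < A" "st < A ^ (3 * j)" "j + rank k < D"
  shows "trail (A ^ (3 * D + 1)) (push_frame A k 0 0 st * A) (st * A + Suc (result k))"
  using assms
proof (induction "rank k" arbitrary: k st j rule: less_induct)
  case less
  let ?bd = "A ^ (3 * D + 1)"
  have A: "0 < A" using less.prems by simp
  have bd: "push_frame A k c acc st * A + r \<le> ?bd" if "c < A" "acc < A" "r < A" for c acc r
  proof -
    have "Suc (push_frame A k c acc st) * A \<le> A ^ (3 * Suc j) * A"
      using push_frame_less[OF less.prems(1) that(1,2) less.prems(2)] by (intro mult_right_mono) auto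
    also have "\<dots> = A ^ (3 * Suc j + 1)" unfolding power_add by simp
    also have "\<dots> \<le> ?bd" by (rule power_increasing) (use less.prems A in auto)
    finally show ?thesis using that(3) by simp
  qed
  have fields: "(push_frame A k c acc st * A + r) mod A = r"
    "(push_frame A k c acc st * A + r) div A = push_frame A k c acc st" if "r < A" for c acc r
    using that by auto
  \<comment> \<open>The loop of the topmost frame: a child is handled by the outer induction on the
    rank, one level higher on the stack.\<close>
  have run: "trail ?bd (push_frame A k 0 0 st * A) (push_frame A k c (accum k c) st * A)" if "c \<le> Y" for c
    using that
  proof (induction c)
    case 0
    show ?case by (simp add: accum_0 trail.here)
  next
    case (Suc c)
    let ?x = "push_frame A k c (accum k c) st * A"
    have c: "c < A" "c < Y" using Suc.prems Y_less by auto
    note f = push_frame_fields[OF less.prems(1) c(1) accum_less]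
    have g: "?x mod A = 0" "?x div A = push_frame A k c (accum k c) st" using A by simp_all
    have ok: "stack_running A ?x" "?x \<le> ?bd"
      using bd[OF c(1) accum_less A, of k c] f(5) A by (auto simp: stack_running_def)
    have "trail ?bd ?x (push_frame A k (Suc c) (accum k (Suc c)) st * A)"
    proof (cases "child k c")
      case False
      have "step ?x = push_frame A k (Suc c) (accum k (Suc c)) st * A"
        unfolding stack_step_def g f using False c A by (simp add: accum_Suc)
      then show ?thesis using trail.there[OF ok] trail.here by metis
    next
      case True
      let ?fr = "push_frame A k c (accum k c) st"
      have s1: "step ?x = push_frame A (key c) 0 0 ?fr * A"
        unfolding stack_step_def g f using True c A by simp
      have s2: "trail ?bd (push_frame A (key c) 0 0 ?fr * A) (?fr * A + Suc (result (key c)))"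
        by (rule less.hyps[OF rank_less[OF True] key_less
              push_frame_less[OF less.prems(1) c(1) accum_less less.prems(2)]])
          (use rank_less[OF True] less.prems in auto)
      have r: "Suc (result (key c)) < A" by (simp add: result_eq fin_less)
      let ?y = "?fr * A + Suc (result (key c))"
      have s3: "step ?y = push_frame A k (Suc c) (accum k (Suc c)) st * A"
        unfolding stack_step_def fields[OF r] f using True by (simp add: accum_Suc)
      have "stack_running A ?y" "?y \<le> ?bd"
        using bd[OF c(1) accum_less r] f(5) fields[OF r] by (auto simp: stack_running_def)
      from trail.there[OF this] s3 have "trail ?bd ?y (push_frame A k (Suc c) (accum k (Suc c)) st * A)"
        by (metis trail.here)
      from trail_trans[OF s2 this] show ?thesis using trail.there[OF ok] s1 by metis
    qed
    from trail_trans[OF Suc.IH this] show ?case using Suc.prems by simp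
  qed
  let ?x = "push_frame A k Y (accum k Y) st * A"
  note f = push_frame_fields[OF less.prems(1) Y_less accum_less]
  have g: "?x mod A = 0" "?x div A = push_frame A k Y (accum k Y) st" using A by simp_all
  have ok: "stack_running A ?x" "?x \<le> ?bd"
    using bd[OF Y_less accum_less A, of k Y] f(5) A by (auto simp: stack_running_def)
  have "step ?x = st * A + Suc (result k)"
    unfolding stack_step_def g f by (simp add: result_eq)
  then have "trail ?bd ?x (st * A + Suc (result k))" using trail.there[OF ok] trail.here by metis
  from trail_trans[OF run[OF order_refl] this] show ?case .
qed

theorem stack_recursion:
  assumes "Suc k < A" "rank k < D"
  shows "\<exists>n. (step ^^ n) (push_frame A k 0 0 0 * A) = Suc (result k) \<and> \<not> stack_running A (Suc (result k)) \<and>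
    (\<forall>j<n. stack_running A ((step ^^ j) (push_frame A k 0 0 0 * A))) \<and>
    (\<forall>j\<le>n. (step ^^ j) (push_frame A k 0 0 0 * A) \<le> A ^ (3 * D + 1))"
proof -
  let ?x = "push_frame A k 0 0 0 * A"
  have r: "Suc (result k) < A" by (simp add: result_eq fin_less)
  have "trail (A ^ (3 * D + 1)) ?x (0 * A + Suc (result k))"
    by (rule trail_call[where j = 0]) (use assms in auto)
  from trail_iterate[OF this] obtain n where n: "(step ^^ n) ?x = Suc (result k)"
    "\<forall>j<n. stack_running A ((step ^^ j) ?x) \<and> (step ^^ j) ?x \<le> A ^ (3 * D + 1)" by auto
  have "1 * A \<le> A ^ (3 * D) * A" by (intro mult_right_mono) (use assms in auto)
  then have "Suc (result k) \<le> A ^ (3 * D + 1)" using r by (simp only: power_add power_one_right)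
  then have "\<forall>j\<le>n. (step ^^ j) ?x \<le> A ^ (3 * D + 1)" using n by (metis le_neq_implies_less)
  moreover have "\<not> stack_running A (Suc (result k))" using r by (simp add: stack_running_def)
  ultimately show ?thesis using n by blast
qed

end

section \<open>Numbers as sets of numbers\<close>

lemma bit_less: "x < 2 ^ n \<Longrightarrow> bit (x :: nat) j \<Longrightarrow> j < n"
  by (metis bit_take_bit_iff take_bit_nat_eq_self)

lemma ex_bits: "\<exists>s<2 ^ n. \<forall>j<n. bit (s :: nat) j = P j"
proof -
  let ?s = "take_bit n (horner_sum of_bool 2 (map P [0..<n])) :: nat"
  have "?s < 2 ^ n" by (rule take_bit_nat_less_exp)
  moreover have "\<forall>j<n. bit ?s j = P j" by (auto simp: bit_take_bit_iff bit_horner_sum_bit_iff)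
  ultimately show ?thesis by blast
qed

text \<open>The code of a set of numbers below \<open>n\<close>, found by search. \<open>y\<close>
  stands for 2 ^ n and is passed separately, so that the closure rule does not involve an
  exponential.\<close>

definition collect_bits :: "nat \<Rightarrow> nat \<Rightarrow> (nat \<Rightarrow> bool) \<Rightarrow> nat" where
  "collect_bits y n P = search y (\<lambda>s. \<forall>j<n. bit s j = P j)"

lemma collect_bits_less: "collect_bits (2 ^ n) n P < 2 ^ n"
  using search_le[of "2 ^ n"] unfolding collect_bits_def by (metis One_nat_def Suc_pred le_imp_less_Suc
      less_Suc_eq_le zero_less_numeral zero_less_power)

lemma bit_collect_bits: "bit (collect_bits (2 ^ n) n P) j \<longleftrightarrow> j < n \<and> P j"
proof -
  obtain s where s: "s < 2 ^ n" "\<forall>j<n. bit (s :: nat) j = P j" using ex_bits by blast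
  from search_prop[of s "2 ^ n" "\<lambda>s. \<forall>j<n. bit s j = P j", OF s]
  have "\<forall>j<n. bit (collect_bits (2 ^ n) n P) j = P j" by (simp add: collect_bits_def)
  then show ?thesis using bit_less[OF collect_bits_less] by blast
qed

lemma linspace_collect_bits:
  assumes "linspace ub gs y" "linspace ub gs n" "linspace_pred (ext_bound (ext_bound ub)) (ext_args (ext_args gs))
    (\<lambda>x. P (fst (fst x)) (snd x))"
  shows "linspace ub gs (\<lambda>e. collect_bits (y e) (n e) (P e))"
  unfolding collect_bits_def by (intro linspace_intros assms)

section \<open>Greatest fixed points of search problems\<close>

text \<open>
  A cloud \<open>C < Y\<close> is good if it is coherent and each of its flaws \<open>d < Q\<close> is repaired by a good cloud
  reachable from it. Reachability from \<open>C\<close> only depends on \<open>key C\<close>, and keys shrink along it. So the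
  flaws that can be repaired from a given key are found by recursion along strictly shrinking keys
  (\<open>child_cloud\<close>, \<open>collect_repairs\<close>), followed by a greatest fixed point among the clouds with the same
  key (\<open>close_repairs\<close>).
\<close>

definition child_cloud :: "nat \<Rightarrow> (nat \<Rightarrow> bool) \<Rightarrow> (nat \<Rightarrow> nat \<Rightarrow> bool) \<Rightarrow> (nat \<Rightarrow> nat) \<Rightarrow> nat \<Rightarrow> nat \<Rightarrow> bool" where
  "child_cloud m coh reach key k c \<longleftrightarrow> coh c \<and> reach k c \<and>
     (\<forall>j<m. bit (key c) j \<longrightarrow> bit k j) \<and> (\<exists>j<m. bit k j \<and> \<not> bit (key c) j)"

definition collect_repairs ::
    "nat \<Rightarrow> nat \<Rightarrow> (nat \<Rightarrow> nat \<Rightarrow> bool) \<Rightarrow> (nat \<Rightarrow> nat \<Rightarrow> bool) \<Rightarrow> nat \<Rightarrow> nat \<Rightarrow> nat \<Rightarrow> nat \<Rightarrow> nat" where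
  "collect_repairs q Q flaw repairs k c acc v =
     collect_bits q Q (\<lambda>d. bit acc d \<or> (\<forall>d'<Q. flaw c d' \<longrightarrow> bit v d') \<and> repairs c d)"

text \<open>By Knaster-Tarski the greatest fixed point is the union of all post-fixed points, so a
  quantifier over bit vectors \<open>S\<close> replaces the iteration.\<close>

definition close_repairs ::
    "nat \<Rightarrow> nat \<Rightarrow> nat \<Rightarrow> (nat \<Rightarrow> bool) \<Rightarrow> (nat \<Rightarrow> nat \<Rightarrow> bool) \<Rightarrow> (nat \<Rightarrow> nat) \<Rightarrow> (nat \<Rightarrow> nat \<Rightarrow> bool) \<Rightarrow>
     (nat \<Rightarrow> nat \<Rightarrow> bool) \<Rightarrow> nat \<Rightarrow> nat \<Rightarrow> nat" where
  "close_repairs q Y Q coh reach key flaw repairs k acc =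
     collect_bits q Q (\<lambda>d. \<exists>S<q. bit S d \<and> (\<forall>d'<Q. bit S d' \<longrightarrow> bit acc d' \<or>
       (\<exists>c<Y. coh c \<and> reach k c \<and> key c = k \<and> (\<forall>d''<Q. flaw c d'' \<longrightarrow> bit S d'') \<and> repairs c d')))"

locale cloud_search =
  fixes Y Q m :: nat and coh :: "nat \<Rightarrow> bool" and reach :: "nat \<Rightarrow> nat \<Rightarrow> bool" and key :: "nat \<Rightarrow> nat"
    and flaw repairs :: "nat \<Rightarrow> nat \<Rightarrow> bool"
  assumes key_less: "\<And>c. key c < 2 ^ m"
    and reach_key: "\<And>c c' j. coh c \<Longrightarrow> coh c' \<Longrightarrow> reach (key c) c' \<Longrightarrow> bit (key c') j \<Longrightarrow> bit (key c) j"
begin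

coinductive good :: "nat \<Rightarrow> bool" where
  "C < Y \<Longrightarrow> coh C \<Longrightarrow> (\<And>d. d < Q \<Longrightarrow> flaw C d \<Longrightarrow> \<exists>C'. good C' \<and> reach (key C) C' \<and> repairs C' d) \<Longrightarrow> good C"

lemma good_iff:
  "good C \<longleftrightarrow> C < Y \<and> coh C \<and> (\<forall>d<Q. flaw C d \<longrightarrow> (\<exists>C'. good C' \<and> reach (key C) C' \<and> repairs C' d))"
  by (auto elim: good.cases intro: good.intros)

abbreviation "child \<equiv> child_cloud m coh reach key"
abbreviation "upd \<equiv> collect_repairs (2 ^ Q) Q flaw repairs"
abbreviation "fin \<equiv> close_repairs (2 ^ Q) Y Q coh reach key flaw repairs"

definition rank :: "nat \<Rightarrow> nat" where
  "rank k = card {j. j < m \<and> bit k j}"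

lemma rank_le: "rank k \<le> m"
proof -
  have "{j. j < m \<and> bit k j} \<subseteq> {..<m}" by auto
  from card_mono[OF _ this] show ?thesis by (simp add: rank_def)
qed

lemma upd_less: "upd k c acc v < 2 ^ Q" and fin_less: "fin k acc < 2 ^ Q"
  by (simp_all only: collect_repairs_def close_repairs_def collect_bits_less)

lemma rank_less:
  assumes "child k c" shows "rank (key c) < rank k"
  unfolding rank_def by (rule psubset_card_mono) (use assms in \<open>auto simp: child_cloud_def\<close>)

context
  fixes A :: nat
  assumes A: "Y < A" "2 ^ m < A" "2 ^ Q < A"
begin

interpretation rc: stack_recursion A Y child key upd "fin" rank
proof
  show "Suc (key c) < A" for c using key_less[of c] A by simp
  show "upd k c acc v < A" for k c acc v using upd_less[of k c acc v] A by simp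
  show "Suc (fin k acc) < A" for k acc using fin_less[of k acc] A by simp
qed (use A rank_less in auto)

lemma bit_upd: "bit (upd k c acc v) d \<longleftrightarrow>
    d < Q \<and> (bit acc d \<or> (\<forall>d'<Q. flaw c d' \<longrightarrow> bit v d') \<and> repairs c d)"
  by (simp add: collect_repairs_def bit_collect_bits)

lemma bit_accum:
  "bit (rc.accum k j) d \<longleftrightarrow>
    d < Q \<and> (\<exists>c<j. child k c \<and> (\<forall>d'<Q. flaw c d' \<longrightarrow> bit (rc.result (key c)) d') \<and> repairs c d)"
proof (induction j)
  case (Suc j)
  then show ?case by (cases "child k j") (auto simp: rc.accum_Suc bit_upd less_Suc_eq)
qed (simp add: rc.accum_0)

text \<open>Induction on the number of bits of the key. Repairs by clouds with a strictly smaller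
  key are collected in \<open>rc.accum\<close> by the induction hypothesis; repairs by clouds with
  the same key are settled by the post-fixed point.\<close>

lemma bit_result:
  assumes "coh C"
  shows "d < Q \<Longrightarrow> bit (rc.result (key C)) d \<longleftrightarrow> (\<exists>C'. good C' \<and> reach (key C) C' \<and> repairs C' d)"
  using assms
proof (induction "rank (key C)" arbitrary: C d rule: less_induct)
  case less
  let ?k = "key C"
  have IH: "good c \<longleftrightarrow> c < Y \<and> coh c \<and> (\<forall>d'<Q. flaw c d' \<longrightarrow> bit (rc.result (key c)) d')"
    if "child ?k c" for c
    using less.hyps[OF rank_less[OF that]] that good_iff[of c] by (auto simp: child_cloud_def)
  have acc: "bit (rc.accum ?k Y) d \<longleftrightarrow> d < Q \<and> (\<exists>c. child ?k c \<and> good c \<and> repairs c d)" for d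
    unfolding bit_accum using IH by (auto simp: child_cloud_def)
  define closed where "closed S \<longleftrightarrow> (\<forall>d'<Q. bit S d' \<longrightarrow> bit (rc.accum ?k Y) d' \<or>
       (\<exists>c<Y. coh c \<and> reach ?k c \<and> key c = ?k \<and> (\<forall>d''<Q. flaw c d'' \<longrightarrow> bit S d'') \<and> repairs c d'))"
    for S :: nat
  have res: "bit (rc.result ?k) d \<longleftrightarrow> d < Q \<and> (\<exists>S<2 ^ Q. bit S d \<and> closed S)" for d
    unfolding rc.result_eq close_repairs_def bit_collect_bits closed_def by simp
  show ?case
  proof
    assume "bit (rc.result ?k) d"
    then obtain S where S: "bit S d" "closed S" using res by blast
    have step: "\<exists>C'. (good C' \<or> C' < Y \<and> coh C' \<and> key C' = ?k \<and> (\<forall>d''<Q. flaw C' d'' \<longrightarrow> bit S d''))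
        \<and> reach ?k C' \<and> repairs C' d'" if "d' < Q" "bit S d'" for d'
      using S(2) that unfolding closed_def acc by (auto simp: child_cloud_def)
    \<comment> \<open>Soundness is coinductive: a cloud with this key whose flaws all lie in
      \<open>S\<close> finds repairers that are good already or again of this kind.\<close>
    have good: "good c" if "c < Y \<and> coh c \<and> key c = ?k \<and> (\<forall>d''<Q. flaw c d'' \<longrightarrow> bit S d'')" for c
      using that
    proof (coinduction arbitrary: c)
      case good
      then show ?case using step by metis
    qed
    show "\<exists>C'. good C' \<and> reach ?k C' \<and> repairs C' d" using step[OF less.prems(1) S(1)] good by blast
  next
    assume "\<exists>C'. good C' \<and> reach ?k C' \<and> repairs C' d"
    \<comment> \<open>For completeness the set of all flaws that are really repairable is the
      post-fixed point.\<close>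
    moreover define S where "S = collect_bits (2 ^ Q) Q (\<lambda>d. \<exists>C'. good C' \<and> reach ?k C' \<and> repairs C' d)"
    ultimately have "bit S d" using less.prems(1) by (simp add: bit_collect_bits)
    moreover have "closed S"
      unfolding closed_def
    proof (intro allI impI)
      fix d' assume d': "d' < Q" "bit S d'"
      then obtain C' where C': "good C'" "reach ?k C'" "repairs C' d'"
        by (auto simp: S_def bit_collect_bits)
      have g: "C' < Y" "coh C'" "\<forall>d<Q. flaw C' d \<longrightarrow> (\<exists>C''. good C'' \<and> reach (key C') C'' \<and> repairs C'' d)"
        using iffD1[OF good_iff C'(1)] by auto
      have sub: "bit (key C') j \<Longrightarrow> bit ?k j" for j
        using reach_key[OF less.prems(2) g(2) C'(2)] .
      show "bit (rc.accum ?k Y) d' \<or> (\<exists>c<Y. coh c \<and> reach ?k c \<and> key c = ?k \<and>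
          (\<forall>d''<Q. flaw c d'' \<longrightarrow> bit S d'') \<and> repairs c d')"
      proof (cases "\<exists>j<m. bit ?k j \<and> \<not> bit (key C') j")
        case True
        then have "child ?k C'" using g C' sub by (auto simp: child_cloud_def)
        then show ?thesis using acc C' d' by blast
      next
        case False
        then have k: "key C' = ?k"
          using sub bit_less[OF key_less] by (intro bit_eqI) blast
        then have "\<forall>d''<Q. flaw C' d'' \<longrightarrow> bit S d''"
          using g(3) by (auto simp: S_def bit_collect_bits)
        then show ?thesis using g C' k by blast
      qed
    qed
    ultimately show "bit (rc.result ?k) d"
      unfolding res using less.prems(1) collect_bits_less by (auto simp: S_def)
  qed
qed

theorem good_iff_machine:
  "\<exists>n v. (stack_step A Y child key upd fin ^^ n) (push_frame A (key C) 0 0 0 * A) = Suc v \<and>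
    \<not> stack_running A (Suc v) \<and>
    (\<forall>j<n. stack_running A ((stack_step A Y child key upd fin ^^ j) (push_frame A (key C) 0 0 0 * A))) \<and>
    (\<forall>j\<le>n. (stack_step A Y child key upd fin ^^ j) (push_frame A (key C) 0 0 0 * A) \<le> A ^ (3 * Suc m + 1)) \<and>
    (good C \<longleftrightarrow> C < Y \<and> coh C \<and> (\<forall>d<Q. flaw C d \<longrightarrow> bit v d))"
proof -
  have "Suc (key C) < A" "rank (key C) < Suc m"
    using key_less[of C] A rank_le[of "key C"] by auto
  from rc.stack_recursion[OF this] show ?thesis
  proof (elim exE, intro exI conjI; (elim conjE)?)
    show "good C \<longleftrightarrow> C < Y \<and> coh C \<and> (\<forall>d<Q. flaw C d \<longrightarrow> bit (rc.result (key C)) d)"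
      using good_iff[of C] bit_result[of C] by auto
  qed
qed

end

end

section \<open>Types and clouds\<close>

text \<open>
  The subformulas of a formula of length \<open>n\<close> are addressed by their starting positions in the string,
  \<open>lt\<close> gives the letter (as a digit, see \<open>digit_val\<close>) at a position, \<open>r\<close> the right conjunct of the
  conjunction at a position, and \<open>sm\<close> relates the positions of the same atom. A type is a truth
  assignment to the positions, coded as a number below \<open>2 ^ n\<close>, and a cloud is a set of types, coded as
  a number below \<open>2 ^ 2 ^ n\<close>; it stands for the types realised in an \<open>L\<close>-class.
\<close>

definition type_ok :: "bool \<Rightarrow> nat \<Rightarrow> (nat \<Rightarrow> nat) \<Rightarrow> (nat \<Rightarrow> nat) \<Rightarrow> (nat \<Rightarrow> nat \<Rightarrow> bool) \<Rightarrow> nat \<Rightarrow> bool" where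
  "type_ok rf n lt r sm t \<longleftrightarrow> (\<forall>i<n.
     (lt i = 3 \<longrightarrow> bit t i = (\<not> bit t (Suc i))) \<and>
     (lt i = 1 \<longrightarrow> bit t i = (bit t (Suc i) \<and> bit t (r i))) \<and>
     (rf \<and> lt i = 5 \<and> bit t i \<longrightarrow> bit t (Suc i)) \<and>
     (\<forall>j<n. sm i j \<longrightarrow> bit t i = bit t j))"

text \<open>What an accessible world inherits: a true box together with its body, as for a
  transitive relation, and in the case of SSL the truth values of all atoms.\<close>

definition type_le :: "bool \<Rightarrow> nat \<Rightarrow> (nat \<Rightarrow> nat) \<Rightarrow> nat \<Rightarrow> nat \<Rightarrow> bool" where
  "type_le ssl n lt t u \<longleftrightarrow> (\<forall>i<n. (lt i = 5 \<and> bit t i \<longrightarrow> bit u i \<and> bit u (Suc i)) \<and>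
     (ssl \<and> lt i = 7 \<longrightarrow> bit t i = bit u i))"

definition cloud_ok ::
    "bool \<Rightarrow> nat \<Rightarrow> nat \<Rightarrow> (nat \<Rightarrow> nat) \<Rightarrow> (nat \<Rightarrow> nat) \<Rightarrow> (nat \<Rightarrow> nat \<Rightarrow> bool) \<Rightarrow> nat \<Rightarrow> bool" where
  "cloud_ok rf n p lt r sm C \<longleftrightarrow> (\<forall>t<p. bit C t \<longrightarrow> type_ok rf n lt r sm t \<and>
     (\<forall>i<n. lt i = 6 \<longrightarrow> bit t i = (\<forall>u<p. bit C u \<longrightarrow> bit u (Suc i))))"

text \<open>The first half of the key is the up-closure of the cloud, the second half the complement of its
  down-closure. Both shrink when one passes to a successor cloud.\<close>

definition cloud_key :: "bool \<Rightarrow> nat \<Rightarrow> nat \<Rightarrow> nat \<Rightarrow> (nat \<Rightarrow> nat) \<Rightarrow> nat \<Rightarrow> nat" where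
  "cloud_key ssl n p y lt C = collect_bits y (2 * p) (\<lambda>j.
     j < p \<and> (\<exists>t<p. bit C t \<and> type_le ssl n lt t j) \<or>
     p \<le> j \<and> \<not> ssl \<and> \<not> (\<exists>t<p. bit C t \<and> (\<forall>u<p. type_le ssl n lt t u \<longrightarrow> type_le ssl n lt (j - p) u)))"

definition cloud_reach :: "bool \<Rightarrow> nat \<Rightarrow> nat \<Rightarrow> (nat \<Rightarrow> nat) \<Rightarrow> nat \<Rightarrow> nat \<Rightarrow> bool" where
  "cloud_reach ssl n p lt k C \<longleftrightarrow> (\<forall>t<p. bit C t \<longrightarrow> bit k t) \<and>
     (\<not> ssl \<longrightarrow> (\<forall>s<p. \<not> bit k (p + s) \<longrightarrow> (\<exists>t<p. bit C t \<and> type_le ssl n lt s t)))"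

text \<open>The flaw number \<open>t * n + i\<close> asks for a witness against the box at position \<open>i\<close> above the type \<open>t\<close>.\<close>

definition cloud_flaw :: "nat \<Rightarrow> (nat \<Rightarrow> nat) \<Rightarrow> nat \<Rightarrow> nat \<Rightarrow> bool" where
  "cloud_flaw n lt C d \<longleftrightarrow> bit C (d div n) \<and> lt (d mod n) = 5 \<and> \<not> bit (d div n) (d mod n)"

definition cloud_repairs :: "bool \<Rightarrow> nat \<Rightarrow> nat \<Rightarrow> (nat \<Rightarrow> nat) \<Rightarrow> nat \<Rightarrow> nat \<Rightarrow> bool" where
  "cloud_repairs ssl n p lt C d \<longleftrightarrow> (\<exists>u<p. bit C u \<and> type_le ssl n lt (d div n) u \<and> \<not> bit u (Suc (d mod n)))"

lemma type_le_trans: "type_le ssl n lt t u \<Longrightarrow> type_le ssl n lt u v \<Longrightarrow> type_le ssl n lt t v"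
  unfolding type_le_def by blast

locale clouds =
  fixes ssl rf :: bool and n :: nat and lt r :: "nat \<Rightarrow> nat" and sm :: "nat \<Rightarrow> nat \<Rightarrow> bool"
begin

abbreviation "p \<equiv> 2 ^ n :: nat"
abbreviation "le \<equiv> type_le ssl n lt"
abbreviation "coh \<equiv> cloud_ok rf n p lt r sm"
abbreviation "key \<equiv> cloud_key ssl n p (2 ^ (2 * p)) lt"
abbreviation "reach \<equiv> cloud_reach ssl n p lt"
abbreviation "flaw \<equiv> cloud_flaw n lt"
abbreviation "repairs \<equiv> cloud_repairs ssl n p lt"

text \<open>The trace of left commutativity, and in products also of right commutativity, on the
  types of two L-classes.\<close>

definition succ_cloud :: "nat \<Rightarrow> nat \<Rightarrow> bool" where
  "succ_cloud C C' \<longleftrightarrow> (\<forall>u<p. bit C' u \<longrightarrow> (\<exists>t<p. bit C t \<and> le t u)) \<and>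
     (\<not> ssl \<longrightarrow> (\<forall>t<p. bit C t \<longrightarrow> (\<exists>u<p. bit C' u \<and> le t u)))"

lemma bit_key_up: "j < p \<Longrightarrow> bit (key C) j \<longleftrightarrow> (\<exists>t<p. bit C t \<and> le t j)"
  by (auto simp: cloud_key_def bit_collect_bits)

text \<open>The down-closure compares up-sets instead of using \<open>le\<close> directly:
  \<open>le\<close> need not be reflexive, as in K4, yet the types of \<open>C\<close> must belong
  to the down-closure of \<open>C\<close>.\<close>

lemma bit_key_down:
  "s < p \<Longrightarrow> bit (key C) (p + s) \<longleftrightarrow> \<not> ssl \<and> \<not> (\<exists>t<p. bit C t \<and> (\<forall>u<p. le t u \<longrightarrow> le s u))"
  by (auto simp: cloud_key_def bit_collect_bits)

text \<open>If s is in the down-closure because of t in \<open>C\<close>, any type of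
  \<open>C'\<close> above t is above s. Hence it makes no difference whether the down-closure or the
  cloud itself has to be covered.\<close>

lemma reach_key_iff: "reach (key C) C' \<longleftrightarrow> succ_cloud C C'"
proof -
  have "(\<forall>s<p. \<not> bit (key C) (p + s) \<longrightarrow> (\<exists>u<p. bit C' u \<and> le s u)) \<longleftrightarrow>
      (\<forall>t<p. bit C t \<longrightarrow> (\<exists>u<p. bit C' u \<and> le t u))" if "\<not> ssl"
    using that bit_key_down[of _ C] by (auto; blast)
  moreover have "(\<forall>u<p. bit C' u \<longrightarrow> bit (key C) u) \<longleftrightarrow> (\<forall>u<p. bit C' u \<longrightarrow> (\<exists>t<p. bit C t \<and> le t u))"
    using bit_key_up[of _ C] by auto
  ultimately show ?thesis unfolding cloud_reach_def succ_cloud_def by blast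
qed

lemma succ_cloud_trans: "succ_cloud C C' \<Longrightarrow> succ_cloud C' C'' \<Longrightarrow> succ_cloud C C''"
  unfolding succ_cloud_def by (meson type_le_trans)

lemma key_decreasing:
  assumes "succ_cloud C C'" "bit (key C') j"
  shows "bit (key C) j"
proof -
  have j: "j < 2 * p" using assms(2) by (simp add: cloud_key_def bit_collect_bits)
  show ?thesis
  proof (cases "j < p")
    case True
    then show ?thesis using assms bit_key_up type_le_trans unfolding succ_cloud_def by meson
  next
    case False
    then obtain s where s: "j = p + s" "s < p" using j by (metis add_less_cancel_left le_Suc_ex linorder_not_less mult_2)
    have nssl: "\<not> ssl" and C': "\<not> (\<exists>t<p. bit C' t \<and> (\<forall>u<p. le t u \<longrightarrow> le s u))"
      using assms(2) bit_key_down[OF s(2)] s by auto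
    have "\<not> (\<exists>t<p. bit C t \<and> (\<forall>u<p. le t u \<longrightarrow> le s u))"
    proof
      assume "\<exists>t<p. bit C t \<and> (\<forall>u<p. le t u \<longrightarrow> le s u)"
      then obtain t where t: "t < p" "bit C t" "\<forall>u<p. le t u \<longrightarrow> le s u" by blast
      \<comment> \<open>Whatever is above t' is above t and therefore above s, so t' puts s into the
        down-closure of \<open>C'\<close>.\<close>
      then obtain t' where "t' < p" "bit C' t'" "le t t'"
        using assms(1) nssl unfolding succ_cloud_def by blast
      then show False using C' t(3) type_le_trans by blast
    qed
    then show ?thesis using bit_key_down[OF s(2)] s nssl by auto
  qed
qed

sublocale cloud_search "2 ^ p" "p * n" "2 * p" coh reach key flaw repairs
proof
  show "key c < 2 ^ (2 * p)" for c unfolding cloud_key_def by (rule collect_bits_less)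
  show "reach (key c) c' \<Longrightarrow> bit (key c') j \<Longrightarrow> bit (key c) j" for c c' j
    unfolding reach_key_iff by (rule key_decreasing)
qed

text \<open>A name for \<open>good\<close> that depends on the parameters of this locale only, for
  use outside of it.\<close>

definition good_cloud :: "nat \<Rightarrow> bool" where
  "good_cloud C \<longleftrightarrow> good C"

definition good_witness :: bool where
  "good_witness \<longleftrightarrow> (\<exists>C t. good C \<and> bit C t \<and> bit t 0)"

lemma goodD: "good C \<Longrightarrow> C < 2 ^ p" "good C \<Longrightarrow> coh C"
  by (auto elim: good.cases)

lemma good_bit_less: "good C \<Longrightarrow> bit C t \<Longrightarrow> t < p"
  using bit_less goodD(1) by blast

lemma good_step:
  assumes "good C" "bit C t" "i < n" "lt i = 5" "\<not> bit t i"
  obtains C' u where "good C'" "succ_cloud C C'" "bit C' u" "le t u" "\<not> bit u (Suc i)"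
proof -
  have "Suc t * n \<le> p * n" using good_bit_less[OF assms(1,2)] by (intro mult_right_mono) auto
  then have "t * n + i < p * n" using assms(3) by simp
  moreover have "flaw C (t * n + i)" using assms by (simp add: cloud_flaw_def)
  ultimately obtain C' where "good C'" "reach (key C) C'" "repairs C' (t * n + i)"
    using iffD1[OF good_iff assms(1)] by blast
  then show ?thesis
    using that assms(3) by (auto simp: reach_key_iff cloud_repairs_def)
qed

lemma good_type_ok: "good C \<Longrightarrow> bit C t \<Longrightarrow> type_ok rf n lt r sm t"
  using good_bit_less goodD(2) unfolding cloud_ok_def by blast

lemma good_know:
  "good C \<Longrightarrow> bit C t \<Longrightarrow> i < n \<Longrightarrow> lt i = 6 \<Longrightarrow> bit t i \<longleftrightarrow> (\<forall>u. bit C u \<longrightarrow> bit u (Suc i))"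
  using good_bit_less goodD(2) unfolding cloud_ok_def by blast

lemma type_le_refl: "rf \<Longrightarrow> type_ok rf n lt r sm t \<Longrightarrow> le t t"
  unfolding type_le_def type_ok_def by blast

end

text \<open>The interface to the parser: \<open>fm i\<close> is the formula read from position
  \<open>i\<close>, and \<open>sub\<close> marks the positions where a subformula starts. Immediate
  subformulas start further to the right.\<close>

locale formula_table = clouds ssl rf n lt r sm
    for ssl rf :: bool and n :: nat and lt r :: "nat \<Rightarrow> nat" and sm :: "nat \<Rightarrow> nat \<Rightarrow> bool" +
  fixes fm :: "nat \<Rightarrow> form" and sub :: "nat \<Rightarrow> bool"
  assumes sub_less: "\<And>i. sub i \<Longrightarrow> i < n" and sub_0: "sub 0"
    and sub_cases: "\<And>i. i < n \<Longrightarrow> sub i \<longleftrightarrow> lt i \<in> {1, 3, 5, 6, 7}"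
    and neg: "\<And>i. i < n \<Longrightarrow> lt i = 3 \<Longrightarrow> sub (Suc i) \<and> fm i = Neg (fm (Suc i))"
    and conj: "\<And>i. i < n \<Longrightarrow> lt i = 1 \<Longrightarrow> sub (Suc i) \<and> sub (r i) \<and> i < r i \<and> fm i = Conj (fm (Suc i)) (fm (r i))"
    and box: "\<And>i. i < n \<Longrightarrow> lt i = 5 \<Longrightarrow> sub (Suc i) \<and> fm i = Box (fm (Suc i))"
    and know: "\<And>i. i < n \<Longrightarrow> lt i = 6 \<Longrightarrow> sub (Suc i) \<and> fm i = K (fm (Suc i))"
    and atom: "\<And>i. i < n \<Longrightarrow> lt i = 7 \<Longrightarrow> \<exists>a. fm i = Atom a"
    and same: "\<And>i j. i < n \<Longrightarrow> j < n \<Longrightarrow> sm i j \<longleftrightarrow> lt i = 7 \<and> lt j = 7 \<and> fm i = fm j"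
    and ssl_rf: "ssl \<Longrightarrow> rf"
begin

lemma n_pos: "0 < n"
  using sub_less[OF sub_0] .

text \<open>The truth lemma shared by both model constructions, by induction on n - i. The valuation
  asks for some occurrence of the atom; all occurrences agree because types respect
  \<open>sm\<close>.\<close>

lemma truth:
  assumes types: "\<And>w. w \<in> worlds M \<Longrightarrow> type_ok rf n lt r sm (\<tau> w)"
    and M: "is_model M"
    and val: "\<And>w A. w \<in> worlds M \<Longrightarrow> w \<in> val M A \<longleftrightarrow> (\<exists>i<n. lt i = 7 \<and> fm i = Atom A \<and> bit (\<tau> w) i)"
    and le: "\<And>w v. (w, v) \<in> dia M \<Longrightarrow> le (\<tau> w) (\<tau> v)"
    and box': "\<And>w i. w \<in> worlds M \<Longrightarrow> i < n \<Longrightarrow> lt i = 5 \<Longrightarrow> \<not> bit (\<tau> w) i \<Longrightarrow> \<exists>v. (w, v) \<in> dia M \<and> \<not> bit (\<tau> v) (Suc i)"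
    and know': "\<And>w i. w \<in> worlds M \<Longrightarrow> i < n \<Longrightarrow> lt i = 6 \<Longrightarrow> bit (\<tau> w) i \<longleftrightarrow> (\<forall>v. (w, v) \<in> lrel M \<longrightarrow> bit (\<tau> v) (Suc i))"
  shows "sub i \<Longrightarrow> w \<in> worlds M \<Longrightarrow> sat M w (fm i) \<longleftrightarrow> bit (\<tau> w) i"
proof (induction "n - i" arbitrary: i w rule: less_induct)
  case less
  have i: "i < n" using sub_less less.prems by blast
  have IH: "sat M v (fm j) \<longleftrightarrow> bit (\<tau> v) j" if "i < j" "sub j" "v \<in> worlds M" for j v
    by (rule less.hyps) (use that sub_less[OF that(2)] i in auto)
  have in_W: "(w, v) \<in> dia M \<Longrightarrow> v \<in> worlds M" "(w, v) \<in> lrel M \<Longrightarrow> v \<in> worlds M" for v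
    using M by (auto simp: is_model_def)
  note ty = types[OF less.prems(2), unfolded type_ok_def, rule_format, OF i]
  consider "lt i = 1" | "lt i = 3" | "lt i = 5" | "lt i = 6" | "lt i = 7"
    using sub_cases[OF i] less.prems(1) by auto
  then show ?case
  proof cases
    case 1
    then show ?thesis using conj[OF i 1] IH[of "Suc i" w] IH[of "r i" w] ty less.prems by auto
  next
    case 2
    then show ?thesis using neg[OF i 2] IH[of "Suc i" w] ty less.prems by auto
  next
    case 3
    have "(\<forall>v. (w, v) \<in> dia M \<longrightarrow> bit (\<tau> v) (Suc i)) \<longleftrightarrow> bit (\<tau> w) i"
    proof
      assume "\<forall>v. (w, v) \<in> dia M \<longrightarrow> bit (\<tau> v) (Suc i)"
      then show "bit (\<tau> w) i" using box'[OF less.prems(2) i 3] by blast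
    next
      assume "bit (\<tau> w) i"
      then show "\<forall>v. (w, v) \<in> dia M \<longrightarrow> bit (\<tau> v) (Suc i)"
        using le i 3 unfolding type_le_def by blast
    qed
    then show ?thesis using box[OF i 3] IH[of "Suc i"] in_W by auto
  next
    case 4
    then show ?thesis using know[OF i 4] know'[OF less.prems(2) i 4] IH[of "Suc i"] in_W by auto
  next
    case 5
    obtain a where a: "fm i = Atom a" using atom[OF i 5] by blast
    have "bit (\<tau> w) j = bit (\<tau> w) i" if "j < n" "lt j = 7" "fm j = Atom a" for j
      using ty that same[OF i that(1)] 5 a by auto
    then have "(\<exists>j<n. lt j = 7 \<and> fm j = Atom a \<and> bit (\<tau> w) j) \<longleftrightarrow> bit (\<tau> w) i"
      using i 5 a by blast
    then show ?thesis using a val[OF less.prems(2), of a] by simp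
  qed
qed

section \<open>From models to good clouds\<close>

definition world_type :: "'w model \<Rightarrow> 'w \<Rightarrow> nat" where
  "world_type M x = collect_bits p n (\<lambda>i. sat M x (fm i))"

definition world_cloud :: "'w model \<Rightarrow> 'w \<Rightarrow> nat" where
  "world_cloud M x = collect_bits (2 ^ p) p (\<lambda>t. \<exists>y. (x, y) \<in> lrel M \<and> t = world_type M y)"

lemma bit_world_type: "sub i \<Longrightarrow> bit (world_type M x) i \<longleftrightarrow> sat M x (fm i)"
  using sub_less by (auto simp: world_type_def bit_collect_bits)

lemma bit_world_cloud: "bit (world_cloud M x) t \<longleftrightarrow> (\<exists>y. (x, y) \<in> lrel M \<and> t = world_type M y)"
  by (auto simp: world_cloud_def bit_collect_bits world_type_def collect_bits_less)

text \<open>Coinduction over the worlds: the cloud of a flaw's witness world repairs it. Left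
  commutativity yields the first half of \<open>succ_cloud\<close>, right commutativity the
  second.\<close>

lemma world_cloud_good:
  assumes M: "is_model M" "trans (dia M)" "equiv (worlds M) (lrel M)"
    and left: "\<And>w u u'. (w, u) \<in> dia M \<Longrightarrow> (u, u') \<in> lrel M \<Longrightarrow> \<exists>w'. (w, w') \<in> lrel M \<and> (w', u') \<in> dia M"
    and right: "\<And>w u w'. \<not> ssl \<Longrightarrow> (w, u) \<in> dia M \<Longrightarrow> (w, w') \<in> lrel M \<Longrightarrow> \<exists>u'. (u, u') \<in> lrel M \<and> (w', u') \<in> dia M"
    and rfl: "\<And>w. rf \<Longrightarrow> w \<in> worlds M \<Longrightarrow> (w, w) \<in> dia M"
    and pers: "\<And>w v A. ssl \<Longrightarrow> (w, v) \<in> dia M \<Longrightarrow> w \<in> val M A \<longleftrightarrow> v \<in> val M A"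
    and x: "x \<in> worlds M"
  shows "good (world_cloud M x)"
proof -
  let ?\<tau> = "world_type M" and ?C = "world_cloud M"
  have L: "(y, z) \<in> lrel M \<Longrightarrow> (z, y) \<in> lrel M" "(y, z) \<in> lrel M \<Longrightarrow> (z, u) \<in> lrel M \<Longrightarrow> (y, u) \<in> lrel M"
      "y \<in> worlds M \<Longrightarrow> (y, y) \<in> lrel M" for y z u
    using M(3) by (auto simp: equiv_def refl_on_def dest: symD transD)
  have W: "(y, z) \<in> lrel M \<Longrightarrow> y \<in> worlds M \<and> z \<in> worlds M" "(y, z) \<in> dia M \<Longrightarrow> y \<in> worlds M \<and> z \<in> worlds M" for y z
    using M(1) by (auto simp: is_model_def)
  have b: "bit (?\<tau> y) i \<longleftrightarrow> sat M y (fm i)" if "sub i" for y i using bit_world_type[OF that] .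
  have ok: "type_ok rf n lt r sm (?\<tau> y)" if "y \<in> worlds M" for y
    unfolding type_ok_def
  proof (intro allI impI conjI)
    fix i assume i: "i < n"
    have si: "sub i" if "lt i \<in> {1, 3, 5, 6, 7}" using sub_cases[OF i] that by blast
    show "bit (?\<tau> y) i = (\<not> bit (?\<tau> y) (Suc i))" if "lt i = 3"
      using neg[OF i that] b si that by auto
    show "bit (?\<tau> y) i = (bit (?\<tau> y) (Suc i) \<and> bit (?\<tau> y) (r i))" if "lt i = 1"
      using conj[OF i that] b si that by auto
    show "bit (?\<tau> y) (Suc i)" if "rf \<and> lt i = 5 \<and> bit (?\<tau> y) i"
      using box[OF i] b si that rfl[OF _ \<open>y \<in> worlds M\<close>] by auto
    show "bit (?\<tau> y) i = bit (?\<tau> y) j" if "j < n" "sm i j" for j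
      using same[OF i that(1)] that b sub_cases[OF i] sub_cases[OF that(1)] by auto
  qed
  have le: "le (?\<tau> y) (?\<tau> z)" if "(y, z) \<in> dia M" for y z
    unfolding type_le_def
  proof (intro allI impI conjI)
    fix i assume i: "i < n"
    show "bit (?\<tau> z) i" "bit (?\<tau> z) (Suc i)" if "lt i = 5 \<and> bit (?\<tau> y) i"
      using box[OF i] b that sub_cases[OF i] \<open>(y, z) \<in> dia M\<close> transD[OF M(2)] by auto
    show "bit (?\<tau> y) i = bit (?\<tau> z) i" if "ssl \<and> lt i = 7"
      using atom[OF i] b sub_cases[OF i] that pers[OF _ \<open>(y, z) \<in> dia M\<close>] by auto
  qed
  have coh: "coh (?C y)" if "y \<in> worlds M" for y
    unfolding cloud_ok_def
  proof (intro allI impI conjI)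
    fix t assume "bit (?C y) t"
    then obtain z where z: "(y, z) \<in> lrel M" "t = ?\<tau> z" unfolding bit_world_cloud by blast
    show "type_ok rf n lt r sm t" unfolding z(2) by (rule ok) (use W z(1) in blast)
    fix i assume i: "i < n" "lt i = 6"
    have "bit t i \<longleftrightarrow> (\<forall>u. (z, u) \<in> lrel M \<longrightarrow> bit (?\<tau> u) (Suc i))"
      using know[OF i] b sub_cases[OF i(1)] i z by auto
    also have "\<dots> \<longleftrightarrow> (\<forall>u. (y, u) \<in> lrel M \<longrightarrow> bit (?\<tau> u) (Suc i))" using L z(1) by blast
    also have "\<dots> \<longleftrightarrow> (\<forall>u<p. bit (?C y) u \<longrightarrow> bit u (Suc i))"
      unfolding bit_world_cloud using collect_bits_less by (auto simp: world_type_def)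
    finally show "bit t i = (\<forall>u<p. bit (?C y) u \<longrightarrow> bit u (Suc i))" .
  qed
  show ?thesis using x
  proof (coinduction arbitrary: x)
    case (good x)
    have "\<exists>z. z \<in> worlds M \<and> reach (key (?C x)) (?C z) \<and> repairs (?C z) d"
      if d: "d < p * n" "flaw (?C x) d" for d
    proof -
      let ?t = "d div n" and ?i = "d mod n"
      have i: "?i < n" "lt ?i = 5" using n_pos d by (auto simp: cloud_flaw_def)
      obtain y where y: "(x, y) \<in> lrel M" "?t = ?\<tau> y" using d unfolding cloud_flaw_def bit_world_cloud by blast
      have "\<not> sat M y (fm ?i)" using d b[of ?i y] sub_cases[OF i(1)] i y by (auto simp: cloud_flaw_def)
      then obtain z where z: "(y, z) \<in> dia M" "\<not> sat M z (fm (Suc ?i))" using box[OF i] by auto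
      have "succ_cloud (?C x) (?C z)"
        unfolding succ_cloud_def
      proof (intro conjI allI impI)
        fix u assume "bit (?C z) u"
        then obtain z' where z': "(z, z') \<in> lrel M" "u = ?\<tau> z'" unfolding bit_world_cloud by blast
        obtain y' where y': "(y, y') \<in> lrel M" "(y', z') \<in> dia M" using left[OF z(1) z'(1)] by blast
        have "bit (?C x) (?\<tau> y')" unfolding bit_world_cloud using L y y' by blast
        then show "\<exists>t<p. bit (?C x) t \<and> le t u"
          using le[OF y'(2)] z' collect_bits_less by (intro exI[of _ "?\<tau> y'"]) (auto simp: world_type_def)
      next
        fix t assume "bit (?C x) t" and ns: "\<not> ssl"
        then obtain y' where y': "(x, y') \<in> lrel M" "t = ?\<tau> y'" unfolding bit_world_cloud by blast
        have "(y, y') \<in> lrel M" using L y y' by blast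
        then obtain z' where z': "(z, z') \<in> lrel M" "(y', z') \<in> dia M" using right[OF ns z(1)] by blast
        have "bit (?C z) (?\<tau> z')" unfolding bit_world_cloud using z' by blast
        then show "\<exists>u<p. bit (?C z) u \<and> le t u"
          using le[OF z'(2)] y' collect_bits_less by (intro exI[of _ "?\<tau> z'"]) (auto simp: world_type_def)
      qed
      moreover have zW: "z \<in> worlds M" using W z by blast
      moreover have "bit (?C z) (?\<tau> z)" unfolding bit_world_cloud using L zW by blast
      then have "repairs (?C z) d"
        unfolding cloud_repairs_def using le[OF z(1)] y z b box[OF i] collect_bits_less
        by (intro exI[of _ "?\<tau> z"]) (auto simp: world_type_def)
      ultimately show ?thesis using reach_key_iff by blast
    qed
    moreover have "?C x < 2 ^ p" unfolding world_cloud_def by (rule collect_bits_less)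
    ultimately show ?case using coh[OF good] by blast
  qed
qed

lemma model_good_witness:
  assumes "is_model M" "trans (dia M)" "equiv (worlds M) (lrel M)"
    and "\<And>w u u'. (w, u) \<in> dia M \<Longrightarrow> (u, u') \<in> lrel M \<Longrightarrow> \<exists>w'. (w, w') \<in> lrel M \<and> (w', u') \<in> dia M"
    and "\<And>w u w'. \<not> ssl \<Longrightarrow> (w, u) \<in> dia M \<Longrightarrow> (w, w') \<in> lrel M \<Longrightarrow> \<exists>u'. (u, u') \<in> lrel M \<and> (w', u') \<in> dia M"
    and "\<And>w. rf \<Longrightarrow> w \<in> worlds M \<Longrightarrow> (w, w) \<in> dia M"
    and "\<And>w v A. ssl \<Longrightarrow> (w, v) \<in> dia M \<Longrightarrow> w \<in> val M A \<longleftrightarrow> v \<in> val M A"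
    and "x \<in> worlds M" "sat M x (fm 0)"
  shows good_witness
proof -
  have "good (world_cloud M x)" by (rule world_cloud_good[OF assms(1-8)])
  moreover have "(x, x) \<in> lrel M" using assms(3,8) by (auto simp: equiv_def refl_on_def)
  then have "bit (world_cloud M x) (world_type M x)" unfolding bit_world_cloud by blast
  moreover have "bit (world_type M x) 0" by (simp only: bit_world_type[OF sub_0] assms(9))
  ultimately show ?thesis unfolding good_witness_def by blast
qed

section \<open>From good clouds to models\<close>

text \<open>Pairs of a good cloud and one of its types suffice as worlds, with the clouds as
  L-classes: a cross axiom model only demands left commutativity, the first half of
  \<open>succ_cloud\<close>.\<close>

lemma good_witness_SSL:
  assumes ssl good_witness
  shows "SSL_satisfiable TYPE(nat \<times> nat) (fm 0)"
proof -
  define W where "W = {x. good (fst x) \<and> bit (fst x) (snd x)}"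
  define M where "M = \<lparr>worlds = W,
    dia = {(x, y). x \<in> W \<and> y \<in> W \<and> le (snd x) (snd y) \<and> succ_cloud (fst x) (fst y)},
    lrel = {(x, y). x \<in> W \<and> y \<in> W \<and> fst x = fst y},
    val = (\<lambda>A. {x \<in> W. \<exists>i<n. lt i = 7 \<and> fm i = Atom A \<and> bit (snd x) i})\<rparr>"
  have sel: "worlds M = W"
    "(x, y) \<in> dia M \<longleftrightarrow> x \<in> W \<and> y \<in> W \<and> le (snd x) (snd y) \<and> succ_cloud (fst x) (fst y)"
    "(x, y) \<in> lrel M \<longleftrightarrow> x \<in> W \<and> y \<in> W \<and> fst x = fst y"
    "x \<in> val M A \<longleftrightarrow> x \<in> W \<and> (\<exists>i<n. lt i = 7 \<and> fm i = Atom A \<and> bit (snd x) i)" for x y A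
    by (auto simp: M_def)
  have W: "x \<in> W \<longleftrightarrow> good (fst x) \<and> bit (fst x) (snd x)" for x by (simp add: W_def)
  obtain C t where C: "good C" "bit C t" "bit t 0" using assms(2) by (auto simp: good_witness_def)
  have rfl: "le t t" if "good C" "bit C t" for C t
    using type_le_refl[OF ssl_rf[OF assms(1)] good_type_ok[OF that]] .
  have rfl_succ: "succ_cloud C C" if "good C" for C
    unfolding succ_cloud_def using rfl[OF that] assms(1) by blast
  have "(C, t) \<in> W" using C by (simp add: W)
  then have model: "is_model M" by (auto simp: is_model_def sel subset_iff)
  have "cross_axiom_model M"
    unfolding cross_axiom_model_def
  proof (intro conjI allI impI)
    show "preorder_on (worlds M) (dia M)"
      unfolding preorder_on_def refl_on_def trans_def sel(1)
      by (auto simp: sel W rfl rfl_succ intro: type_le_trans succ_cloud_trans)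
    show "equiv (worlds M) (lrel M)"
      by (rule equivI) (auto simp: sel refl_on_def sym_def trans_def)
  next
    fix w u u' assume h: "(w, u) \<in> dia M \<and> (u, u') \<in> lrel M"
    then have h: "w \<in> W" "u \<in> W" "u' \<in> W" "succ_cloud (fst w) (fst u)" "fst u = fst u'" by (auto simp: sel)
    have "snd u' < p" "bit (fst u) (snd u')" using h W good_bit_less by auto
    then obtain t where t: "bit (fst w) t" "le t (snd u')" using h(4) unfolding succ_cloud_def by blast
    then show "\<exists>w'. (w, w') \<in> lrel M \<and> (w', u') \<in> dia M"
      using h by (intro exI[of _ "(fst w, t)"]) (auto simp: sel W)
  next
    fix w v A assume h: "(w, v) \<in> dia M"
    then have "lt i = 7 \<Longrightarrow> i < n \<Longrightarrow> bit (snd w) i = bit (snd v) i" for i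
      using assms(1) by (auto simp: sel type_le_def)
    then show "w \<in> val M A \<longleftrightarrow> v \<in> val M A" using h by (auto simp: sel)
  qed (rule model)
  moreover have "sat M (C, t) (fm 0) \<longleftrightarrow> bit (snd (C, t)) 0"
  proof (rule truth[OF _ model _ _ _ _ sub_0])
    fix w i assume w: "w \<in> worlds M" and i: "i < n"
    have gw: "good (fst w)" "bit (fst w) (snd w)" using w by (auto simp: sel W)
    show "\<exists>v. (w, v) \<in> dia M \<and> \<not> bit (snd v) (Suc i)" if b: "lt i = 5" "\<not> bit (snd w) i"
    proof -
      obtain C' u where u: "good C'" "succ_cloud (fst w) C'" "bit C' u" "le (snd w) u" "\<not> bit u (Suc i)"
        using good_step[OF gw i b] .
      then show ?thesis using gw by (intro exI[of _ "(C', u)"]) (auto simp: sel W)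
    qed
    show "bit (snd w) i \<longleftrightarrow> (\<forall>v. (w, v) \<in> lrel M \<longrightarrow> bit (snd v) (Suc i))" if "lt i = 6"
      unfolding good_know[OF gw i that] using gw by (auto simp: sel W)
  qed (use C in \<open>auto simp: sel W good_type_ok\<close>)
  ultimately show ?thesis
    using C unfolding SSL_satisfiable_def by (intro exI[of _ M] conjI bexI[of _ "(C, t)"]) (auto simp: sel W)
qed

text \<open>The k-th element of \<open>X\<close> is labelled by the first component of the pair that
  k encodes; every first component recurs for infinitely many k.\<close>

lemma infinite_split:
  fixes X :: "nat set"
  assumes "infinite X" "countable S" "S \<noteq> {}"
  shows "\<exists>f. f ` X \<subseteq> S \<and> (\<forall>s\<in>S. infinite {x \<in> X. f x = s})"
proof -
  let ?h = "enumerate X"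
  have h: "bij_betw ?h UNIV X" using assms(1) by (rule bij_enumerate)
  define f where "f x = from_nat_into S (fst (prod_decode (inv_into UNIV ?h x)))" for x
  have fh: "f (?h k) = from_nat_into S (fst (prod_decode k))" for k
    using bij_betw_imp_inj_on[OF h] by (simp add: f_def)
  have "infinite {x \<in> X. f x = s}" if s: "s \<in> S" for s
  proof -
    obtain j where j: "from_nat_into S j = s" using from_nat_into_surj[OF assms(2) s] by blast
    have "inj (\<lambda>l. ?h (prod_encode (j, l)))"
      using bij_betw_imp_inj_on[OF h] by (intro injI) (auto dest!: injD)
    then have "infinite (range (\<lambda>l. ?h (prod_encode (j, l))))" by (simp add: finite_image_iff)
    moreover have "range (\<lambda>l. ?h (prod_encode (j, l))) \<subseteq> {x \<in> X. f x = s}"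
      using bij_betwE[OF h] by (auto simp: fh j)
    ultimately show ?thesis using finite_subset by blast
  qed
  moreover have "f ` X \<subseteq> S" using from_nat_into[OF assms(3)] by (auto simp: f_def)
  ultimately show ?thesis by blast
qed

text \<open>
  The first factor of the product consists of all maps \<open>F\<close> from the second factor \<open>nat\<close> to types that
  take every type of some good cloud infinitely often, ordered pointwise. The infinite fibres leave
  room for passing to an arbitrary successor cloud.
\<close>

definition thread :: "(nat \<Rightarrow> nat) \<Rightarrow> nat \<Rightarrow> bool" where
  "thread F C \<longleftrightarrow> good C \<and> range F = {t. bit C t} \<and> (\<forall>t. bit C t \<longrightarrow> infinite {x. F x = t})"

lemma threadD: "thread F C \<Longrightarrow> good C" "thread F C \<Longrightarrow> bit C (F x)"
  by (auto simp: thread_def)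

text \<open>Each infinite fibre of \<open>F\<close> over a type s is split among the types of
  \<open>C'\<close> above s, each taken infinitely often. Right commutativity provides a type above
  s, left commutativity ensures that all of \<open>C'\<close> is reached.\<close>

lemma thread_succ:
  assumes F: "thread F C" and C': "good C'" "succ_cloud C C'" "\<not> ssl" and u: "bit C' u" "le (F x) u"
  obtains F' where "thread F' C'" "\<And>y. le (F y) (F' y)" "F' x = u"
proof -
  define S where "S s = {t. bit C' t \<and> le s t}" for s
  have finS: "finite (S s)" for s
    by (rule finite_subset[of _ "{..<p}"]) (auto simp: S_def good_bit_less[OF C'(1)])
  have "\<exists>f. f ` {y. F y = s} \<subseteq> S s \<and> (\<forall>t\<in>S s. infinite {y \<in> {y. F y = s}. f y = t})" if "bit C s" for s
  proof (rule infinite_split)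
    show "infinite {y. F y = s}" using F that by (auto simp: thread_def)
    have "good C" using F by (simp add: thread_def)
    then have "s < p" using that by (rule good_bit_less)
    then show "S s \<noteq> {}" using C'(2,3) that unfolding succ_cloud_def S_def by blast
  qed (use finS countable_finite in blast)
  then obtain f where f: "\<And>s. bit C s \<Longrightarrow> f s ` {y. F y = s} \<subseteq> S s"
    "\<And>s t. bit C s \<Longrightarrow> t \<in> S s \<Longrightarrow> infinite {y \<in> {y. F y = s}. f s y = t}" by metis
  \<comment> \<open>The prescribed value at \<open>x\<close> changes a single point, which leaves
    infinite fibres infinite.\<close>
  define F' where "F' y = (if y = x then u else f (F y) y)" for y
  have FC: "bit C (F y)" for y using F by (auto simp: thread_def)
  have F'S: "F' y \<in> S (F y)" for y
    using f(1)[OF FC[of y]] u by (auto simp: F'_def S_def)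
  have inf: "infinite {y. F' y = t}" if t: "bit C' t" for t
  proof -
    obtain s where s: "bit C s" "le s t"
      using C'(2) good_bit_less[OF C'(1) t] t unfolding succ_cloud_def by blast
    have "infinite ({y \<in> {y. F y = s}. f s y = t} - {x})"
      using f(2)[OF s(1)] t s(2) by (simp add: S_def)
    moreover have "{y \<in> {y. F y = s}. f s y = t} - {x} \<subseteq> {y. F' y = t}" by (auto simp: F'_def)
    ultimately show ?thesis using finite_subset by blast
  qed
  have "range F' = {t. bit C' t}"
  proof
    show "range F' \<subseteq> {t. bit C' t}" using F'S by (auto simp: S_def)
    show "{t. bit C' t} \<subseteq> range F'"
    proof
      fix t assume "t \<in> {t. bit C' t}"
      then have "{y. F' y = t} \<noteq> {}" using inf[of t] by (metis finite.emptyI mem_Collect_eq)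
      then show "t \<in> range F'" by auto
    qed
  qed
  then have "thread F' C'" using C'(1) inf by (simp add: thread_def)
  moreover have "le (F y) (F' y)" for y using F'S by (simp add: S_def)
  moreover have "F' x = u" by (simp add: F'_def)
  ultimately show ?thesis using that by blast
qed

lemma good_witness_product:
  fixes Y_frame :: "(nat \<Rightarrow> nat) set \<Rightarrow> (nat \<Rightarrow> nat) rel \<Rightarrow> bool"
  assumes "\<not> ssl" good_witness
    and Y: "\<And>W R. R \<subseteq> W \<times> W \<Longrightarrow> trans R \<Longrightarrow> (rf \<Longrightarrow> refl_on W R) \<Longrightarrow> Y_frame W R"
  shows "product_satisfiable Y_frame TYPE(nat) (fm 0)"
proof -
  define W where "W = {F. \<exists>C. thread F C}"
  define R where "R = {(F, F'). F \<in> W \<and> F' \<in> W \<and> (\<forall>x. le (F x) (F' x))}"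
  define \<sigma> where "\<sigma> A = {x \<in> W \<times> UNIV. \<exists>i<n. lt i = 7 \<and> fm i = Atom A \<and> bit ((fst x) (snd x)) i}" for A
  define M where "M = product_model W R UNIV UNIV \<sigma>"
  have sel: "worlds M = W \<times> UNIV" "(x, y) \<in> dia M \<longleftrightarrow> (fst x, fst y) \<in> R \<and> snd x = snd y"
    "(x, y) \<in> lrel M \<longleftrightarrow> fst x = fst y \<and> fst x \<in> W" "val M = \<sigma>" for x y
    by (cases x; cases y; auto simp: M_def product_model_def)+
  obtain C t where C: "good C" "bit C t" "bit t 0" using assms(2) by (auto simp: good_witness_def)
  have "finite {t. bit C t}"
    by (rule finite_subset[of _ "{..<p}"]) (auto simp: good_bit_less[OF C(1)])
  moreover have "{t. bit C t} \<noteq> {}" using C(2) by blast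
  ultimately have "\<exists>f. range f \<subseteq> {t. bit C t} \<and> (\<forall>s\<in>{t. bit C t}. infinite {x \<in> UNIV :: nat set. f x = s})"
    by (intro infinite_split[OF infinite_UNIV_nat] countable_finite)
  then obtain F :: "nat \<Rightarrow> nat" where F: "range F \<subseteq> {t. bit C t}" "\<forall>s. bit C s \<longrightarrow> infinite {x. F x = s}"
    by auto
  have "{t. bit C t} \<subseteq> range F"
  proof
    fix s assume "s \<in> {t. bit C t}"
    then have "{x. F x = s} \<noteq> {}" using F(2) by (metis finite.emptyI mem_Collect_eq)
    then show "s \<in> range F" by auto
  qed
  then have thF: "thread F C" using F C by (auto simp: thread_def)
  then have "t \<in> range F" using C(2) by (simp add: thread_def)
  then obtain x0 where x0: "F x0 = t" by blast
  have ty: "type_ok rf n lt r sm (F x)" if "F \<in> W" for F x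
    using that good_type_ok threadD unfolding W_def by blast
  have FW: "F \<in> W" using thF by (auto simp: W_def)
  have RW: "R \<subseteq> W \<times> W" by (auto simp: R_def)
  have fr: "Y_frame W R"
    by (rule Y[OF RW]) (auto simp: trans_def refl_on_def R_def intro: type_le_trans type_le_refl ty)
  have model: "is_model M"
    using thF by (auto simp: is_model_def sel \<sigma>_def W_def R_def)
  have "sat M (F, x0) (fm 0) \<longleftrightarrow> bit ((\<lambda>w. fst w (snd w)) (F, x0)) 0"
  proof (rule truth[OF _ model _ _ _ _ sub_0])
    fix w i assume w: "w \<in> worlds M" and i: "i < n"
    obtain G y D where G: "w = (G, y)" "thread G D" "G \<in> W" using w by (cases w) (auto simp: sel W_def)
    have gD: "good D" "bit D (G y)" using threadD[OF G(2)] by auto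
    show "\<exists>v. (w, v) \<in> dia M \<and> \<not> bit (fst v (snd v)) (Suc i)" if b: "lt i = 5" "\<not> bit (fst w (snd w)) i"
    proof -
      obtain C' u where u: "good C'" "succ_cloud D C'" "bit C' u" "le (G y) u" "\<not> bit u (Suc i)"
        using good_step[OF gD i b(1)] b(2) G(1) by (metis fst_conv snd_conv)
      obtain G' where "thread G' C'" "\<And>z. le (G z) (G' z)" "G' y = u"
        using thread_succ[OF G(2) u(1,2) assms(1) u(3,4)] by blast
      then show ?thesis using G u(5) by (intro exI[of _ "(G', y)"]) (auto simp: sel R_def W_def)
    qed
    show "bit (fst w (snd w)) i \<longleftrightarrow> (\<forall>v. (w, v) \<in> lrel M \<longrightarrow> bit (fst v (snd v)) (Suc i))" if "lt i = 6"
    proof -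
      \<comment> \<open>The L-class of a world is a full row, whose types are the range of
        \<open>G\<close>, that is, exactly its cloud.\<close>
      have "bit (G y) i \<longleftrightarrow> (\<forall>u\<in>range G. bit u (Suc i))"
        using good_know[OF gD i that] G by (simp add: thread_def)
      then show ?thesis using G by (auto simp: sel)
    qed
  qed (use FW in \<open>auto simp: sel ty \<sigma>_def R_def\<close>)
  then have "sat M (F, x0) (fm 0)" using x0 C by simp
  moreover have "S5_frame (UNIV :: nat set) UNIV" by (auto simp: S5_frame_def equiv_def refl_on_def sym_def trans_def)
  moreover have "(F, x0) \<in> worlds M" using thF by (auto simp: sel W_def)
  ultimately show ?thesis
    using fr model unfolding product_satisfiable_def M_def by blast
qed

end

section \<open>Parsing\<close>

text \<open>In bijective base 9 a positive u has last digit (u - 1) mod 9 + 1 and remaining digits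
  (u - 1) div 9. Past the end the value stays 0, so \<open>letter_at\<close> returns 0, which is no
  letter.\<close>

definition drop_digits :: "nat \<Rightarrow> nat \<Rightarrow> nat" where
  "drop_digits v i = rec_nat v (\<lambda>_ u. (u - 1) div 9) i"

definition letter_at :: "nat \<Rightarrow> nat \<Rightarrow> nat" where
  "letter_at v i = (if drop_digits v i = 0 then 0 else (drop_digits v i - 1) mod 9 + 1)"

definition str_length :: "nat \<Rightarrow> nat" where
  "str_length v = search (Suc v) (\<lambda>i. i = 0 \<or> letter_at v (i - 1) \<noteq> 0)"

lemma drop_digits_num_val: "drop_digits (num_val w) i = num_val (drop i w)"
proof (induction i)
  case (Suc i)
  have *: "(num_val ds - 1) div 9 = num_val (tl ds)" for ds
  proof (cases ds)
    case (Cons d ds')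
    have "num_val ds - 1 = (digit_val d - 1) + 9 * num_val ds'" "digit_val d - 1 < 9"
      using digit_val_bounds[of d] Cons by auto
    then show ?thesis using Cons by simp
  qed simp
  show ?case using Suc * by (simp add: drop_digits_def tl_drop drop_Suc)
qed (simp add: drop_digits_def)

lemma letter_at_num_val: "letter_at (num_val w) i = (if i < length w then digit_val (w ! i) else 0)"
proof (cases "i < length w")
  case True
  then have d: "drop i w = w ! i # drop (Suc i) w" by (simp add: Cons_nth_drop_Suc)
  have "num_val (drop i w) - 1 = (digit_val (w ! i) - 1) + 9 * num_val (drop (Suc i) w)" "digit_val (w ! i) - 1 < 9"
    using digit_val_bounds[of "w ! i"] d by auto
  then have "(num_val (drop i w) - 1) mod 9 + 1 = digit_val (w ! i)"
    using digit_val_bounds[of "w ! i"] by (metis le_add_diff_inverse2 mod_less mod_mult_self2)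
  moreover have "num_val (drop i w) \<noteq> 0" using True by (simp add: num_val_eq_0_iff)
  ultimately show ?thesis using True by (simp add: letter_at_def drop_digits_num_val)
qed (simp add: letter_at_def drop_digits_num_val)

lemma length_le_num_val: "length w \<le> num_val w"
proof (induction w)
  case (Cons d w)
  then show ?case using digit_val_bounds(1)[of d] by simp
qed simp

lemma str_length_num_val: "str_length (num_val w) = length w"
proof -
  let ?P = "\<lambda>i. i = 0 \<or> letter_at (num_val w) (i - 1) \<noteq> 0"
  have P: "?P i \<longleftrightarrow> i \<le> length w" for i
    using digit_val_bounds(1) by (cases i) (auto simp: letter_at_num_val not_less_eq_eq Suc_le_eq)
  have "?P (search (Suc (num_val w)) ?P) \<and> length w \<le> search (Suc (num_val w)) ?P"
    by (rule search_prop) (use length_le_num_val[of w] P[of "length w"] in \<open>auto simp only: less_Suc_eq_le\<close>)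
  then show ?thesis unfolding P str_length_def by simp
qed

text \<open>The parse tree is guessed as the sequence \<open>l\<close> of the lengths of the subformulas at all positions,
  coded by the base-\<open>Suc n\<close> digits of a number.\<close>

definition length_at :: "nat \<Rightarrow> nat \<Rightarrow> nat \<Rightarrow> nat" where
  "length_at n c i = rec_nat c (\<lambda>_ u. u div Suc n) i mod Suc n"

lemma length_at_ex:
  assumes "\<forall>x\<in>set ls. x \<le> n"
  shows "\<exists>c<Suc n ^ length ls. \<forall>i<length ls. length_at n c i = ls ! i"
  using assms
proof (induction ls)
  case (Cons x ls)
  then obtain c where c: "c < Suc n ^ length ls" "\<forall>i<length ls. length_at n c i = ls ! i" by auto
  let ?c = "c * Suc n + x"
  have x: "x < Suc n" using Cons.prems by simp
  have div: "?c div Suc n = c" and md: "?c mod Suc n = x" using x by (simp_all del: mult_Suc_right)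
  have shift: "rec_nat ?c (\<lambda>_ u. u div Suc n) (Suc i) = rec_nat c (\<lambda>_ u. u div Suc n) i" for i
    by (induction i) (simp_all add: div del: mult_Suc_right)
  have "?c < Suc c * Suc n" using x by simp
  also have "\<dots> \<le> Suc n ^ length ls * Suc n" using c(1) by (intro mult_right_mono) auto
  finally have "?c < Suc n ^ length (x # ls)" by (simp add: mult.commute)
  moreover have "length_at n ?c i = (x # ls) ! i" if "i < length (x # ls)" for i
  proof (cases i)
    case 0
    then show ?thesis using md by (simp add: length_at_def)
  next
    case (Suc j)
    then show ?thesis using c(2) that by (simp only: length_at_def shift) simp
  qed
  ultimately show ?case by blast
qed simp

definition sub_letter :: "nat \<Rightarrow> bool" where
  "sub_letter x \<longleftrightarrow> x = 1 \<or> x = 3 \<or> x = 5 \<or> x = 6 \<or> x = 7"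

text \<open>The summand 2 counts the opening parenthesis and the conjunction sign.\<close>

definition right_at :: "(nat \<Rightarrow> nat) \<Rightarrow> nat \<Rightarrow> nat" where
  "right_at l i = i + 2 + l (Suc i)"

text \<open>A local check of the guessed lengths, with letters as digits: 1 and 2 the parentheses, 3
  negation, 4 conjunction, 5 box, 6 K, 7 to 9 the letters x, 0, 1. Positions whose letter starts no
  formula are not constrained.\<close>

definition parse_ok :: "(nat \<Rightarrow> nat) \<Rightarrow> (nat \<Rightarrow> nat) \<Rightarrow> nat \<Rightarrow> bool" where
  "parse_ok lt l i \<longleftrightarrow>
    (lt i = 3 \<or> lt i = 5 \<or> lt i = 6 \<longrightarrow> sub_letter (lt (Suc i)) \<and> l i = Suc (l (Suc i))) \<and>
    (lt i = 1 \<longrightarrow> sub_letter (lt (Suc i)) \<and> lt (Suc i + l (Suc i)) = 4 \<and> sub_letter (lt (right_at l i)) \<and>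
       lt (right_at l i + l (right_at l i)) = 2 \<and> l i = 3 + l (Suc i) + l (right_at l i)) \<and>
    (lt i = 7 \<longrightarrow> 2 \<le> l i \<and> (lt (Suc i) = 8 \<and> l i = 2 \<or>
       lt (Suc i) = 9 \<and> (\<forall>j<l i. 2 \<le> j \<longrightarrow> lt (i + j) = 8 \<or> lt (i + j) = 9)))"

definition same_atom :: "(nat \<Rightarrow> nat) \<Rightarrow> (nat \<Rightarrow> nat) \<Rightarrow> nat \<Rightarrow> nat \<Rightarrow> bool" where
  "same_atom lt l i j \<longleftrightarrow> lt i = 7 \<and> lt j = 7 \<and> l i = l j \<and> (\<forall>k<l i. lt (i + k) = lt (j + k))"

definition table_ok :: "nat \<Rightarrow> (nat \<Rightarrow> nat) \<Rightarrow> (nat \<Rightarrow> nat) \<Rightarrow> bool" where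
  "table_ok n lt l \<longleftrightarrow> sub_letter (lt 0) \<and> l 0 = n \<and> (\<forall>i<n. parse_ok lt l i)"

definition atom_at :: "(nat \<Rightarrow> nat) \<Rightarrow> (nat \<Rightarrow> nat) \<Rightarrow> nat \<Rightarrow> atom" where
  "atom_at lt l i = (if lt (Suc i) = 8 then X0 else X1 (map (\<lambda>j. lt (i + j) = 9) [2..<l i]))"

function form_at :: "nat \<Rightarrow> (nat \<Rightarrow> nat) \<Rightarrow> (nat \<Rightarrow> nat) \<Rightarrow> nat \<Rightarrow> form" where
  "form_at n lt l i =
    (if n \<le> i then Atom X0
     else if lt i = 3 then Neg (form_at n lt l (Suc i))
     else if lt i = 5 then Box (form_at n lt l (Suc i))
     else if lt i = 6 then K (form_at n lt l (Suc i))
     else if lt i = 1 then Conj (form_at n lt l (Suc i)) (form_at n lt l (right_at l i))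
     else Atom (atom_at lt l i))"
  by auto
termination by (relation "measure (\<lambda>(n, lt, l, i). n - i)") (auto simp: right_at_def)

declare form_at.simps [simp del]

lemma atom_at_inject:
  assumes "parse_ok lt l i" "parse_ok lt l j" "lt i = 7" "lt j = 7"
  shows "atom_at lt l i = atom_at lt l j \<longleftrightarrow> same_atom lt l i j"
proof
  have i: "2 \<le> l i" "lt (Suc i) = 8 \<and> l i = 2 \<or> lt (Suc i) = 9 \<and> (\<forall>k<l i. 2 \<le> k \<longrightarrow> lt (i + k) = 8 \<or> lt (i + k) = 9)"
    and j: "2 \<le> l j" "lt (Suc j) = 8 \<and> l j = 2 \<or> lt (Suc j) = 9 \<and> (\<forall>k<l j. 2 \<le> k \<longrightarrow> lt (j + k) = 8 \<or> lt (j + k) = 9)"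
    using assms by (auto simp: parse_ok_def)
  {
    assume eq: "atom_at lt l i = atom_at lt l j"
    have len: "l i = l j \<and> lt (Suc i) = lt (Suc j)"
      using eq i j by (auto simp: atom_at_def dest!: map_eq_imp_length_eq split: if_splits)
    have "lt (i + k) = lt (j + k)" if k: "k < l i" for k
    proof -
      consider "k = 0" | "k = 1" | "2 \<le> k" by linarith
      then show ?thesis
      proof cases
        case 3
        have "map (\<lambda>k. lt (i + k) = 9) [2..<l i] = map (\<lambda>k. lt (j + k) = 9) [2..<l i]"
          using eq i j len 3 k by (auto simp: atom_at_def split: if_splits)
        then have "(lt (i + k) = 9) = (lt (j + k) = 9)" using 3 k by (simp add: map_eq_conv)
        moreover have "lt (Suc i) = 9" "lt (Suc j) = 9" using i j len 3 k by auto
        then have "lt (i + k) = 8 \<or> lt (i + k) = 9" "lt (j + k) = 8 \<or> lt (j + k) = 9"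
          using i j len 3 k by simp_all
        ultimately show ?thesis by auto
      qed (use assms len in auto)
    qed
    then show "same_atom lt l i j" using assms len by (simp add: same_atom_def)
  next
    assume s: "same_atom lt l i j"
    then have "lt (Suc i) = lt (Suc j)" using i by (auto simp: same_atom_def dest!: spec[of _ 1])
    then show "atom_at lt l i = atom_at lt l j"
      using s by (auto simp: atom_at_def same_atom_def)
  }
qed

lemma table_ok_formula_table:
  assumes t: "table_ok n lt l" and n: "\<And>i. lt i \<noteq> 0 \<Longrightarrow> i < n" and s: "ssl \<Longrightarrow> rf"
  shows "formula_table ssl rf n lt (right_at l) (same_atom lt l) (form_at n lt l) (\<lambda>i. sub_letter (lt i))"
proof
  have ok: "parse_ok lt l i" if "i < n" for i using t that by (simp add: table_ok_def)
  show lt: "i < n" if "sub_letter (lt i)" for i using n[of i] that by (auto simp: sub_letter_def)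
  show "sub_letter (lt 0)" using t by (simp add: table_ok_def)
  show "sub_letter (lt i) = (lt i \<in> {1, 3, 5, 6, 7})" for i by (auto simp: sub_letter_def)
  fix i assume i: "i < n"
  show "lt i = 3 \<Longrightarrow> sub_letter (lt (Suc i)) \<and> form_at n lt l i = Neg (form_at n lt l (Suc i))"
    "lt i = 5 \<Longrightarrow> sub_letter (lt (Suc i)) \<and> form_at n lt l i = Box (form_at n lt l (Suc i))"
    "lt i = 6 \<Longrightarrow> sub_letter (lt (Suc i)) \<and> form_at n lt l i = K (form_at n lt l (Suc i))"
    "lt i = 1 \<Longrightarrow> sub_letter (lt (Suc i)) \<and> sub_letter (lt (right_at l i)) \<and> i < right_at l i \<and>
       form_at n lt l i = Conj (form_at n lt l (Suc i)) (form_at n lt l (right_at l i))"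
    "lt i = 7 \<Longrightarrow> \<exists>a. form_at n lt l i = Atom a"
    using ok[OF i] i by (simp_all add: parse_ok_def form_at.simps[of n lt l i]) (simp add: right_at_def)
  show "same_atom lt l i j = (lt i = 7 \<and> lt j = 7 \<and> form_at n lt l i = form_at n lt l j)" if "j < n" for j
    using atom_at_inject[OF ok[OF i] ok[OF that]] i that
    by (auto simp: form_at.simps[of n lt l i] form_at.simps[of n lt l j] same_atom_def)
qed (rule s)

section \<open>Agreement of parse tables with strings\<close>

lemma upt_Conj:
  "[k..<k + (3 + a + b)] = k # [Suc k..<Suc k + a] @ (Suc k + a) # [k + 2 + a..<k + 2 + a + b] @ [k + 2 + a + b]"
proof -
  have "[k..<k + (3 + a + b)] = k # [Suc k..<k + (3 + a + b)]" by (rule upt_conv_Cons) simp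
  moreover have "[Suc k..<k + (3 + a + b)] = [Suc k..<Suc k + a] @ [Suc k + a..<k + (3 + a + b)]"
  proof -
    have e: "k + (3 + a + b) = Suc k + a + (b + 2)" by simp
    show ?thesis unfolding e by (rule upt_add_eq_append) simp
  qed
  moreover have "[Suc k + a..<k + (3 + a + b)] = (Suc k + a) # [k + 2 + a..<k + (3 + a + b)]"
    using upt_conv_Cons[of "Suc k + a" "k + (3 + a + b)"] by (simp del: upt_Suc)
  moreover have "k + (3 + a + b) = Suc (k + 2 + a + b)" by simp
  then have "[k + 2 + a..<k + (3 + a + b)] = [k + 2 + a..<k + 2 + a + b] @ [k + 2 + a + b]"
    by (simp only: upt_Suc_append le_add1)
  ultimately show ?thesis by (simp only:)
qed

text \<open>Soundness of a guessed table, by induction from right to left: the segment of length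
  \<open>l i\<close> at \<open>i\<close> spells out the formula read off there.\<close>

lemma form_at_string:
  assumes ok: "\<And>i. i < n \<Longrightarrow> parse_ok lt l i" and n: "\<And>i. lt i \<noteq> 0 \<Longrightarrow> i < n"
  shows "sub_letter (lt i) \<Longrightarrow> map lt [i..<i + l i] = map digit_val (form_string (form_at n lt l i))"
proof (induction "n - i" arbitrary: i rule: less_induct)
  case less
  have i: "i < n" using n[of i] less.prems by (auto simp: sub_letter_def)
  have IH: "map lt [j..<j + l j] = map digit_val (form_string (form_at n lt l j))"
    if "i < j" "sub_letter (lt j)" for j
    using less.hyps[of j] that i by simp
  note [simp] = form_at.simps[of n lt l i]
  consider "lt i = 3 \<or> lt i = 5 \<or> lt i = 6" | "lt i = 1" | "lt i = 7"
    using less.prems by (auto simp: sub_letter_def)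
  then show ?case
  proof cases
    case 1
    then have "sub_letter (lt (Suc i))" "l i = Suc (l (Suc i))" using ok[OF i] by (auto simp: parse_ok_def)
    then show ?thesis using 1 IH[of "Suc i"] i by (auto simp: upt_conv_Cons simp del: upt_Suc)
  next
    case 2
    let ?r = "right_at l i"
    have p: "sub_letter (lt (Suc i))" "lt (Suc i + l (Suc i)) = 4" "sub_letter (lt ?r)" "lt (?r + l ?r) = 2"
      "l i = 3 + l (Suc i) + l ?r"
      using ok[OF i] 2 by (auto simp: parse_ok_def)
    have r: "i + 2 + l (Suc i) = ?r" "i < ?r" by (simp_all add: right_at_def)
    show ?thesis
      unfolding p(5) upt_Conj r(1) using 2 p i IH[of "Suc i"] IH[of ?r] r(2) by (simp del: upt_Suc)
  next
    case 3
    then have p: "2 \<le> l i" "lt (Suc i) = 8 \<and> l i = 2 \<or>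
       lt (Suc i) = 9 \<and> (\<forall>j<l i. 2 \<le> j \<longrightarrow> lt (i + j) = 8 \<or> lt (i + j) = 9)"
      using ok[OF i] by (auto simp: parse_ok_def)
    have u: "[i..<i + l i] = i # Suc i # map ((+) i) [2..<l i]"
    proof -
      have "[i..<i + l i] = map ((+) i) [0..<l i]"
        by (rule nth_equalityI) auto
      also have "[0..<l i] = 0 # 1 # [2..<l i]"
        using p(1) by (simp add: upt_conv_Cons numeral_2_eq_2)
      finally show ?thesis by simp
    qed
    show ?thesis
      unfolding u using 3 i p(2) by (auto simp: atom_at_def)
  qed
qed

primrec form_lengths :: "form \<Rightarrow> nat list" where
  "form_lengths (Atom a) = length (atom_string a) # replicate (length (atom_string a) - 1) 0"
| "form_lengths (Neg \<phi>) = Suc (length (form_string \<phi>)) # form_lengths \<phi>"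
| "form_lengths (K \<phi>) = Suc (length (form_string \<phi>)) # form_lengths \<phi>"
| "form_lengths (Box \<phi>) = Suc (length (form_string \<phi>)) # form_lengths \<phi>"
| "form_lengths (Conj \<phi> \<psi>) = (3 + length (form_string \<phi>) + length (form_string \<psi>)) #
     form_lengths \<phi> @ 0 # form_lengths \<psi> @ [0]"

lemma length_atom_string: "2 \<le> length (atom_string a)"
  by (cases a) auto

lemma length_form_lengths [simp]: "length (form_lengths \<phi>) = length (form_string \<phi>)"
proof (induction \<phi>)
  case (Atom a)
  then show ?case using length_atom_string[of a] by simp
qed auto

lemma form_lengths_le: "x \<in> set (form_lengths \<phi>) \<Longrightarrow> x \<le> length (form_string \<phi>)"
  by (induction \<phi>) fastforce+

lemma parse_unary:
  assumes "(\<forall>i\<in>{Suc k..<Suc k + m}. parse_ok lt l i) \<and> form_at n lt l (Suc k) = \<phi> \<and>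
      l (Suc k) = m \<and> sub_letter (lt (Suc k))"
    "lt k = 3 \<or> lt k = 5 \<or> lt k = 6" "l k = Suc m"
  shows "(\<forall>i\<in>{k..<k + Suc m}. parse_ok lt l i) \<and> form_at n lt l (Suc k) = \<phi>"
proof -
  have "l (Suc k) = m" "sub_letter (lt (Suc k))" using assms(1) by blast+
  then have "parse_ok lt l k" unfolding parse_ok_def using assms(2,3) by auto
  moreover have E: "{k..<k + Suc m} = insert k {Suc k..<Suc k + m}" by auto
  ultimately show ?thesis unfolding E using assms(1) by blast
qed

text \<open>Completeness: the true lengths pass the check. The offset \<open>k\<close> lets the
  induction speak of a formula inside a longer string.\<close>

lemma form_at_form_lengths:
  assumes "map lt [k..<k + length (form_string \<phi>)] = map digit_val (form_string \<phi>)"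
    "map l [k..<k + length (form_string \<phi>)] = form_lengths \<phi>" "k + length (form_string \<phi>) \<le> n"
  shows "(\<forall>i\<in>{k..<k + length (form_string \<phi>)}. parse_ok lt l i) \<and> form_at n lt l k = \<phi> \<and>
    l k = length (form_string \<phi>) \<and> sub_letter (lt k)"
  using assms
proof (induction \<phi> arbitrary: k)
  case (Atom a)
  let ?m = "length (atom_string a)"
  have m: "2 \<le> ?m" by (rule length_atom_string)
  have lt: "lt (k + i) = digit_val (atom_string a ! i)" if "i < ?m" for i
    using arg_cong[OF Atom.prems(1), of "\<lambda>xs. xs ! i"] that by simp
  have l: "l (k + i) = form_lengths (Atom a) ! i" if "i < ?m" for i
    using arg_cong[OF Atom.prems(2), of "\<lambda>xs. xs ! i"] that by simp
  have lk: "l k = ?m" using l[of 0] m by (cases a) simp_all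
  have k: "lt k = 7" using lt[of 0] m by (cases a) auto
  have k1: "lt (Suc k) = (if a = X0 then 8 else 9)" using lt[of 1] m by (cases a) auto
  have bits: "lt (k + j) = 8 \<or> lt (k + j) = 9" if "1 \<le> j" "j < ?m" for j
    using lt[OF that(2)] that by (cases a) (auto simp: nth_Cons')
  have ok: "parse_ok lt l k"
    using k k1 lk m bits by (cases a) (auto simp: parse_ok_def)
  have ok': "parse_ok lt l (k + j)" if "1 \<le> j" "j < ?m" for j
    using bits[OF that] by (auto simp: parse_ok_def)
  have "parse_ok lt l i" if "i \<in> {k..<k + ?m}" for i
  proof (cases "i = k")
    case False
    then show ?thesis using ok'[of "i - k"] that by auto
  qed (simp add: ok)
  moreover have "atom_at lt l k = a"
  proof (cases a)
    case (X1 w)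
    have len: "?m = 2 + length w" using X1 by simp
    have "map (\<lambda>j. lt (k + j) = 9) [2..<?m] = w"
    proof (rule nth_equalityI)
      show "length (map (\<lambda>j. lt (k + j) = 9) [2..<?m]) = length w"
        unfolding len by (simp del: upt_Suc)
      fix i assume "i < length (map (\<lambda>j. lt (k + j) = 9) [2..<?m])"
      then have i: "i < length w" unfolding len by (simp del: upt_Suc)
      then have "lt (k + (2 + i)) = (if w ! i then 9 else 8)" using lt[of "2 + i"] X1 len by simp
      then show "map (\<lambda>j. lt (k + j) = 9) [2..<?m] ! i = w ! i"
        unfolding len using i by (simp del: upt_Suc)
    qed
    then show ?thesis using k1 lk X1 by (simp add: atom_at_def)
  qed (use k1 in \<open>simp add: atom_at_def\<close>)
  then have "form_at n lt l k = Atom a"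
    using k m Atom.prems(3) by (simp add: form_at.simps[of n lt l k])
  ultimately show ?case using k lk by (simp add: sub_letter_def)
next
  case (Neg \<phi>)
  let ?m = "length (form_string \<phi>)"
  have p: "map lt [Suc k..<Suc k + ?m] = map digit_val (form_string \<phi>)"
      "map l [Suc k..<Suc k + ?m] = form_lengths \<phi>" "Suc k + ?m \<le> n" "lt k = 3" "l k = Suc ?m"
    using Neg.prems by (auto simp: upt_conv_Cons simp del: upt_Suc)
  then show ?case
    using parse_unary[OF Neg.IH[OF p(1-3)]] by (simp add: form_at.simps[of n lt l k] sub_letter_def)
next
  case (K \<phi>)
  let ?m = "length (form_string \<phi>)"
  have p: "map lt [Suc k..<Suc k + ?m] = map digit_val (form_string \<phi>)"
      "map l [Suc k..<Suc k + ?m] = form_lengths \<phi>" "Suc k + ?m \<le> n" "lt k = 6" "l k = Suc ?m"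
    using K.prems by (auto simp: upt_conv_Cons simp del: upt_Suc)
  then show ?case
    using parse_unary[OF K.IH[OF p(1-3)]] by (simp add: form_at.simps[of n lt l k] sub_letter_def)
next
  case (Box \<phi>)
  let ?m = "length (form_string \<phi>)"
  have p: "map lt [Suc k..<Suc k + ?m] = map digit_val (form_string \<phi>)"
      "map l [Suc k..<Suc k + ?m] = form_lengths \<phi>" "Suc k + ?m \<le> n" "lt k = 5" "l k = Suc ?m"
    using Box.prems by (auto simp: upt_conv_Cons simp del: upt_Suc)
  then show ?case
    using parse_unary[OF Box.IH[OF p(1-3)]] by (simp add: form_at.simps[of n lt l k] sub_letter_def)
next
  case (Conj \<phi> \<psi>)
  let ?a = "length (form_string \<phi>)" and ?b = "length (form_string \<psi>)"
  have len: "length (form_string (Conj \<phi> \<psi>)) = 3 + ?a + ?b" by simp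
  note prems = Conj.prems[unfolded len upt_Conj]
  have lt: "lt k = 1" "map lt [Suc k..<Suc k + ?a] = map digit_val (form_string \<phi>)" "lt (Suc k + ?a) = 4"
      "map lt [k + 2 + ?a..<k + 2 + ?a + ?b] = map digit_val (form_string \<psi>)" "lt (k + 2 + ?a + ?b) = 2"
    using prems(1) by (auto simp del: upt_Suc)
  have l: "l k = 3 + ?a + ?b" "map l [Suc k..<Suc k + ?a] = form_lengths \<phi>"
      "map l [k + 2 + ?a..<k + 2 + ?a + ?b] = form_lengths \<psi>"
    using prems(2) by (auto simp del: upt_Suc)
  have 1: "(\<forall>i\<in>{Suc k..<Suc k + ?a}. parse_ok lt l i) \<and> form_at n lt l (Suc k) = \<phi> \<and>
      l (Suc k) = ?a \<and> sub_letter (lt (Suc k))"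
    by (rule Conj.IH(1)[OF lt(2) l(2)]) (use prems(3) in simp)
  have 2: "(\<forall>i\<in>{k + 2 + ?a..<k + 2 + ?a + ?b}. parse_ok lt l i) \<and> form_at n lt l (k + 2 + ?a) = \<psi> \<and>
      l (k + 2 + ?a) = ?b \<and> sub_letter (lt (k + 2 + ?a))"
    by (rule Conj.IH(2)[OF lt(4) l(3)]) (use prems(3) in simp)
  have r: "right_at l k = k + 2 + ?a" using 1 by (simp add: right_at_def)
  have "parse_ok lt l k" using lt l 1 2 r by (auto simp: parse_ok_def)
  moreover have "parse_ok lt l (Suc k + ?a)" "parse_ok lt l (k + 2 + ?a + ?b)"
    using lt by (auto simp: parse_ok_def)
  moreover have "i = k \<or> i \<in> {Suc k..<Suc k + ?a} \<or> i = Suc k + ?a \<or> i \<in> {k + 2 + ?a..<k + 2 + ?a + ?b} \<or>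
      i = k + 2 + ?a + ?b" if "i \<in> {k..<k + (3 + ?a + ?b)}" for i using that by auto
  ultimately have "\<forall>i\<in>{k..<k + (3 + ?a + ?b)}. parse_ok lt l i" using 1 2 by blast
  moreover have "form_at n lt l k = Conj \<phi> \<psi>"
    using prems(3) lt(1) 1 2 r by (simp add: form_at.simps[of n lt l k])
  ultimately show ?case unfolding len using l(1) lt(1) by (simp add: sub_letter_def)
qed

theorem parse_iff:
  assumes "length w = n" and y: "Suc n ^ n \<le> y"
  shows "w = form_string \<phi> \<longleftrightarrow> (\<exists>c<y. table_ok n (letter_at (num_val w)) (length_at n c) \<and>
    form_at n (letter_at (num_val w)) (length_at n c) 0 = \<phi>)"
proof -
  let ?lt = "letter_at (num_val w)"
  have lt: "map ?lt [0..<n] = map digit_val w"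
    by (rule nth_equalityI) (use assms(1) in \<open>auto simp: letter_at_num_val\<close>)
  have n: "?lt i \<noteq> 0 \<Longrightarrow> i < n" for i using assms(1) by (simp add: letter_at_num_val split: if_splits)
  show ?thesis
  proof
    assume w: "w = form_string \<phi>"
    obtain c where c: "c < Suc n ^ n" "\<forall>i<n. length_at n c i = form_lengths \<phi> ! i"
      using length_at_ex[of "form_lengths \<phi>" n] form_lengths_le[of _ \<phi>] assms(1) w by auto
    have "(\<forall>i\<in>{0..<0 + length (form_string \<phi>)}. parse_ok ?lt (length_at n c) i) \<and>
        form_at n ?lt (length_at n c) 0 = \<phi> \<and> length_at n c 0 = length (form_string \<phi>) \<and> sub_letter (?lt 0)"
    proof (rule form_at_form_lengths)
      show "map (length_at n c) [0..<0 + length (form_string \<phi>)] = form_lengths \<phi>"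
        by (rule nth_equalityI) (use c assms(1) w in auto)
    qed (use assms(1) w lt in auto)
    then have "table_ok n ?lt (length_at n c)" "form_at n ?lt (length_at n c) 0 = \<phi>"
      using assms(1) w by (auto simp: table_ok_def)
    then show "\<exists>c<y. table_ok n ?lt (length_at n c) \<and> form_at n ?lt (length_at n c) 0 = \<phi>"
      using less_le_trans[OF c(1) y] by blast
  next
    assume "\<exists>c<y. table_ok n ?lt (length_at n c) \<and> form_at n ?lt (length_at n c) 0 = \<phi>"
    then obtain c where c: "table_ok n ?lt (length_at n c)" "form_at n ?lt (length_at n c) 0 = \<phi>" by blast
    then have "map ?lt [0..<0 + length_at n c 0] = map digit_val (form_string \<phi>)"
      using form_at_string[of n ?lt "length_at n c" 0] n by (auto simp: table_ok_def)
    then have "map digit_val w = map digit_val (form_string \<phi>)" using c(1) lt by (simp add: table_ok_def)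
    then show "w = form_string \<phi>" using inj_map_eq_map[of digit_val] digit_val_inject by (simp add: inj_def)
  qed
qed

section \<open>The decision procedure\<close>

context
  fixes ub :: "'e \<Rightarrow> nat" and gs :: "('e \<Rightarrow> nat) list"
begin

lemma linspace_letter_at:
  assumes v: "linspace ub gs v" and i: "linspace ub gs i"
  shows "linspace ub gs (\<lambda>e. letter_at (v e) (i e))"
proof -
  have le: "drop_digits x j \<le> x" for x j
    by (induction j) (auto simp: drop_digits_def intro: order_trans[OF div_le_dividend])
  have "linspace ub gs (\<lambda>e. drop_digits (v e) (i e))"
    unfolding drop_digits_def
    by (rule linspace_rec[OF i v _ linspace_polybounded[OF v]])
      (use le in \<open>auto simp: drop_digits_def intro!: linspace_intros\<close>)
  then show ?thesis unfolding letter_at_def by (intro linspace_intros)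
qed

lemma linspace_length_at:
  assumes n: "linspace ub gs n" and c: "linspace ub gs c" and i: "linspace ub gs i"
  shows "linspace ub gs (\<lambda>e. length_at (n e) (c e) (i e))"
proof -
  have le: "rec_nat x (\<lambda>_ u. u div Suc y) j \<le> x" for x y j
    by (induction j) (auto intro: order_trans[OF div_le_dividend])
  have "linspace ub gs (\<lambda>e. rec_nat (c e) (\<lambda>_ u. u div Suc (n e)) (i e))"
    by (rule linspace_rec[OF i c _ linspace_polybounded[OF c] le]) (intro linspace_intros n)
  then show ?thesis unfolding length_at_def by (intro linspace_intros n)
qed

end

lemma linspace_str_length: "linspace ub gs v \<Longrightarrow> linspace ub gs (\<lambda>e. str_length (v e))"
  unfolding str_length_def by (intro linspace_intros linspace_letter_at)

lemmas linspace_parse_intros = linspace_letter_at linspace_length_at linspace_intros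

lemma linspace_table_ok:
  assumes "linspace ub gs n" "linspace ub gs v" "linspace ub gs c"
  shows "linspace_pred ub gs (\<lambda>e. table_ok (n e) (letter_at (v e)) (length_at (n e) (c e)))"
  unfolding table_ok_def parse_ok_def sub_letter_def right_at_def
  by (intro linspace_parse_intros assms)

lemma linspace_type_le:
  assumes "linspace ub gs n" "linspace ub gs v" "linspace ub gs t" "linspace ub gs u"
  shows "linspace_pred ub gs (\<lambda>e. type_le ssl (n e) (letter_at (v e)) (t e) (u e))"
  unfolding type_le_def by (intro linspace_parse_intros assms)

lemma linspace_type_ok:
  assumes "linspace ub gs n" "linspace ub gs v" "linspace ub gs c" "linspace ub gs t"
  shows "linspace_pred ub gs (\<lambda>e. type_ok rf (n e) (letter_at (v e)) (right_at (length_at (n e) (c e)))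
    (same_atom (letter_at (v e)) (length_at (n e) (c e))) (t e))"
  unfolding type_ok_def right_at_def same_atom_def by (intro linspace_parse_intros assms)

lemmas linspace_type_intros = linspace_type_le linspace_type_ok linspace_parse_intros

abbreviation "ok_at rf n p v c \<equiv>
  cloud_ok rf n p (letter_at v) (right_at (length_at n c)) (same_atom (letter_at v) (length_at n c))"
abbreviation "key_at ssl n p y v \<equiv> cloud_key ssl n p y (letter_at v)"
abbreviation "reach_at ssl n p v \<equiv> cloud_reach ssl n p (letter_at v)"
abbreviation "flaw_at n v \<equiv> cloud_flaw n (letter_at v)"
abbreviation "repairs_at ssl n p v \<equiv> cloud_repairs ssl n p (letter_at v)"

lemma linspace_cloud_flaw:
  assumes "linspace ub gs n" "linspace ub gs v" "linspace ub gs a" "linspace ub gs d"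
  shows "linspace_pred ub gs (\<lambda>e. flaw_at (n e) (v e) (a e) (d e))"
  unfolding cloud_flaw_def by (intro linspace_parse_intros assms)

lemma linspace_cloud_ok:
  assumes "linspace ub gs n" "linspace ub gs p" "linspace ub gs v" "linspace ub gs c" "linspace ub gs a"
  shows "linspace_pred ub gs (\<lambda>e. ok_at rf (n e) (p e) (v e) (c e) (a e))"
  unfolding cloud_ok_def by (intro linspace_type_intros assms)

lemma linspace_cloud_key:
  assumes "linspace ub gs n" "linspace ub gs p" "linspace ub gs v" "linspace ub gs a" "linspace ub gs y"
  shows "linspace ub gs (\<lambda>e. key_at ssl (n e) (p e) (y e) (v e) (a e))"
  unfolding cloud_key_def by (intro linspace_collect_bits linspace_type_intros assms)

lemma linspace_cloud_reach:
  assumes "linspace ub gs n" "linspace ub gs p" "linspace ub gs v" "linspace ub gs k" "linspace ub gs a"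
  shows "linspace_pred ub gs (\<lambda>e. reach_at ssl (n e) (p e) (v e) (k e) (a e))"
  unfolding cloud_reach_def by (intro linspace_type_intros assms)

lemma linspace_cloud_repairs:
  assumes "linspace ub gs n" "linspace ub gs p" "linspace ub gs v" "linspace ub gs a" "linspace ub gs d"
  shows "linspace_pred ub gs (\<lambda>e. repairs_at ssl (n e) (p e) (v e) (a e) (d e))"
  unfolding cloud_repairs_def by (intro linspace_type_intros assms)

lemmas linspace_cloud_intros = linspace_cloud_flaw linspace_cloud_ok linspace_cloud_key linspace_cloud_reach
  linspace_cloud_repairs linspace_collect_bits linspace_intros

lemma linspace_child_cloud:
  assumes "linspace ub gs n" "linspace ub gs p" "linspace ub gs v" "linspace ub gs c" "linspace ub gs y"
    "linspace ub gs m" "linspace ub gs k" "linspace ub gs a"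
  shows "linspace_pred ub gs (\<lambda>e. child_cloud (m e)
    (ok_at rf (n e) (p e) (v e) (c e))
    (reach_at ssl (n e) (p e) (v e))
    (key_at ssl (n e) (p e) (y e) (v e)) (k e) (a e))"
  unfolding child_cloud_def by (intro linspace_cloud_intros assms)

lemma linspace_collect_repairs:
  assumes "linspace ub gs n" "linspace ub gs p" "linspace ub gs v"
    "linspace ub gs q" "linspace ub gs Q" "linspace ub gs a" "linspace ub gs acc" "linspace ub gs u"
  shows "linspace ub gs (\<lambda>e. collect_repairs (q e) (Q e) (flaw_at (n e) (v e))
    (repairs_at ssl (n e) (p e) (v e)) (k e) (a e) (acc e) (u e))"
  unfolding collect_repairs_def by (intro linspace_cloud_intros assms)

lemma linspace_close_repairs:
  assumes "linspace ub gs n" "linspace ub gs p" "linspace ub gs v" "linspace ub gs c" "linspace ub gs y"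
    "linspace ub gs q" "linspace ub gs Y" "linspace ub gs Q" "linspace ub gs k" "linspace ub gs acc"
  shows "linspace ub gs (\<lambda>e. close_repairs (q e) (Y e) (Q e)
    (ok_at rf (n e) (p e) (v e) (c e))
    (reach_at ssl (n e) (p e) (v e))
    (key_at ssl (n e) (p e) (y e) (v e)) (flaw_at (n e) (v e))
    (repairs_at ssl (n e) (p e) (v e)) (k e) (acc e))"
  unfolding close_repairs_def by (intro linspace_cloud_intros assms)

lemma linspace_cloud_step:
  assumes "linspace ub gs n" "linspace ub gs p" "linspace ub gs v" "linspace ub gs c" "linspace ub gs y"
    "linspace ub gs q" "linspace ub gs Y" "linspace ub gs Q" "linspace ub gs m" "linspace ub gs A" "linspace ub gs x"
  shows "linspace ub gs (\<lambda>e. stack_step (A e) (Y e)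
    (child_cloud (m e)
      (ok_at rf (n e) (p e) (v e) (c e))
      (reach_at ssl (n e) (p e) (v e))
      (key_at ssl (n e) (p e) (y e) (v e)))
    (key_at ssl (n e) (p e) (y e) (v e))
    (collect_repairs (q e) (Q e) (flaw_at (n e) (v e))
      (repairs_at ssl (n e) (p e) (v e)))
    (close_repairs (q e) (Y e) (Q e)
      (ok_at rf (n e) (p e) (v e) (c e))
      (reach_at ssl (n e) (p e) (v e))
      (key_at ssl (n e) (p e) (y e) (v e)) (flaw_at (n e) (v e))
      (repairs_at ssl (n e) (p e) (v e))) (x e))"
  unfolding stack_step_def push_frame_def
  by (intro linspace_child_cloud linspace_collect_repairs linspace_close_repairs linspace_cloud_key
      linspace_intros assms)

text \<open>The instance of \<open>ub\<close>: the states of the stack machine are polynomial in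
  this number, which itself is never computed.\<close>

definition space_bound :: "letter list \<Rightarrow> nat" where
  "space_bound w = 2 ^ (length w * 4 ^ length w)"

lemma polybounded_power2:
  assumes "\<And>w. E w \<le> k * (length w * 4 ^ length w) + k"
  shows "polybounded space_bound gs (\<lambda>w. 2 ^ E w)"
proof (rule polybounded_mono)
  show "polybounded space_bound gs (\<lambda>w. 2 ^ k * space_bound w ^ k)"
    by (intro polybounded_mult polybounded_const polybounded_power polybounded_bound)
  show "2 ^ E w \<le> 2 ^ k * space_bound w ^ k" for w
  proof -
    have "(2 :: nat) ^ E w \<le> 2 ^ (k * (length w * 4 ^ length w) + k)"
      by (rule power_increasing[OF assms]) simp
    also have "\<dots> = 2 ^ k * space_bound w ^ k"
      by (simp add: space_bound_def power_add mult.commute flip: power_mult)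
    finally show ?thesis .
  qed
qed

context
  fixes n :: nat
begin

text \<open>The summand 1 takes care of n = 0, where n * 4 ^ n vanishes.\<close>

lemma exponent_bounds:
  "n \<le> n * 4 ^ n" "2 ^ n \<le> n * 4 ^ n + 1" "2 ^ n * n \<le> n * 4 ^ n" "2 ^ n * 2 ^ n = (4 :: nat) ^ n"
  "4 ^ n \<le> n * 4 ^ n + (1 :: nat)"
proof -
  have p: "(2 :: nat) ^ n \<le> 4 ^ n" by (rule power_mono) auto
  have "n * 1 \<le> n * 4 ^ n" by (intro mult_left_mono) auto
  then show "n \<le> n * 4 ^ n" by simp
  show 5: "4 ^ n \<le> n * 4 ^ n + (1 :: nat)" by (cases n) auto
  then show "2 ^ n \<le> n * 4 ^ n + 1" using p by linarith
  have "n * 2 ^ n \<le> n * 4 ^ n" using p by (intro mult_left_mono) auto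
  then show "2 ^ n * n \<le> n * 4 ^ n" by (simp add: mult.commute)
  show "2 ^ n * 2 ^ n = (4 :: nat) ^ n" by (simp flip: power_mult_distrib)
qed

text \<open>The first factor is the number of bits of a base-A digit, the second the number of
  digits of the stack for keys of 2 * 2 ^ n bits. The product is where n * 4 ^ n originates; 40 is a
  generous constant.\<close>

lemma stack_exponent_bound:
  "(2 ^ n * n + 2 * 2 ^ n + 1) * (3 * Suc (2 * 2 ^ n) + 1) \<le> 40 * (n * 4 ^ n) + 40"
proof -
  have eq: "(2 ^ n * n + 2 * 2 ^ n + 1) * (3 * Suc (2 * 2 ^ n) + 1) =
      6 * (n * (2 ^ n * 2 ^ n)) + 12 * (2 ^ n * 2 ^ n) + 14 * 2 ^ n + 4 * (2 ^ n * n) + 4"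
    by (simp add: algebra_simps)
  show ?thesis unfolding eq exponent_bounds(4) using exponent_bounds(1,2,3,5) by linarith
qed

end

lemma linspace_length: "linspace space_bound [num_val] length"
proof -
  have "linspace space_bound [num_val] (\<lambda>w. str_length (num_val w))"
    by (intro linspace_str_length linspace_arg)
  then show ?thesis by (simp add: str_length_num_val)
qed

lemma linspace_power2_length: "linspace space_bound [num_val] (\<lambda>w. 2 ^ length w)"
  by (rule linspace_power2[OF linspace_length polybounded_power2[of _ 1]])
    (use exponent_bounds(1) in \<open>simp add: le_SucI\<close>)

lemmas linspace_sizes =
  linspace_power2_length
  linspace_power2[OF linspace_power2_length polybounded_power2[of _ 1]]
  linspace_power2[OF linspace_mult[OF linspace_power2_length linspace_length] polybounded_power2[of _ 1]]
  linspace_power2[OF linspace_mult[OF linspace_const[of _ _ 2] linspace_power2_length] polybounded_power2[of _ 2]]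
  linspace_power2[OF linspace_add[OF linspace_add[OF linspace_mult[OF linspace_power2_length linspace_length]
    linspace_mult[OF linspace_const[of _ _ 2] linspace_power2_length]] linspace_const[of _ _ 1]]
    polybounded_power2[of _ 4]]

text \<open>The stack machine is run by \<open>linspace_while\<close> until it halts, and the
  goodness of the cloud is read off the returned vector of repairable flaws.\<close>

lemma linspace_good_cloud:
  "linspace_pred (ext_bound (ext_bound space_bound)) (ext_args (ext_args [num_val]))
    (\<lambda>x. clouds.good_cloud ssl rf (length (fst (fst x))) (letter_at (num_val (fst (fst x))))
      (right_at (length_at (length (fst (fst x))) (snd (fst x))))
      (same_atom (letter_at (num_val (fst (fst x)))) (length_at (length (fst (fst x))) (snd (fst x)))) (snd x))"
proof -
  let ?ub = "ext_bound (ext_bound space_bound)" and ?gs = "ext_args (ext_args [num_val])"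
  define n where "n x = length (fst (fst x))" for x :: "(letter list \<times> nat) \<times> nat"
  define v where "v x = num_val (fst (fst x))" for x :: "(letter list \<times> nat) \<times> nat"
  define c where "c x = snd (fst x)" for x :: "(letter list \<times> nat) \<times> nat"
  define p where "p x = (2 :: nat) ^ n x" for x
  define Y where "Y x = (2 :: nat) ^ p x" for x
  define Q where "Q x = p x * n x" for x
  define q where "q x = (2 :: nat) ^ Q x" for x
  define m where "m x = 2 * p x" for x
  define y where "y x = (2 :: nat) ^ m x" for x
  \<comment> \<open>A digit has to hold a loop counter up to 2 ^ p, a key of 2 * p bits or a vector
    of p * n flaws.\<close>
  define A where "A x = (2 :: nat) ^ (p x * n x + 2 * p x + 1)" for x
  have E: "2 ^ n \<le> 1 * (n * 4 ^ n) + 1" "2 ^ n * n \<le> 1 * (n * 4 ^ n) + 1" "2 * 2 ^ n \<le> 2 * (n * 4 ^ n) + 2"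
      "2 ^ n * n + 2 * 2 ^ n + 1 \<le> 4 * (n * 4 ^ n) + 4" for n :: nat
    using exponent_bounds[of n] by linarith+
  note sizes = linspace_sizes(1) linspace_sizes(2)[OF E(1)] linspace_sizes(3)[OF E(2)]
    linspace_sizes(4)[OF E(3)] linspace_sizes(5)[OF E(4)]
  note lift = linspace_weaken[OF linspace_weaken]
  have ln: "linspace ?ub ?gs n" unfolding n_def by (rule lift[OF linspace_length])
  have lv: "linspace ?ub ?gs v" unfolding v_def by (rule lift[OF linspace_arg])
  have lc: "linspace ?ub ?gs c" unfolding c_def by (rule linspace_weaken[OF linspace_snd])
  have lp: "linspace ?ub ?gs p" unfolding p_def n_def by (rule lift[OF sizes(1)])
  have lY: "linspace ?ub ?gs Y" unfolding Y_def p_def n_def by (rule lift[OF sizes(2)])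
  have lQ: "linspace ?ub ?gs Q" unfolding Q_def by (rule linspace_mult[OF lp ln])
  have lq: "linspace ?ub ?gs q" unfolding q_def Q_def p_def n_def by (rule lift[OF sizes(3)])
  have lm: "linspace ?ub ?gs m" unfolding m_def by (rule linspace_mult[OF linspace_const lp])
  have ly: "linspace ?ub ?gs y" unfolding y_def m_def p_def n_def by (rule lift[OF sizes(4)])
  have lA: "linspace ?ub ?gs A" unfolding A_def p_def n_def by (rule lift[OF sizes(5)])
  note l = ln lp lv lc ly lq lY lQ lm lA
  define coh where "coh x = ok_at rf (n x) (p x) (v x) (c x)" for x
  define reach where "reach x = cloud_reach ssl (n x) (p x) (letter_at (v x))" for x
  define key where "key x = cloud_key ssl (n x) (p x) (y x) (letter_at (v x))" for x
  define flaw where "flaw x = cloud_flaw (n x) (letter_at (v x))" for x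
  define repairs where "repairs x = cloud_repairs ssl (n x) (p x) (letter_at (v x))" for x
  note defs = coh_def reach_def key_def flaw_def repairs_def
  define good where "good x = clouds.good_cloud ssl rf (n x) (letter_at (v x)) (right_at (length_at (n x) (c x)))
      (same_atom (letter_at (v x)) (length_at (n x) (c x)))" for x
  define h where "h x = stack_step (A x) (Y x) (child_cloud (m x) (coh x) (reach x) (key x)) (key x)
      (collect_repairs (q x) (Q x) (flaw x) (repairs x))
      (close_repairs (q x) (Y x) (Q x) (coh x) (reach x) (key x) (flaw x) (repairs x))" for x
  define g where "g x = push_frame (A x) (key x (snd x)) 0 0 0 * A x" for x
  have "\<exists>k u. (h x ^^ k) (g x) = Suc u \<and> \<not> stack_running (A x) (Suc u) \<and>
      (\<forall>j<k. stack_running (A x) ((h x ^^ j) (g x))) \<and>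
      (\<forall>j\<le>k. (h x ^^ j) (g x) \<le> A x ^ (3 * Suc (m x) + 1)) \<and>
      (good x (snd x) \<longleftrightarrow> snd x < Y x \<and> coh x (snd x) \<and> (\<forall>d<Q x. flaw x (snd x) d \<longrightarrow> bit u d))" for x
  proof -
    interpret C: clouds ssl rf "n x" "letter_at (v x)" "right_at (length_at (n x) (c x))"
      "same_atom (letter_at (v x)) (length_at (n x) (c x))" .
    have "2 ^ (2 ^ n x) < A x" "2 ^ (2 * 2 ^ n x) < A x" "2 ^ (2 ^ n x * n x) < A x"
      unfolding A_def p_def by (rule power_strict_increasing; simp)+
    from C.good_iff_machine[OF this, of "snd x"] show ?thesis
      unfolding h_def g_def good_def C.good_cloud_def defs p_def Y_def Q_def q_def m_def y_def .
  qed
  then obtain k u where k: "\<And>x. (h x ^^ k x) (g x) = Suc (u x)" "\<And>x. \<not> stack_running (A x) (Suc (u x))"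
      "\<And>x j. j < k x \<Longrightarrow> stack_running (A x) ((h x ^^ j) (g x))"
      "\<And>x j. j \<le> k x \<Longrightarrow> (h x ^^ j) (g x) \<le> A x ^ (3 * Suc (m x) + 1)"
      "\<And>x. good x (snd x) \<longleftrightarrow> snd x < Y x \<and> coh x (snd x) \<and> (\<forall>d<Q x. flaw x (snd x) d \<longrightarrow> bit (u x) d)"
    by metis
  have "linspace ?ub ?gs (\<lambda>x. (h x ^^ k x) (g x))"
  proof (rule linspace_while[where t = "\<lambda>x s. of_bool (stack_running (A x) s)"])
    show "linspace ?ub ?gs g"
      unfolding g_def push_frame_def key_def by (intro linspace_cloud_intros linspace_snd l)
    show "linspace (ext_bound ?ub) (ext_args ?gs) (\<lambda>x. of_bool (stack_running (A (fst x)) (snd x)))"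
      unfolding linspace_pred_def[symmetric] stack_running_def by (intro linspace_intros l)
    show "linspace (ext_bound ?ub) (ext_args ?gs) (\<lambda>x. h (fst x) (snd x))"
      unfolding h_def defs by (intro linspace_cloud_step linspace_weaken l linspace_snd)
    have "polybounded space_bound [num_val]
        (\<lambda>w. 2 ^ ((2 ^ length w * length w + 2 * 2 ^ length w + 1) * (3 * Suc (2 * 2 ^ length w) + 1)))"
      by (rule polybounded_power2[OF stack_exponent_bound])
    from polybounded_weaken[OF polybounded_weaken[OF this]]
    show "polybounded ?ub ?gs (\<lambda>x. A x ^ (3 * Suc (m x) + 1))"
      unfolding A_def m_def p_def n_def by (simp only: power_mult)
  qed (use k in auto)
  \<comment> \<open>The machine stops with the successor of the result.\<close>
  then have lu: "linspace ?ub ?gs u"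
    unfolding k(1) using linspace_diff[OF _ linspace_const[of _ _ 1]] by fastforce
  have "linspace_pred ?ub ?gs (\<lambda>x. snd x < Y x \<and> coh x (snd x) \<and> (\<forall>d<Q x. flaw x (snd x) d \<longrightarrow> bit (u x) d))"
    unfolding defs by (intro linspace_cloud_intros l lu)
  then have "linspace_pred ?ub ?gs (\<lambda>x. good x (snd x))" by (rule linspace_pred_cong) (simp only: k(5))
  then show ?thesis unfolding good_def n_def v_def c_def .
qed

text \<open>A parse table, a cloud and a type in it are sought by bounded quantifiers. The logic
  enters only through the two flags and the equivalence of \<open>S\<close> with a good witness, so
  one procedure serves all three logics.\<close>

theorem logic_DSPACE:
  assumes S: "\<And>n lt r sm fm sub. formula_table ssl rf n lt r sm fm sub \<Longrightarrow>
      S (fm 0) \<longleftrightarrow> clouds.good_witness ssl rf n lt r sm"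
    and "ssl \<Longrightarrow> rf"
    and f: "(\<lambda>n. real n * 2 ^ (2 * n)) \<in> O(f)"
  shows "{form_string \<phi> |\<phi>. S \<phi>} \<in> DSPACE f"
proof (rule linspace_pred_DSPACE)
  let ?n = length and ?lt = "\<lambda>w. letter_at (num_val w)"
  let ?r = "\<lambda>w c. right_at (length_at (length w) c)"
    and ?sm = "\<lambda>w c. same_atom (letter_at (num_val w)) (length_at (length w) c)"
  let ?P = "\<lambda>w. \<exists>c<2 ^ (2 ^ ?n w * ?n w). table_ok (?n w) (?lt w) (length_at (?n w) c) \<and>
    (\<exists>C<2 ^ 2 ^ ?n w. clouds.good_cloud ssl rf (?n w) (?lt w) (?r w c) (?sm w c) C \<and>
      (\<exists>t<2 ^ ?n w. bit C t \<and> bit t 0))"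
  have E: "2 ^ n \<le> 1 * (n * 4 ^ n) + 1" "2 ^ n * n \<le> 1 * (n * 4 ^ n) + 1" for n :: nat
    using exponent_bounds[of n] by linarith+
  note lift = linspace_weaken[OF linspace_weaken]
  have lin: "linspace_pred space_bound [num_val] ?P"
  proof (intro linspace_pred_ex linspace_pred_conj)
    show "linspace space_bound [num_val] (\<lambda>w. 2 ^ (2 ^ ?n w * ?n w))"
      by (rule linspace_sizes(3)[OF E(2)])
    show "linspace_pred (ext_bound space_bound) (ext_args [num_val])
       (\<lambda>x. table_ok (?n (fst x)) (?lt (fst x)) (length_at (?n (fst x)) (snd x)))"
      by (intro linspace_table_ok linspace_snd linspace_weaken linspace_length linspace_arg)
    show "linspace (ext_bound space_bound) (ext_args [num_val]) (\<lambda>x. 2 ^ 2 ^ ?n (fst x))"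
      by (rule linspace_weaken[OF linspace_sizes(2)[OF E(1)]])
    show "linspace (ext_bound (ext_bound space_bound)) (ext_args (ext_args [num_val]))
       (\<lambda>x. 2 ^ ?n (fst (fst x)))"
      by (rule lift[OF linspace_power2_length])
  qed (rule linspace_good_cloud, intro linspace_intros, intro linspace_intros)
  have iff: "?P w \<longleftrightarrow> w \<in> {form_string \<phi> |\<phi>. S \<phi>}" for w
  proof -
    let ?y = "2 ^ (2 ^ ?n w * ?n w) :: nat"
    \<comment> \<open>The codes of parse tables lie below (n + 1) ^ n, hence below 2 ^ (2 ^ n * n),
      a number already available as a range for search.\<close>
    have "Suc (?n w) \<le> 2 ^ 2 ^ ?n w"
      using less_exp[of "?n w"] less_exp[of "2 ^ ?n w"] by linarith
    then have "Suc (?n w) ^ ?n w \<le> (2 ^ 2 ^ ?n w) ^ ?n w" by (rule power_mono) simp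
    then have y: "Suc (?n w) ^ ?n w \<le> ?y" by (simp only: power_mult)
    have "?P w \<longleftrightarrow> (\<exists>c<?y. table_ok (?n w) (?lt w) (length_at (?n w) c) \<and>
        S (form_at (?n w) (?lt w) (length_at (?n w) c) 0))"
    proof (intro ex_cong1 conj_cong)
      fix c assume t: "table_ok (?n w) (?lt w) (length_at (?n w) c)"
      have n: "?lt w i \<noteq> 0 \<Longrightarrow> i < ?n w" for i by (simp add: letter_at_num_val split: if_splits)
      interpret formula_table ssl rf "?n w" "?lt w" "?r w c" "?sm w c"
          "form_at (?n w) (?lt w) (length_at (?n w) c)" "\<lambda>i. sub_letter (?lt w i)"
        by (rule table_ok_formula_table[OF t n assms(2)])
      have "good_witness \<longleftrightarrow> (\<exists>C<2 ^ 2 ^ ?n w. good_cloud C \<and> (\<exists>t<2 ^ ?n w. bit C t \<and> bit t 0))"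
        unfolding good_witness_def good_cloud_def using goodD(1) good_bit_less by blast
      then show "(\<exists>C<2 ^ 2 ^ ?n w. good_cloud C \<and> (\<exists>t<2 ^ ?n w. bit C t \<and> bit t 0)) \<longleftrightarrow>
          S (form_at (?n w) (?lt w) (length_at (?n w) c) 0)"
        using S[OF formula_table_axioms] by blast
    qed simp_all
    also have "\<dots> \<longleftrightarrow> (\<exists>\<phi>. S \<phi> \<and> w = form_string \<phi>)"
      unfolding parse_iff[OF refl y] by blast
    finally show ?thesis by blast
  qed
  show "linspace_pred space_bound [num_val] (\<lambda>w. w \<in> {form_string \<phi> |\<phi>. S \<phi>})"
    by (rule linspace_pred_cong[OF lin iff])
  show "space_bound w \<le> 2 ^ (4 * (length w * 4 ^ length w))" for w
    unfolding space_bound_def by (rule power_increasing) auto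
  show "4 * n \<le> 4 * (n * 4 ^ n)" for n :: nat using exponent_bounds(1)[of n] by simp
  have "(\<lambda>n. real (4 * (n * 4 ^ n))) = (\<lambda>n. 4 * (real n * 2 ^ (2 * n)))" by (simp add: power_mult)
  moreover have "(\<lambda>n. 4 * (real n * 2 ^ (2 * n))) \<in> O(f)" using f by simp
  ultimately show "(\<lambda>n. real (4 * (n * 4 ^ n))) \<in> O(f)" by metis
  have "(\<lambda>_. 1) \<in> O(\<lambda>n. real n * 2 ^ (2 * n))"
  proof (rule landau_o.big_mono)
    show "\<forall>\<^sub>F n in sequentially. norm (1::real) \<le> norm (real n * 2 ^ (2 * n))"
      using eventually_ge_at_top[of "1::nat"]
    proof eventually_elim
      case (elim n)
      have "1 * 1 \<le> real n * 2 ^ (2 * n)" by (rule mult_mono) (use elim in auto)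
      then show ?case by simp
    qed
  qed
  then show "(\<lambda>_. 1) \<in> O(f)" using f by (rule landau_o.big_trans)
qed

context formula_table
begin

lemma product_good_witness:
  assumes "\<not> ssl" "product_satisfiable Y_frame TYPE('b) (fm 0)"
    and Y: "\<And>W R. Y_frame W R \<Longrightarrow> R \<subseteq> W \<times> W \<and> trans R \<and> (rf \<longrightarrow> refl_on W R)"
  shows good_witness
proof -
  from assms(2) obtain W1 R and W2 :: "'b set" and E \<sigma> x where
    fr: "Y_frame W1 R" "S5_frame W2 E" and M: "is_model (product_model W1 R W2 E \<sigma>)"
    and x: "x \<in> worlds (product_model W1 R W2 E \<sigma>)" "sat (product_model W1 R W2 E \<sigma>) x (fm 0)"
    unfolding product_satisfiable_def by blast
  let ?M = "product_model W1 R W2 E \<sigma>"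
  have sel: "worlds ?M = W1 \<times> W2" "((a, b), (a', b')) \<in> dia ?M \<longleftrightarrow> (a, a') \<in> R \<and> b = b' \<and> b \<in> W2"
    "((a, b), (a', b')) \<in> lrel ?M \<longleftrightarrow> (b, b') \<in> E \<and> a = a' \<and> a \<in> W1" for a b a' b'
    by (auto simp: product_model_def)
  have R: "R \<subseteq> W1 \<times> W1" "trans R" "rf \<Longrightarrow> refl_on W1 R" using Y[OF fr(1)] by auto
  have E: "equiv W2 E" using fr(2) by (simp add: S5_frame_def)
  have EW: "E \<subseteq> W2 \<times> W2" using E by (simp add: equiv_def)
  show ?thesis
  proof (rule model_good_witness[OF M _ _ _ _ _ _ x])
    show "trans (dia ?M)"
      using R(2) by (auto simp: trans_def sel)
    show "equiv (worlds ?M) (lrel ?M)"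
    proof (rule equivI)
      have "refl_on W2 E" "sym E" "trans E" using E by (auto simp: equiv_def)
      note E' = refl_onD[OF this(1)] symD[OF this(2)] transD[OF this(3)]
      show "lrel ?M \<subseteq> worlds ?M \<times> worlds ?M" using M by (simp add: is_model_def)
      show "refl_on (worlds ?M) (lrel ?M)" by (rule refl_onI) (auto simp: sel intro: E'(1))
      show "sym (lrel ?M)" by (rule symI) (auto simp: sel intro: E'(2))
      show "trans (lrel ?M)" by (rule transI) (auto simp: sel intro: E'(3))
    qed
    show "\<exists>w'. (w, w') \<in> lrel ?M \<and> (w', u') \<in> dia ?M" if "(w, u) \<in> dia ?M" "(u, u') \<in> lrel ?M" for w u u'
      using that R(1) EW by (cases w; cases u; cases u') (auto simp: sel)
    show "\<exists>u'. (u, u') \<in> lrel ?M \<and> (w', u') \<in> dia ?M" if "(w, u) \<in> dia ?M" "(w, w') \<in> lrel ?M" for w u w'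
      using that R(1) EW by (cases w; cases u; cases w') (auto simp: sel)
    show "(w, w) \<in> dia ?M" if rf "w \<in> worlds ?M" for w
      using that R(3) by (cases w) (auto simp: sel refl_on_def)
  qed (use assms(1) in simp)
qed

lemma SSL_good_witness:
  assumes ssl "SSL_satisfiable TYPE('w) (fm 0)"
  shows good_witness
proof -
  from assms(2) obtain M :: "'w model" and x where M: "cross_axiom_model M" "x \<in> worlds M" "sat M x (fm 0)"
    unfolding SSL_satisfiable_def by blast
  then have c: "is_model M" "preorder_on (worlds M) (dia M)" "equiv (worlds M) (lrel M)"
    by (auto simp: cross_axiom_model_def)
  show ?thesis
  proof (rule model_good_witness[OF c(1) _ c(3) _ _ _ _ M(2,3)])
    show "trans (dia M)" using c(2) by (simp add: preorder_on_def)
    show "(w, w) \<in> dia M" if "w \<in> worlds M" for w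
      using c(2) that by (auto simp: preorder_on_def refl_on_def)
  qed (use M(1) assms(1) in \<open>auto simp: cross_axiom_model_def\<close>)
qed

end

theorem theorem3p1:
  shows "K4_S5_SAT TYPE('a::infinite) TYPE('b::infinite) \<in> DSPACE (\<lambda>n. real n * 2 ^ (3 * n)) \<and>
    S4_S5_SAT TYPE('a) TYPE('b) \<in> DSPACE (\<lambda>n. real n * 2 ^ (2 * n)) \<and>
    SSL_SAT TYPE('w::infinite) \<in> DSPACE (\<lambda>n. real n * 2 ^ (2 * n))"
proof (intro conjI)
  show "K4_S5_SAT TYPE('a) TYPE('b) \<in> DSPACE (\<lambda>n. real n * 2 ^ (3 * n))"
    unfolding K4_S5_SAT_def
  proof (rule logic_DSPACE[where ssl = False and rf = False])
    fix n lt r sm fm sub assume "formula_table False False n lt r sm fm sub"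
    then interpret formula_table False False n lt r sm fm sub .
    show "product_satisfiable (K4_frame :: 'a set \<Rightarrow> _) TYPE('b) (fm 0) \<longleftrightarrow> good_witness"
    proof
      assume "product_satisfiable (K4_frame :: 'a set \<Rightarrow> _) TYPE('b) (fm 0)"
      then show good_witness by (rule product_good_witness[rotated]) (auto simp: K4_frame_def)
    next
      assume good_witness
      \<comment> \<open>The constructed model lives on uncountably many threads; a countable
        submodel of it carries over to any infinite types.\<close>
      then have "product_satisfiable (K4_frame :: (nat \<Rightarrow> nat) set \<Rightarrow> _) TYPE(nat) (fm 0)"
        by (intro good_witness_product) (auto simp: K4_frame_def)
      then show "product_satisfiable (K4_frame :: 'a set \<Rightarrow> _) TYPE('b) (fm 0)"
        by (rule product_universal[rotated]) (rule pullback_K4)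
    qed
  next
    \<comment> \<open>The common procedure meets the smaller bound for K4 as well; the exponent 3 *
      n follows by monotonicity.\<close>
    show "(\<lambda>n. real n * 2 ^ (2 * n)) \<in> O(\<lambda>n. real n * 2 ^ (3 * n))"
      by (intro landau_o.big_mono always_eventually allI) (auto intro!: mult_left_mono power_increasing)
  qed simp
next
  show "S4_S5_SAT TYPE('a) TYPE('b) \<in> DSPACE (\<lambda>n. real n * 2 ^ (2 * n))"
    unfolding S4_S5_SAT_def
  proof (rule logic_DSPACE[where ssl = False and rf = True])
    fix n lt r sm fm sub assume "formula_table False True n lt r sm fm sub"
    then interpret formula_table False True n lt r sm fm sub .
    show "product_satisfiable (S4_frame :: 'a set \<Rightarrow> _) TYPE('b) (fm 0) \<longleftrightarrow> good_witness"
    proof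
      assume "product_satisfiable (S4_frame :: 'a set \<Rightarrow> _) TYPE('b) (fm 0)"
      then show good_witness
        by (rule product_good_witness[rotated]) (auto simp: S4_frame_def preorder_on_def refl_on_def)
    next
      assume good_witness
      then have "product_satisfiable (S4_frame :: (nat \<Rightarrow> nat) set \<Rightarrow> _) TYPE(nat) (fm 0)"
        by (intro good_witness_product) (auto simp: S4_frame_def preorder_on_def refl_on_def)
      then show "product_satisfiable (S4_frame :: 'a set \<Rightarrow> _) TYPE('b) (fm 0)"
        by (rule product_universal[rotated]) (rule pullback_S4)
    qed
  qed simp_all
next
  show "SSL_SAT TYPE('w) \<in> DSPACE (\<lambda>n. real n * 2 ^ (2 * n))"
    unfolding SSL_SAT_def
  proof (rule logic_DSPACE[where ssl = True and rf = True])
    fix n lt r sm fm sub assume "formula_table True True n lt r sm fm sub"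
    then interpret formula_table True True n lt r sm fm sub .
    show "SSL_satisfiable TYPE('w) (fm 0) \<longleftrightarrow> good_witness"
      using SSL_good_witness good_witness_SSL SSL_universal by blast
  qed simp_all
qed

end
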